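(* Let $n\ge 3$, let $P=\mathit{As}^n$ be the $n$-dimensional associahedron (Stasheff polytope), and let $q=q(n)=\frac{n(n+2)}{4}$ if $n$ is even and $q=q(n)=\frac{(n+1)^2}{4}$ if $n$ is odd. Then the bigraded Betti numbers of $P$ satisfy $$\beta^{-q,2(q+1)}(P)=\begin{cases} n+3, & \text{if } n \text{ is even},\\ \frac{n+3}{2}, & \text{if } n \text{ is odd},\end{cases}$$ and $$\beta^{-i,2(i+1)}(P)=0\quad\text{for all } i\ge q+1.$$
   Context: Associahedron: $\mathit{As}^n$ is the simple convex $n$-dimensional polytope (defined up to combinatorial equivalence) whose $i$-dimensional faces, $0\le i\le n-1$, correspond bijectively to the sets of $n-i$ pairwise nonintersecting diagonals of a convex $(n+3)$-gon $G_{n+3}$ (diagonals with a common vertex are regarded as nonintersecting); a face $H$ is contained in a face $H'$ if and only if the set of diagonals corresponding to $H$ contains that corresponding to $H'$. In particular its facets correspond to the diagonals of $G_{n+3}$, and there are $m=\frac{n(n+3)}{2}$ of them. Bigraded Betti numbers: fix a field $\mathbf k$. For a simple polytope $P$ with facets $F_1,\dots,F_m$, let $K_P$ be the simplicial complex on $[m]=\{1,\dots,m\}$ whose simplices are the subsets $\{i_1,\dots,i_k\}$ with $F_{i_1}\cap\dots\cap F_{i_k}\neq\varnothing$ (the boundary of the dual simplicial polytope). The face ring is $\mathbf k[K_P]=\mathbf k[v_1,\dots,v_m]/\mathcal I$, $\deg v_i=2$, where $\mathcal I$ is generated by the square-free monomials $v_{i_1}\cdots v_{i_k}$ with $\{i_1,\dots,i_k\}$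 not a simplex of $K_P$. Set $\beta^{-i,2j}(P)=\dim_{\mathbf k}\operatorname{Tor}^{-i,2j}_{\mathbf k[v_1,\dots,v_m]}(\mathbf k[K_P],\mathbf k)$, where $\operatorname{Tor}^{-i,2j}$ is the part of $\operatorname{Tor}_i$ of internal degree $2j$. *)

theory Defs
  imports
    "HOL-Analysis.Analysis"
    "HOL-Library.Poly_Mapping"
    "HOL-Library.Function_Algebras"
    "HOL-Algebra.Ideal"
begin

section \<open>Graded polynomial rings and face rings\<close>

type_synonym ('v, 'k) mpoly = "('v \<Rightarrow>\<^sub>0 nat) \<Rightarrow>\<^sub>0 'k"

text \<open>
  The type \<open>('v, 'k) mpoly\<close> has one variable for each element of \<open>'v\<close>; the polynomial ring
  \<open>k[V]\<close> in the variables \<open>V\<close> is a subring of it. Restricting to \<open>V\<close> matters, because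
  Tor over a polynomial ring changes when superfluous variables are added.
\<close>

definition polys :: "'v set \<Rightarrow> ('v, 'k::zero) mpoly set" where
  "polys V = {p. \<forall>u\<in>Poly_Mapping.keys p. Poly_Mapping.keys u \<subseteq> V}"

definition poly_ring :: "'v set \<Rightarrow> ('v, 'k::field) mpoly ring" where
  "poly_ring V =
     \<lparr>carrier = polys V, monoid.mult = (*), one = 1, ring.zero = 0, add = (+)\<rparr>"

definition mvar :: "'v \<Rightarrow> ('v, 'k::field) mpoly" where
  "mvar v = Poly_Mapping.single (Poly_Mapping.single v 1) 1"

text \<open>Every variable has degree 2.\<close>

definition mon_deg :: "('v \<Rightarrow>\<^sub>0 nat) \<Rightarrow> nat" where
  "mon_deg u = 2 * (\<Sum>v\<in>Poly_Mapping.keys u. Poly_Mapping.lookup u v)"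

definition hom_of_deg :: "nat \<Rightarrow> ('v, 'k::zero) mpoly \<Rightarrow> bool" where
  "hom_of_deg d p \<longleftrightarrow> (\<forall>u\<in>Poly_Mapping.keys p. mon_deg u = d)"

text \<open>
  For a simplicial complex \<open>K\<close> on the vertex set \<open>V\<close>, the face ring is the quotient of
  \<open>k[V]\<close> by the following ideal.
\<close>

definition face_ideal :: "'v set \<Rightarrow> 'v set set \<Rightarrow> ('v, 'k::field) mpoly set" where
  "face_ideal V K = genideal (poly_ring V) {\<Prod>v\<in>S. mvar v | S. S \<subseteq> V \<and> S \<notin> K}"

section \<open>Graded free resolutions and Tor\<close>

text \<open>
  A sequence of finitely generated graded free \<open>k[V]\<close>-modules
  \<open>\<dots> \<rightarrow> F\<^sub>1 \<rightarrow> F\<^sub>0\<close> with bases fixed: \<open>F\<^sub>i\<close> has basis elements \<open>e\<^sub>a\<close> for \<open>a < fr_rank F i\<close>, where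
  \<open>e\<^sub>a\<close> has internal degree \<open>fr_deg F i a\<close>. The polynomial \<open>fr_diff F i a c\<close> is the
  coefficient of \<open>e\<^sub>a \<in> F\<^sub>i\<close> in the image of \<open>e\<^sub>c \<in> F\<^sub>i\<^sub>+\<^sub>1\<close>, and the augmentation \<open>F\<^sub>0 \<rightarrow> k[V]/I\<close>
  sends \<open>e\<^sub>a\<close> to the class of \<open>fr_aug F a\<close>.
\<close>

record 'p free_complex =
  fr_rank :: "nat \<Rightarrow> nat"
  fr_deg :: "nat \<Rightarrow> nat \<Rightarrow> nat"
  fr_diff :: "nat \<Rightarrow> nat \<Rightarrow> nat \<Rightarrow> 'p"
  fr_aug :: "nat \<Rightarrow> 'p"

definition fr_mod :: "'v set \<Rightarrow> ('v, 'k::field) mpoly free_complex \<Rightarrow> nat \<Rightarrow> (nat \<Rightarrow> ('v, 'k) mpoly) set"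
  where
  "fr_mod V F i =
     {x. (\<forall>a<fr_rank F i. x a \<in> polys V) \<and> (\<forall>a\<ge>fr_rank F i. x a = 0)}"

definition fr_map ::
  "('v, 'k::field) mpoly free_complex \<Rightarrow> nat \<Rightarrow> (nat \<Rightarrow> ('v, 'k) mpoly) \<Rightarrow> nat \<Rightarrow> ('v, 'k) mpoly" where
  "fr_map F i x a =
     (if a < fr_rank F i then \<Sum>c<fr_rank F (Suc i). fr_diff F i a c * x c else 0)"

definition fr_eps :: "('v, 'k::field) mpoly free_complex \<Rightarrow> (nat \<Rightarrow> ('v, 'k) mpoly) \<Rightarrow> ('v, 'k) mpoly"
  where
  "fr_eps F x = (\<Sum>a<fr_rank F 0. fr_aug F a * x a)"

definition graded_free_complex :: "'v set \<Rightarrow> ('v, 'k::field) mpoly free_complex \<Rightarrow> bool" where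
  "graded_free_complex V F \<longleftrightarrow>
     (\<forall>a<fr_rank F 0. fr_aug F a \<in> polys V \<and> hom_of_deg (fr_deg F 0 a) (fr_aug F a)) \<and>
     (\<forall>i. \<forall>a<fr_rank F i. \<forall>c<fr_rank F (Suc i).
        fr_diff F i a c \<in> polys V \<and>
        (\<forall>u\<in>Poly_Mapping.keys (fr_diff F i a c).
           mon_deg u + fr_deg F i a = fr_deg F (Suc i) c))"

text \<open>
  Exactness of \<open>\<dots> \<rightarrow> F\<^sub>1 \<rightarrow> F\<^sub>0 \<rightarrow> k[V]/I \<rightarrow> 0\<close>, at \<open>k[V]/I\<close>, at \<open>F\<^sub>0\<close>, and at
  \<open>F\<^sub>i\<^sub>+\<^sub>1\<close> respectively.
\<close>

definition graded_free_resolution ::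
  "'v set \<Rightarrow> ('v, 'k::field) mpoly set \<Rightarrow> ('v, 'k) mpoly free_complex \<Rightarrow> bool" where
  "graded_free_resolution V I F \<longleftrightarrow>
     graded_free_complex V F \<and>
     (\<forall>p\<in>polys V. \<exists>x\<in>fr_mod V F 0. p - fr_eps F x \<in> I) \<and>
     {x \<in> fr_mod V F 0. fr_eps F x \<in> I} = fr_map F 0 ` fr_mod V F 1 \<and>
     (\<forall>i. {x \<in> fr_mod V F (Suc i). fr_map F i x = 0} =
            fr_map F (Suc i) ` fr_mod V F (Suc (Suc i)))"

text \<open>
  Here \<open>k\<close> is the \<open>k[V]\<close>-module \<open>k[V]/(v : v \<in> V)\<close>, on which a polynomial acts through its
  constant term. So \<open>F\<^sub>i \<otimes> k\<close> is the vector space with basis \<open>e\<^sub>a\<close>, \<open>a < fr_rank F i\<close>, and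
  the matrix of the differential of \<open>F \<otimes> k\<close> consists of the constant terms
  of the entries of the original one. \<open>tens_space F i d\<close> is the part of \<open>F\<^sub>i \<otimes> k\<close> of internal
  degree \<open>d\<close>.
\<close>

definition tens_space :: "('v, 'k::field) mpoly free_complex \<Rightarrow> nat \<Rightarrow> nat \<Rightarrow> (nat \<Rightarrow> 'k) set" where
  "tens_space F i d = {x. \<forall>a. x a \<noteq> 0 \<longrightarrow> a < fr_rank F i \<and> fr_deg F i a = d}"

definition tens_map :: "('v, 'k::field) mpoly free_complex \<Rightarrow> nat \<Rightarrow> (nat \<Rightarrow> 'k) \<Rightarrow> nat \<Rightarrow> 'k" where
  "tens_map F i x a =
     (if a < fr_rank F i
      then \<Sum>c<fr_rank F (Suc i). Poly_Mapping.lookup (fr_diff F i a c) 0 * x c else 0)"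

definition tens_cycles :: "('v, 'k::field) mpoly free_complex \<Rightarrow> nat \<Rightarrow> nat \<Rightarrow> (nat \<Rightarrow> 'k) set" where
  "tens_cycles F i d =
     {x \<in> tens_space F i d. case i of 0 \<Rightarrow> True | Suc i' \<Rightarrow> tens_map F i' x = 0}"

definition tens_boundaries :: "('v, 'k::field) mpoly free_complex \<Rightarrow> nat \<Rightarrow> nat \<Rightarrow> (nat \<Rightarrow> 'k) set" where
  "tens_boundaries F i d = tens_map F i ` tens_space F (Suc i) d"

definition fun_scale :: "'k::field \<Rightarrow> (nat \<Rightarrow> 'k) \<Rightarrow> nat \<Rightarrow> 'k" where
  "fun_scale c x = (\<lambda>a. c * x a)"

interpretation funs: vector_space "fun_scale :: 'k::field \<Rightarrow> (nat \<Rightarrow> 'k) \<Rightarrow> nat \<Rightarrow> 'k"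
  by unfold_locales (auto simp: fun_scale_def fun_eq_iff algebra_simps)

text \<open>
  The dimension of the degree \<open>d\<close> part of the \<open>i\<close>-th homology of \<open>F \<otimes> k\<close>; if \<open>F\<close> is a
  complex, the boundaries form a subspace of the finite-dimensional space of cycles.
\<close>

definition tens_homology_dim :: "('v, 'k::field) mpoly free_complex \<Rightarrow> nat \<Rightarrow> nat \<Rightarrow> nat" where
  "tens_homology_dim F i d = funs.dim (tens_cycles F i d) - funs.dim (tens_boundaries F i d)"

text \<open>
  The dimension of the part of \<open>Tor\<^sub>i(k[V]/I, k)\<close> of internal degree \<open>d\<close>, over the ring \<open>k[V]\<close>
  with \<open>V\<close> finite, computed as usual from a chosen graded free resolution of \<open>k[V]/I\<close>.
\<close>

definition tor_dim :: "'v set \<Rightarrow> ('v, 'k::field) mpoly set \<Rightarrow> nat \<Rightarrow> nat \<Rightarrow> nat" where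
  "tor_dim V I i d = tens_homology_dim (SOME F. graded_free_resolution V I F) i d"

section \<open>Simple polytopes and their bigraded Betti numbers\<close>

definition simple_polytope :: "nat \<Rightarrow> 'a::euclidean_space set \<Rightarrow> bool" where
  "simple_polytope n P \<longleftrightarrow> polytope P \<and> aff_dim P = int n \<and>
     (\<forall>x. x extreme_point_of P \<longrightarrow> card {F. F facet_of P \<and> x \<in> F} = n)"

definition facets :: "'a::euclidean_space set \<Rightarrow> 'a set set" where
  "facets P = {F. F facet_of P}"

text \<open>
  The complex \<open>K\<^sub>P\<close>, with the facets themselves as vertices instead of an enumeration of them.
  The empty simplex belongs to it because \<open>\<Inter>{} = UNIV\<close>.
\<close>

definition polytope_complex :: "'a::euclidean_space set \<Rightarrow> 'a set set set" where
  "polytope_complex P = {S. S \<subseteq> facets P \<and> \<Inter>S \<noteq> {}}"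

text \<open>\<open>bigraded_betti TYPE('k) P i d\<close> is \<open>\<beta>\<^sup>-\<^sup>i\<^sup>,\<^sup>d(P)\<close> over the field \<open>'k\<close>.\<close>

definition bigraded_betti :: "'k::field itself \<Rightarrow> 'a::euclidean_space set \<Rightarrow> nat \<Rightarrow> nat \<Rightarrow> nat" where
  "bigraded_betti _ P i d =
     tor_dim (facets P) (face_ideal (facets P) (polytope_complex P) :: ('a set, 'k) mpoly set) i d"

section \<open>The associahedron\<close>

text \<open>
  The points \<open>w 0, \<dots>, w (N - 1)\<close> are the vertices of a convex \<open>N\<close>-gon, listed
  counterclockwise: any three of them, taken in this order, span a positively oriented triangle.
\<close>

definition convex_polygon :: "nat \<Rightarrow> (nat \<Rightarrow> complex) \<Rightarrow> bool" where
  "convex_polygon N w \<longleftrightarrow>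
     (\<forall>a b c. a < b \<and> b < c \<and> c < N \<longrightarrow> Im (cnj (w b - w a) * (w c - w a)) > 0)"

text \<open>The pair \<open>(a, b)\<close> stands for the diagonal joining the vertices \<open>w a\<close> and \<open>w b\<close>.\<close>

definition polygon_diagonals :: "nat \<Rightarrow> (nat \<times> nat) set" where
  "polygon_diagonals N = {(a, b). Suc a < b \<and> b < N \<and> \<not> (a = 0 \<and> b = N - 1)}"

text \<open>Open segments are used since diagonals with a common vertex count as nonintersecting.\<close>

definition nonintersecting :: "(nat \<Rightarrow> complex) \<Rightarrow> nat \<times> nat \<Rightarrow> nat \<times> nat \<Rightarrow> bool" where
  "nonintersecting w D E \<longleftrightarrow>
     open_segment (w (fst D)) (w (snd D)) \<inter> open_segment (w (fst E)) (w (snd E)) = {}"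

definition diagonal_sets :: "nat \<Rightarrow> (nat \<Rightarrow> complex) \<Rightarrow> nat \<Rightarrow> (nat \<times> nat) set set" where
  "diagonal_sets N w k =
     {X. X \<subseteq> polygon_diagonals N \<and> card X = k \<and> pairwise (nonintersecting w) X}"

definition associahedron :: "nat \<Rightarrow> 'a::euclidean_space set \<Rightarrow> bool" where
  "associahedron n P \<longleftrightarrow> simple_polytope n P \<and>
     (\<exists>w \<delta>. convex_polygon (n + 3) w \<and>
        (\<forall>i<n. bij_betw \<delta> {H. H face_of P \<and> aff_dim H = int i}
                          (diagonal_sets (n + 3) w (n - i))) \<and>
        (\<forall>H H'. H face_of P \<and> H' face_of P \<and>
           aff_dim H \<in> {0..<int n} \<and> aff_dim H' \<in> {0..<int n} \<longrightarrow>
           (H \<subseteq> H' \<longleftrightarrow> \<delta> H' \<subseteq> \<delta> H)))"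

end

(* Tor of the face ring of K can be read off from any free resolution F of it and from the Koszul
   resolution of k: in the double complex of F tensored with the Koszul complex, the homology of
   F \<otimes> k is carried along a zigzag of linear relations to the Koszul homology of the face ring.
   (A resolution exists: the Taylor resolution.) In the linear strand, the latter is the sum over all
   vertex sets U of size i + 1 of the space of functions on U that are constant on the edges of K,
   modulo the constants.

   For the associahedron, such a U is a set of diagonals, and it contributes only if it splits into
   nonempty parts A and B such that every diagonal of A crosses every diagonal of B. The endpoints of A
   and of B are disjoint, and a set of diagonals with s endpoints that are all crossed by one diagonal has
   at most s^2/4 elements. Hence U has at most q + 1 elements, with equality only if U consists of one
   diagonal dividing the polygon as evenly as possible and of all the diagonals that cross it. *)

theory Submission
  imports Defs
begin

text \<open>\<open>tor_dim\<close> takes an unspecified resolution, so the dimension is computed for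
  an arbitrary \<open>F\<close>. The differentials of the double complex have no canonical sections;
  relating chains that are joined by a step of the zigzag avoids choosing lifts, and relations
  compose.

  The Taylor and the Koszul complex are exact for the same reason. Once each coefficient is
  multiplied by the monomial of its basis element, both differentials act on every monomial
  separately, as the boundary of a simplex, and a cone whose apex depends on the monomial contracts
  it.

  The linear strand is accessible because no monomial of degree at most 2 lies in the face ideal:
  the chains concerned are the same over k[V] and over the face ring, only the cycle condition is
  weaker over the latter.

  Both formulas for q give the integer part of (n+1)^2/4, the largest product of two numbers with
  sum n+1, these being the numbers of vertices on the two sides of a diagonal. If A and B both have
  at least three endpoints, they have at most (9+n^2)/4 diagonals together, and n \<ge> 3 puts this
  below q+1.\<close>

abbreviation lk :: "('a \<Rightarrow>\<^sub>0 'b::zero) \<Rightarrow> 'a \<Rightarrow> 'b" where "lk \<equiv> Poly_Mapping.lookup"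
abbreviation ks :: "('a \<Rightarrow>\<^sub>0 'b::zero) \<Rightarrow> 'a set" where "ks \<equiv> Poly_Mapping.keys"
abbreviation sing :: "'a \<Rightarrow> 'b::zero \<Rightarrow> ('a \<Rightarrow>\<^sub>0 'b)" where "sing \<equiv> Poly_Mapping.single"

section \<open>Monomials\<close>

definition chi :: "'v set \<Rightarrow> 'v \<Rightarrow>\<^sub>0 nat" where
  "chi A = (\<Sum>v\<in>A. sing v 1)"

definition xmon :: "'v set \<Rightarrow> ('v, 'k::comm_ring_1) mpoly" where
  "xmon A = sing (chi A) 1"

lemma lookup_chi: "finite A \<Longrightarrow> lk (chi A) v = (if v \<in> A then 1 else 0)"
proof -
  assume A: "finite A"
  have "lk (chi A) v = (\<Sum>w\<in>A. if w = v then 1 else 0)"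
    by (auto simp: chi_def lookup_sum lookup_single when_def intro!: sum.cong)
  then show ?thesis using A by simp
qed

lemma keys_chi [simp]: "finite A \<Longrightarrow> ks (chi A) = A"
  by (auto simp: in_keys_iff lookup_chi split: if_splits)

lemma chi_empty [simp]: "chi {} = 0"
  by (simp add: chi_def)

lemma chi_singleton: "chi {v} = sing v 1"
  by (simp add: chi_def)

lemma chi_inject: "finite A \<Longrightarrow> finite B \<Longrightarrow> chi A = chi B \<longleftrightarrow> A = B"
  by (metis keys_chi)

lemma chi_union: "finite A \<Longrightarrow> finite B \<Longrightarrow> A \<inter> B = {} \<Longrightarrow> chi (A \<union> B) = chi A + chi B"
  unfolding chi_def by (simp add: sum.union_disjoint)

lemma chi_insert: "finite A \<Longrightarrow> v \<notin> A \<Longrightarrow> chi (insert v A) = chi A + chi {v}"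
  by (simp add: chi_def add.commute)

lemma keys_add_nat: "ks ((u :: 'v \<Rightarrow>\<^sub>0 nat) + w) = ks u \<union> ks w"
  by (auto simp: in_keys_iff lookup_add)

lemma chi_le: "finite A \<Longrightarrow> A \<subseteq> ks (u :: 'v \<Rightarrow>\<^sub>0 nat) \<Longrightarrow> \<exists>w. u = chi A + w"
proof
  assume A: "finite A" "A \<subseteq> ks u"
  show "u = chi A + (u - chi A)"
  proof (rule poly_mapping_eqI)
    fix v
    have "v \<in> A \<Longrightarrow> lk u v \<ge> 1" using A by (force simp: in_keys_iff)
    then show "lk u v = lk (chi A + (u - chi A)) v"
      using A by (auto simp: lookup_add lookup_minus lookup_chi)
  qed
qed

lemma mon_deg_superset:
  assumes "finite A" "ks u \<subseteq> A" shows "mon_deg u = 2 * (\<Sum>v\<in>A. lk u v)"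
proof -
  have "(\<Sum>v\<in>ks u. lk u v) = (\<Sum>v\<in>A. lk u v)"
    by (rule sum.mono_neutral_left) (use assms in \<open>auto simp: in_keys_iff\<close>)
  then show ?thesis by (simp add: mon_deg_def)
qed

lemma mon_deg_add: "mon_deg (u + w) = mon_deg u + mon_deg w"
proof -
  have f: "finite (ks u \<union> ks w)" by simp
  show ?thesis
    using mon_deg_superset[OF f, of "u + w"] mon_deg_superset[OF f, of u] mon_deg_superset[OF f, of w]
    by (simp add: keys_add_nat lookup_add sum.distrib)
qed

lemma mon_deg_chi: "finite A \<Longrightarrow> mon_deg (chi A) = 2 * card A"
  using mon_deg_superset[of A "chi A"] by (simp add: lookup_chi)

lemma mon_deg_zero [simp]: "mon_deg 0 = 0"
  by (simp add: mon_deg_def)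

lemma mon_deg_eq_0_iff: "mon_deg u = 0 \<longleftrightarrow> u = 0"
proof
  assume "mon_deg u = 0"
  then have "\<forall>v\<in>ks u. lk u v = 0" by (simp add: mon_deg_def)
  then have "\<And>v. lk u v = 0" by (metis in_keys_iff)
  then show "u = 0" by (intro poly_mapping_eqI) simp
qed simp

lemma mon_deg_eq_2D: assumes "mon_deg u = 2" shows "\<exists>v. u = chi {v}"
proof -
  have "u \<noteq> 0" using assms by auto
  then obtain v where v: "v \<in> ks u" by (metis all_not_in_conv keys_eq_empty)
  then obtain w where w: "u = chi {v} + w" using chi_le[of "{v}" u] by auto
  then have "mon_deg w = 0" using assms by (simp add: mon_deg_add mon_deg_chi)
  then show ?thesis using w by (auto simp: mon_deg_eq_0_iff)
qed

section \<open>Coefficients of polynomials\<close>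

lemma lookup_mult_sing: "lk (sing m c * p) (m + u) = c * lk (p :: ('v, 'k::comm_ring_1) mpoly) u"
proof -
  have "lk (sing m c * p) (m + u) = (\<Sum>l. (c * (\<Sum>q. lk p q when m + u = m + q)) when l = m)"
    unfolding lookup_mult by (rule Sum_any.cong) (auto simp: when_def lookup_single)
  then show ?thesis by simp
qed

lemma keys_mult_sing:
  assumes "lk (sing m c * p) u \<noteq> 0"
  shows "\<exists>w. u = m + w \<and> lk (p :: ('v, 'k::comm_ring_1) mpoly) w \<noteq> 0"
proof -
  have "u \<in> ks (sing m c * p)" using assms by (simp add: in_keys_iff)
  then obtain w where "u = m + w" using keys_mult[of "sing m c" p] by (auto split: if_splits)
  then show ?thesis using assms lookup_mult_sing[of m c p w] by (intro exI[of _ w]) auto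
qed

lemma lookup_mult_sing0: "lk (sing 0 c * p) u = c * lk (p :: ('v, 'k::comm_ring_1) mpoly) u"
  using lookup_mult_sing[of 0 c p u] by simp

text \<open>Exponents are natural numbers, so \<open>0 = l + q\<close> only for
  \<open>l = q = 0\<close>; taking constant terms is therefore multiplicative. This is what connects
  a resolution with its tensor product with k.\<close>

lemma lookup_mult_0: "lk (f * g) 0 = lk f 0 * lk (g :: ('v, 'k::comm_ring_1) mpoly) 0"
proof -
  have nz: "0 = l + q \<longleftrightarrow> l = 0 \<and> q = 0" for l q :: "'v \<Rightarrow>\<^sub>0 nat"
    by (auto simp: poly_mapping_eq_iff lookup_add fun_eq_iff)
  have "lk (f * g) 0 = (\<Sum>l. (lk f 0 * lk g 0) when l = (0 :: 'v \<Rightarrow>\<^sub>0 nat))"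
    unfolding lookup_mult nz
  proof (rule arg_cong[where f = Sum_any], rule ext)
    fix l
    show "lk f l * (\<Sum>q. lk g q when l = 0 \<and> q = 0) = (lk f 0 * lk g 0 when l = 0)"
      by (cases "l = 0") (auto simp: when_def)
  qed
  then show ?thesis by simp
qed

lemma lookup_minus1_power: "lk ((-1) ^ n * p) u = (-1) ^ n * lk (p :: ('v, 'k::comm_ring_1) mpoly) u"
  by (induction n) auto

lemma in_keys_multE:
  assumes "lk ((f :: ('v, 'k::comm_ring_1) mpoly) * g) u \<noteq> 0"
  obtains a b where "u = a + b" "lk f a \<noteq> 0" "lk g b \<noteq> 0"
proof -
  have "u \<in> ks (f * g)" using assms by (simp add: in_keys_iff)
  then show ?thesis using keys_mult[of f g] that by (fastforce simp: in_keys_iff)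
qed

lemma lookup_sum_nonzeroE:
  assumes "lk (\<Sum>x\<in>A. f x) u \<noteq> 0" obtains x where "x \<in> A" "lk (f x) u \<noteq> 0"
proof -
  have "(\<Sum>x\<in>A. lk (f x) u) \<noteq> 0" using assms by (simp add: lookup_sum)
  then obtain x where "x \<in> A" "lk (f x) u \<noteq> 0" by (rule sum.not_neutral_contains_not_neutral)
  then show ?thesis by (rule that)
qed

text \<open>Serves both to extract homogeneous components and, in \<open>contraction\<close>, to
  sort the terms of a polynomial by the vertex picked for their exponent.\<close>

definition cut :: "('u \<Rightarrow> bool) \<Rightarrow> ('u \<Rightarrow>\<^sub>0 'k::zero) \<Rightarrow> ('u \<Rightarrow>\<^sub>0 'k)" where
  "cut Q p = Abs_poly_mapping (\<lambda>u. if Q u then lk p u else 0)"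

lemma lookup_cut [simp]: "lk (cut Q p) u = (if Q u then lk p u else 0)"
proof -
  have "{u. (if Q u then lk p u else 0) \<noteq> 0} \<subseteq> {u. lk p u \<noteq> 0}" by auto
  then have "finite {u. (if Q u then lk p u else 0) \<noteq> 0}" by (rule finite_subset) simp
  then show ?thesis by (simp add: cut_def)
qed

lemma cut_id: "(\<And>u. lk p u \<noteq> 0 \<Longrightarrow> Q u) \<Longrightarrow> cut Q p = p"
  by (rule poly_mapping_eqI) auto

lemma cut_sum: "cut Q (\<Sum>x\<in>A. f x) = (\<Sum>x\<in>A. cut Q (f x))"
  by (rule poly_mapping_eqI) (auto simp: lookup_sum)

text \<open>The part of \<open>g\<close> selected by \<open>R\<close> yields only terms selected by
  \<open>Q\<close>, the rest yields none, so no cancellation mixes the two. For a homogeneous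
  \<open>f\<close>, multiplication thus commutes with taking homogeneous components, up to a shift
  of degree.\<close>

lemma cut_mult:
  assumes "\<And>a b. lk f a \<noteq> 0 \<Longrightarrow> lk g b \<noteq> 0 \<Longrightarrow> Q (a + b) \<longleftrightarrow> R b"
  shows "cut Q (f * g) = f * cut R (g :: ('v, 'k::comm_ring_1) mpoly)"
proof -
  have g: "g = cut R g + cut (\<lambda>u. \<not> R u) g"
    by (rule poly_mapping_eqI) (auto simp: lookup_add)
  have 1: "cut Q (f * cut R g) = f * cut R g"
  proof (rule cut_id)
    fix u assume "lk (f * cut R g) u \<noteq> 0"
    then show "Q u" by (rule in_keys_multE) (use assms in \<open>auto split: if_splits\<close>)
  qed
  have 2: "cut Q (f * cut (\<lambda>u. \<not> R u) g) = 0"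
  proof (rule poly_mapping_eqI)
    fix u show "lk (cut Q (f * cut (\<lambda>u. \<not> R u) g)) u = lk 0 u"
    proof (rule ccontr)
      assume "\<not> ?thesis"
      then have *: "Q u" "lk (f * cut (\<lambda>u. \<not> R u) g) u \<noteq> 0" by (auto split: if_splits)
      from *(2) show False by (rule in_keys_multE) (use assms *(1) in \<open>auto split: if_splits\<close>)
    qed
  qed
  have "cut Q (f * g) = cut Q (f * cut R g + f * cut (\<lambda>u. \<not> R u) g)"
    by (subst g) (simp add: distrib_left)
  also have "\<dots> = cut Q (f * cut R g) + cut Q (f * cut (\<lambda>u. \<not> R u) g)"
    by (rule poly_mapping_eqI) (auto simp: lookup_add)
  finally show ?thesis by (simp add: 1 2)
qed

text \<open>The quotient by the square-free monomial is obtained by shifting exponents; injectivity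
  of the shift keeps its support finite.\<close>

lemma xmon_factor:
  assumes "finite A" "\<And>u. lk p u \<noteq> 0 \<Longrightarrow> A \<subseteq> ks u"
  obtains g where "p = xmon A * g"
proof -
  have inj: "inj (\<lambda>u. chi A + u)" by (simp add: inj_def)
  have "{u. lk p (chi A + u) \<noteq> 0} = (\<lambda>u. chi A + u) -` {u. lk p u \<noteq> 0}" by auto
  moreover have "finite ((\<lambda>u. chi A + u) -` {u. lk p u \<noteq> 0})"
    by (rule finite_vimageI) (auto simp: inj)
  ultimately have "finite {u. lk p (chi A + u) \<noteq> 0}" by simp
  then have lg: "lk (Abs_poly_mapping (\<lambda>u. lk p (chi A + u))) u = lk p (chi A + u)" for u by simp
  have "p = xmon A * Abs_poly_mapping (\<lambda>u. lk p (chi A + u))" (is "p = _ * ?g")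
  proof (rule poly_mapping_eqI)
    fix u
    show "lk p u = lk (xmon A * ?g) u"
    proof (cases "\<exists>w. u = chi A + w")
      case True then show ?thesis by (auto simp: xmon_def lookup_mult_sing lg)
    next
      case False
      then have "lk p u = 0" using assms chi_le by blast
      moreover have "lk (xmon A * ?g) u = 0"
        using False keys_mult_sing unfolding xmon_def by blast
      ultimately show ?thesis by simp
    qed
  qed
  then show ?thesis by (rule that)
qed

lemma lookup_xmon_mult: "lk (xmon A * g) (chi A + u) = lk (g :: ('v, 'k::comm_ring_1) mpoly) u"
  by (simp add: xmon_def lookup_mult_sing)

lemma xmon_mult_nonzeroE:
  assumes "lk (xmon A * (g :: ('v, 'k::comm_ring_1) mpoly)) u \<noteq> 0"
  obtains w where "u = chi A + w" "lk g w \<noteq> 0"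
  using keys_mult_sing[of "chi A" 1 g u] assms unfolding xmon_def by blast

lemma xmon_cancel: "xmon A * g = xmon A * h \<longleftrightarrow> g = (h :: ('v, 'k::comm_ring_1) mpoly)"
  by (metis lookup_xmon_mult poly_mapping_eqI)

lemma xmon_union: "finite A \<Longrightarrow> finite B \<Longrightarrow> A \<inter> B = {} \<Longrightarrow> xmon (A \<union> B) = xmon A * xmon B"
  by (simp add: xmon_def mult_single chi_union)

section \<open>The simplex with coefficients in polynomials\<close>

text \<open>The element type carries no order, so a numbering \<open>r\<close> provides the one
  needed for the usual alternating signs.\<close>

definition sg :: "('e \<Rightarrow> nat) \<Rightarrow> 'e \<Rightarrow> 'e set \<Rightarrow> 'c::comm_ring_1" where
  "sg r e T = (-1) ^ card {f \<in> T. r f < r e}"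

lemma sg_mult_self [simp]: "sg r e T * sg r e T = 1"
  by (simp add: sg_def flip: power_mult_distrib)

lemma sg_mult_self' [simp]: "sg r e T * (sg r e T * x) = x"
  by (simp flip: mult.assoc)

lemma lookup_sg: "lk (sg r e T * p) u = sg r e T * lk (p :: ('v, 'k::comm_ring_1) mpoly) u"
  by (simp add: sg_def lookup_minus1_power)

lemma sg_nz [simp]: "sg r e T \<noteq> (0 :: 'c::idom)"
  by (simp add: sg_def)

lemma sg_insert:
  assumes "finite T" "f \<notin> T"
  shows "sg r e (insert f T) = (if r f < r e then - sg r e T else (sg r e T :: 'c::comm_ring_1))"
proof -
  have "{x \<in> insert f T. r x < r e} =
        (if r f < r e then insert f {x \<in> T. r x < r e} else {x \<in> T. r x < r e})"
    by auto
  then show ?thesis using assms by (simp add: sg_def)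
qed

text \<open>Exactly one of \<open>e\<close> and \<open>f\<close> precedes the other, so just one of
  the two signs changes with the order of insertion.\<close>

lemma sg_swap:
  assumes "finite T" "f \<notin> T" "e \<notin> T" "r e \<noteq> r f"
  shows "sg r e T * sg r f (insert e T) = - (sg r f T * sg r e (insert f T) :: 'c::comm_ring_1)"
  using assms by (auto simp: sg_insert)

text \<open>\<open>y\<close> is read as the chain with coefficient \<open>y S\<close> at the simplex
  \<open>S\<close>; the coefficient of \<open>T\<close> in its boundary collects the simplices with
  one vertex more. The empty simplex takes part, so the complex is the augmented one.\<close>

definition bd :: "('e \<Rightarrow> nat) \<Rightarrow> 'e set \<Rightarrow> ('e set \<Rightarrow> 'c::comm_ring_1) \<Rightarrow> 'e set \<Rightarrow> 'c" where
  "bd r E y T = (if T \<subseteq> E then \<Sum>e\<in>E - T. sg r e T * y (insert e T) else 0)"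

text \<open>The cone operator, with apex \<open>pick u\<close> for the terms with exponent
  \<open>u\<close>. The apex may vary because \<open>bd\<close> has constant coefficients and so
  does not mix exponents.\<close>

definition contraction ::
  "('e \<Rightarrow> nat) \<Rightarrow> 'e set \<Rightarrow> (('v \<Rightarrow>\<^sub>0 nat) \<Rightarrow> 'e) \<Rightarrow> ('e set \<Rightarrow> ('v, 'k::comm_ring_1) mpoly)
    \<Rightarrow> 'e set \<Rightarrow> ('v, 'k) mpoly" where
  "contraction r E pick y S =
     (if S \<subseteq> E then \<Sum>e\<in>S. sg r e (S - {e}) * cut (\<lambda>u. pick u = e) (y (S - {e})) else 0)"

lemma lookup_contraction:
  assumes "finite S" "S \<subseteq> E"
  shows "lk (contraction r E pick y S) u =
    (if pick u \<in> S then sg r (pick u) (S - {pick u}) * lk (y (S - {pick u})) u else 0)"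
proof -
  have "lk (contraction r E pick y S) u =
      (\<Sum>e\<in>S. if e = pick u then sg r (pick u) (S - {pick u}) * lk (y (S - {pick u})) u else 0)"
    using assms by (simp only: contraction_def lookup_sum lookup_sg lookup_cut if_True)
      (rule sum.cong, auto)
  then show ?thesis using assms by simp
qed

text \<open>At an exponent \<open>u\<close> with apex \<open>a\<close>, this is the cone formula. If
  \<open>a\<close> is not in \<open>T\<close>, only the summand that adjoins \<open>a\<close>
  survives; if it is, the cycle condition at \<open>T - {a}\<close> turns the sum back into
  \<open>y T\<close>.\<close>

lemma bd_contraction:
  fixes y :: "'e set \<Rightarrow> ('v, 'k::comm_ring_1) mpoly"
  assumes fin: "finite E" and inj: "inj_on r E" and T: "T \<subseteq> E"
    and cyc: "\<And>T. T \<subseteq> E \<Longrightarrow> bd r E y T = 0"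
    and pick: "\<And>u. lk (y T) u \<noteq> 0 \<Longrightarrow> pick u \<in> E"
  shows "bd r E (contraction r E pick y) T = y T"
proof (rule poly_mapping_eqI)
  fix u
  define a where "a = pick u"
  have fT: "finite T" using T fin finite_subset by blast
  have "lk (bd r E (contraction r E pick y) T) u =
      (\<Sum>e\<in>E-T. sg r e T * lk (contraction r E pick y (insert e T)) u)"
    using T by (simp add: bd_def lookup_sum lookup_sg)
  also have "\<dots> = (\<Sum>e\<in>E-T. sg r e T * (if a \<in> insert e T then
        sg r a (insert e T - {a}) * lk (y (insert e T - {a})) u else 0))"
    using T fT by (intro sum.cong refl) (subst lookup_contraction, auto simp: a_def)
  also have "\<dots> = lk (y T) u"
  proof (cases "a \<in> T")
    case False
    have "(\<Sum>e\<in>E-T. sg r e T * (if a \<in> insert e T then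
          sg r a (insert e T - {a}) * lk (y (insert e T - {a})) u else 0)) =
          (\<Sum>e\<in>E-T. if e = a then lk (y T) u else 0)"
      using False by (intro sum.cong refl) auto
    also have "\<dots> = (if a \<in> E then lk (y T) u else 0)" using False fin by simp
    finally show ?thesis using pick[of u] by (auto simp: a_def)
  next
    case True
    define T' where "T' = T - {a}"
    have T': "T = insert a T'" "a \<notin> T'" "finite T'" "T' \<subseteq> E" "a \<in> E"
      using True fT T by (auto simp: T'_def)
    have ET: "E - T' = insert a (E - T)" "a \<notin> E - T" using T' by auto
    have "0 = lk (bd r E y T') u" using cyc[OF T'(4)] by simp
    also have "\<dots> = (\<Sum>e\<in>E-T'. sg r e T' * lk (y (insert e T')) u)"
      using T' by (simp add: bd_def lookup_sum lookup_sg)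
    also have "\<dots> = sg r a T' * lk (y T) u + (\<Sum>e\<in>E-T. sg r e T' * lk (y (insert e T')) u)"
      unfolding ET(1) using ET(2) fin T' by simp
    finally have z: "sg r a T' * lk (y T) u + (\<Sum>e\<in>E-T. sg r e T' * lk (y (insert e T')) u) = 0"
      by simp
    have "(\<Sum>e\<in>E-T. sg r e T * (if a \<in> insert e T then
          sg r a (insert e T - {a}) * lk (y (insert e T - {a})) u else 0)) =
          (\<Sum>e\<in>E-T. - (sg r a T' * (sg r e T' * lk (y (insert e T')) u)))"
    proof (intro sum.cong refl)
      fix e assume e: "e \<in> E - T"
      then have ne: "r e \<noteq> r a" "e \<noteq> a" "e \<notin> T'" using T' inj by (auto simp: inj_on_def)
      have "insert e T - {a} = insert e T'" using ne T' by auto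
      moreover have "sg r e T * sg r a (insert e T') = - (sg r a T' * sg r e T' :: 'k)"
        using ne T' by (auto simp: sg_insert)
      ultimately show "sg r e T * (if a \<in> insert e T then
          sg r a (insert e T - {a}) * lk (y (insert e T - {a})) u else 0) =
          - (sg r a T' * (sg r e T' * lk (y (insert e T')) u))"
        using True by (simp add: mult.assoc[symmetric])
    qed
    also have "\<dots> = - (sg r a T' * (\<Sum>e\<in>E-T. sg r e T' * lk (y (insert e T')) u))"
      by (simp add: sum_negf sum_distrib_left)
    also have "\<dots> = sg r a T' * (sg r a T' * lk (y T) u)"
    proof -
      have "(\<Sum>e\<in>E-T. sg r e T' * lk (y (insert e T')) u) = - (sg r a T' * lk (y T) u)"
        using z by (simp only: add_eq_0_iff)
      then show ?thesis by (simp only: mult_minus_right minus_minus)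
    qed
    finally show ?thesis by simp
  qed
  finally show "lk (bd r E (contraction r E pick y) T) u = lk (y T) u" .
qed

text \<open>Exchanging the summation variables would only show that twice the sum is 0, which is
  void in characteristic 2. The induction cancels \<open>f a x\<close> against \<open>f x a\<close>
  directly.\<close>

lemma sum_pairs_antisym:
  fixes f :: "'e::type \<Rightarrow> 'e \<Rightarrow> 'c::comm_ring_1"
  assumes "finite A" "\<And>x y. x \<in> A \<Longrightarrow> y \<in> A \<Longrightarrow> x \<noteq> y \<Longrightarrow> f x y = - f y x"
  shows "(\<Sum>x\<in>A. \<Sum>y\<in>A - {x}. f x y) = 0"
  using assms
proof (induction rule: finite_induct)
  case (insert a A)
  have e: "insert a A - {x} = insert a (A - {x})" if "x \<in> A" for x
    using that insert(2) by auto
  have IH: "(\<Sum>x\<in>A. \<Sum>y\<in>A - {x}. f x y) = 0"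
    using insert(3) insert(4) by blast
  have anti: "f x a = - f a x" if "x \<in> A" for x
    using that insert(2) insert(4)[of x a] by blast
  have "(\<Sum>x\<in>insert a A. \<Sum>y\<in>insert a A - {x}. f x y) =
      (\<Sum>y\<in>A. f a y) + (\<Sum>x\<in>A. \<Sum>y\<in>insert a (A - {x}). f x y)"
    using insert(1,2) e by simp
  also have "(\<Sum>x\<in>A. \<Sum>y\<in>insert a (A - {x}). f x y) = (\<Sum>x\<in>A. f x a + (\<Sum>y\<in>A - {x}. f x y))"
    using insert(1,2) by (intro sum.cong refl) simp
  also have "\<dots> = (\<Sum>x\<in>A. - f a x)"
    using IH anti by (simp only: sum.distrib) simp
  finally show ?case by (simp add: sum_negf)
qed simp

lemma bd_bd:
  assumes fin: "finite E" and inj: "inj_on r E"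
  shows "bd r E (bd r E y) T = 0"
proof (cases "T \<subseteq> E")
  case True
  have fT: "finite T" using True fin finite_subset by blast
  have "bd r E (bd r E y) T =
      (\<Sum>e\<in>E-T. \<Sum>f\<in>E - T - {e}. sg r e T * (sg r f (insert e T) * y (insert f (insert e T))))"
  proof -
    have "E - insert e T = E - T - {e}" for e by auto
    then show ?thesis using True by (simp add: bd_def sum_distrib_left)
  qed
  also have "\<dots> = 0"
  proof (rule sum_pairs_antisym)
    fix e f assume ef: "e \<in> E - T" "f \<in> E - T" "e \<noteq> f"
    then have "r e \<noteq> r f" using inj by (auto simp: inj_on_def)
    then have "sg r e T * sg r f (insert e T) = - (sg r f T * sg r e (insert f T) :: 'b)"
      using ef fT by (intro sg_swap) auto
    then show "sg r e T * (sg r f (insert e T) * y (insert f (insert e T))) =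
        - (sg r f T * (sg r e (insert f T) * y (insert e (insert f T))))"
      by (simp add: mult.assoc[symmetric] insert_commute)
  qed (use fin in auto)
  finally show ?thesis .
qed (simp add: bd_def)

section \<open>The face ideal\<close>

lemma polys_iff: "p \<in> polys V \<longleftrightarrow> (\<forall>u. lk p u \<noteq> 0 \<longrightarrow> ks u \<subseteq> V)"
  by (auto simp: polys_def in_keys_iff)

lemma polys_0 [simp]: "0 \<in> polys V" and polys_1 [simp]: "(1 :: ('v, 'k::field) mpoly) \<in> polys V"
  by (auto simp: polys_iff lookup_one when_def)

lemma polys_add: "p \<in> polys V \<Longrightarrow> q \<in> polys V \<Longrightarrow> p + q \<in> polys (V :: 'v set)"
  for p q :: "('v, 'k::field) mpoly"
  unfolding polys_iff lookup_add by (metis add.right_neutral)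

lemma polys_uminus: "p \<in> polys V \<Longrightarrow> - p \<in> polys V" for p :: "('v, 'k::field) mpoly"
  by (auto simp: polys_iff)

lemma polys_mult: "p \<in> polys V \<Longrightarrow> q \<in> polys V \<Longrightarrow> p * q \<in> polys V"
  for p q :: "('v, 'k::field) mpoly"
  unfolding polys_iff
proof (intro allI impI)
  fix u assume a: "\<forall>u. lk p u \<noteq> 0 \<longrightarrow> ks u \<subseteq> V" "\<forall>u. lk q u \<noteq> 0 \<longrightarrow> ks u \<subseteq> V"
    and "lk (p * q) u \<noteq> 0"
  from this(3) show "ks u \<subseteq> V"
    by (rule in_keys_multE) (use a in \<open>auto simp: keys_add_nat\<close>)
qed

lemma polys_sum: "(\<And>x. x \<in> A \<Longrightarrow> f x \<in> polys V) \<Longrightarrow> (\<Sum>x\<in>A. f x) \<in> polys V"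
  for f :: "'x \<Rightarrow> ('v, 'k::field) mpoly"
  by (induction A rule: infinite_finite_induct) (auto intro: polys_add)

lemma cring_poly_ring: "cring (poly_ring V :: ('v, 'k::field) mpoly ring)"
proof (rule cringI)
  show "abelian_group (poly_ring V :: ('v, 'k) mpoly ring)"
  proof (rule abelian_groupI)
    fix x :: "('v, 'k) mpoly" assume "x \<in> carrier (poly_ring V)"
    then show "\<exists>y\<in>carrier (poly_ring V). y \<oplus>\<^bsub>poly_ring V\<^esub> x = \<zero>\<^bsub>poly_ring V\<^esub>"
      by (intro bexI[of _ "- x"]) (auto simp: poly_ring_def polys_uminus)
  qed (auto simp: poly_ring_def polys_add algebra_simps)
  show "comm_monoid (poly_ring V :: ('v, 'k) mpoly ring)"
    by (rule comm_monoidI) (auto simp: poly_ring_def polys_mult algebra_simps)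
qed (auto simp: poly_ring_def algebra_simps)

lemma sum_singles: "p = (\<Sum>u\<in>ks p. sing u (lk p u))"
proof (rule poly_mapping_eqI)
  fix u
  have "lk (\<Sum>u\<in>ks p. sing u (lk p u)) u = (\<Sum>w\<in>ks p. if w = u then lk p u else 0)"
    unfolding lookup_sum by (rule sum.cong) (auto simp: lookup_single when_def)
  then show "lk p u = lk (\<Sum>u\<in>ks p. sing u (lk p u)) u" by (simp add: in_keys_iff)
qed

lemma prod_mvar: "finite S \<Longrightarrow> (\<Prod>v\<in>S. mvar v) = (xmon S :: ('v, 'k::field) mpoly)"
proof (induction S rule: finite_induct)
  case empty then show ?case by (simp add: xmon_def)
next
  case (insert v S)
  then show ?case
    using chi_insert[of S v] by (simp add: mvar_def xmon_def mult_single chi_singleton add.commute)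
qed

text \<open>The ideal is generated by monomials, so membership is decided term by term. The
  right-hand side is an ideal as \<open>K\<close> is closed under subsets; conversely, a term whose
  support is a nonface is a multiple of the generator of its support.\<close>

lemma face_ideal_eq:
  fixes V :: "'v set"
  assumes V: "finite V" and K: "\<And>S T. S \<in> K \<Longrightarrow> T \<subseteq> S \<Longrightarrow> T \<in> K"
  shows "face_ideal V K = {p \<in> polys V. \<forall>u. lk p u \<noteq> (0 :: 'k::field) \<longrightarrow> ks u \<notin> K}" (is "_ = ?J")
proof
  interpret cring "poly_ring V :: ('v, 'k) mpoly ring" by (rule cring_poly_ring)
  have sub: "subgroup ?J (add_monoid (poly_ring V))"
  proof
    fix x assume x: "x \<in> ?J"
    have "inv\<^bsub>add_monoid (poly_ring V)\<^esub> x = - x"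
      using x unfolding a_inv_def[symmetric]
      by (intro minus_equality) (auto simp: poly_ring_def polys_uminus)
    then show "inv\<^bsub>add_monoid (poly_ring V)\<^esub> x \<in> ?J" using x by (auto simp: polys_uminus)
  next
    fix x y assume "x \<in> ?J" "y \<in> ?J"
    then show "x \<otimes>\<^bsub>add_monoid (poly_ring V)\<^esub> y \<in> ?J"
      by (auto simp: poly_ring_def polys_add lookup_add) (metis add.right_neutral)
  qed (auto simp: poly_ring_def)
  have mult: "x * a \<in> ?J" if "a \<in> ?J" "x \<in> polys V" for a x :: "('v, 'k) mpoly"
  proof -
    have "ks u \<notin> K" if u: "lk (x * a) u \<noteq> 0" for u
      using u by (rule in_keys_multE) (use \<open>a \<in> ?J\<close> K in \<open>auto simp: keys_add_nat\<close>)
    then show ?thesis using that by (auto simp: polys_mult)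
  qed
  have "ideal ?J (poly_ring V)"
  proof (rule idealI[OF ring_axioms sub])
    fix a x assume "a \<in> ?J" "x \<in> carrier (poly_ring V :: ('v, 'k) mpoly ring)"
    then have "x * a \<in> ?J" by (intro mult) (auto simp: poly_ring_def)
    then show "x \<otimes>\<^bsub>poly_ring V\<^esub> a \<in> ?J" "a \<otimes>\<^bsub>poly_ring V\<^esub> x \<in> ?J"
      by (simp_all add: poly_ring_def mult.commute)
  qed
  moreover have "{\<Prod>v\<in>S. mvar v | S. S \<subseteq> V \<and> S \<notin> K} \<subseteq> ?J"
  proof
    fix p :: "('v, 'k) mpoly" assume "p \<in> {\<Prod>v\<in>S. mvar v | S. S \<subseteq> V \<and> S \<notin> K}"
    then obtain S where S: "S \<subseteq> V" "S \<notin> K" "p = (\<Prod>v\<in>S. mvar v)" by auto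
    have "finite S" by (rule finite_subset[OF S(1) V])
    then show "p \<in> ?J" using S
      by (auto simp: prod_mvar xmon_def polys_iff lookup_single when_def split: if_splits)
  qed
  ultimately show "face_ideal V K \<subseteq> ?J"
    unfolding face_ideal_def by (rule genideal_minimal)
next
  interpret cring "poly_ring V :: ('v, 'k) mpoly ring" by (rule cring_poly_ring)
  let ?G = "{\<Prod>v\<in>S. mvar v | S. S \<subseteq> V \<and> S \<notin> K} :: ('v, 'k) mpoly set"
  have xp: "xmon S \<in> (polys V :: ('v, 'k) mpoly set)" if "S \<subseteq> V" for S
    using that finite_subset[OF that V] by (auto simp: xmon_def polys_iff lookup_single when_def split: if_splits)
  have GV: "?G \<subseteq> carrier (poly_ring V)"
  proof
    fix p assume "p \<in> ?G"
    then obtain S where S: "S \<subseteq> V" "p = (\<Prod>v\<in>S. mvar v)" by auto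
    then have "p = xmon S" using prod_mvar finite_subset[OF S(1) V] by blast
    then show "p \<in> carrier (poly_ring V)" using xp S by (simp add: poly_ring_def)
  qed
  interpret I: ideal "face_ideal V K :: ('v, 'k) mpoly set" "poly_ring V"
    unfolding face_ideal_def by (rule genideal_ideal[OF GV])
  have gen: "?G \<subseteq> face_ideal V K"
    unfolding face_ideal_def by (rule genideal_self[OF GV])
  have add: "x + y \<in> face_ideal V K" if "x \<in> face_ideal V K" "y \<in> face_ideal V K" for x y :: "('v, 'k) mpoly"
    using I.a_closed[OF that] by (simp add: poly_ring_def)
  have zero: "(0 :: ('v, 'k) mpoly) \<in> face_ideal V K"
    using I.zero_closed by (simp add: poly_ring_def)
  have single: "sing u c \<in> face_ideal V K" if u: "ks u \<subseteq> V" "ks u \<notin> K" for u and c :: 'k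
  proof -
    obtain w where w: "u = chi (ks u) + w" using chi_le[of "ks u" u] by auto
    have "(xmon (ks u) :: ('v, 'k) mpoly) \<in> face_ideal V K"
    proof -
      have "(\<Prod>v\<in>ks u. mvar v) \<in> ?G" using u by blast
      then have "(\<Prod>v\<in>ks u. mvar v) \<in> (face_ideal V K :: ('v, 'k) mpoly set)" by (rule subsetD[OF gen])
      then show ?thesis using prod_mvar[of "ks u", where 'k = 'k] by simp
    qed
    moreover have "sing w c \<in> polys V"
    proof -
      have "ks w \<subseteq> ks u" using arg_cong[OF w, of ks] by (simp only: keys_add_nat) blast
      then show ?thesis using u by (auto simp: polys_iff lookup_single when_def split: if_splits)
    qed
    ultimately have "xmon (ks u) * sing w c \<in> face_ideal V K"
      using I.I_r_closed[of "xmon (ks u)" "sing w c"] by (simp add: poly_ring_def)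
    then show ?thesis by (simp add: xmon_def mult_single w[symmetric])
  qed
  show "?J \<subseteq> face_ideal V K"
  proof
    fix p assume p: "p \<in> ?J"
    have "(\<Sum>u\<in>A. sing u (lk p u)) \<in> face_ideal V K" if "A \<subseteq> ks p" "finite A" for A
      using that(2,1)
    proof (induction A rule: finite_induct)
      case (insert u A)
      then have "lk p u \<noteq> 0" by (auto simp: in_keys_iff)
      then have "sing u (lk p u) \<in> face_ideal V K"
        using p by (intro single) (auto simp: polys_iff)
      then show ?case using insert by (auto intro: add)
    qed (simp add: zero)
    then have "(\<Sum>u\<in>ks p. sing u (lk p u)) \<in> face_ideal V K" by simp
    then show "p \<in> face_ideal V K" using sum_singles[of p] by simp
  qed
qed

section \<open>The Taylor resolution\<close>

text \<open>\<open>E\<close> consists of all nonfaces, not only of the minimal ones. Every monomial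
  in the ideal then has its own support among the generators, and this support can serve as the apex
  of the cone. \<open>b\<close> numbers the basis of each term, and \<open>r\<close> orders
  \<open>E\<close> for the signs.\<close>

locale taylor =
  fixes V :: "'v set" and K :: "'v set set" and E :: "'v set set" and r :: "'v set \<Rightarrow> nat"
    and Sub :: "nat \<Rightarrow> 'v set set set" and b :: "nat \<Rightarrow> nat \<Rightarrow> 'v set set"
    and F :: "('v, 'k::field) mpoly free_complex"
  assumes V: "finite V" and K: "\<And>S T. S \<in> K \<Longrightarrow> T \<subseteq> S \<Longrightarrow> T \<in> K"
  defines "E \<equiv> {S. S \<subseteq> V \<and> S \<notin> K}"
  defines "Sub \<equiv> (\<lambda>i. {S. S \<subseteq> E \<and> card S = i})"
  assumes r: "inj_on r E" and b: "\<And>i. bij_betw (b i) {..<card (Sub i)} (Sub i)"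
  defines "F \<equiv> \<lparr>fr_rank = (\<lambda>i. card (Sub i)), fr_deg = (\<lambda>i a. 2 * card (\<Union>(b i a))),
     fr_diff = (\<lambda>i a c. if b i a \<subseteq> b (Suc i) c
        then sg r (the_elem (b (Suc i) c - b i a)) (b i a) * xmon (\<Union>(b (Suc i) c) - \<Union>(b i a)) else 0),
     fr_aug = (\<lambda>_. 1)\<rparr>"
begin

lemma finE: "finite E"
  unfolding E_def using V by simp

lemma finSub: "finite (Sub i)"
  unfolding Sub_def using finE by simp

lemma Union_sub: "S \<subseteq> E \<Longrightarrow> \<Union>S \<subseteq> V"
  by (auto simp: E_def)

lemma finite_Union_sub: "S \<subseteq> E \<Longrightarrow> finite (\<Union>S)"
  by (rule finite_subset[OF Union_sub V])

lemma b_Sub: "a < card (Sub i) \<Longrightarrow> b i a \<in> Sub i"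
  using b[of i] by (auto simp: bij_betw_def)

text \<open>Multiplying the coefficient of \<open>S\<close> by the monomial of \<open>\<Union>S\<close> turns the differential of the
  Taylor complex into the one of a simplex.\<close>

definition hat :: "nat \<Rightarrow> (nat \<Rightarrow> ('v, 'k) mpoly) \<Rightarrow> 'v set set \<Rightarrow> ('v, 'k) mpoly" where
  "hat i x S = (if S \<in> Sub i then xmon (\<Union>S) * x (inv_into {..<card (Sub i)} (b i) S) else 0)"

lemma hat_b: "a < card (Sub i) \<Longrightarrow> hat i x (b i a) = xmon (\<Union>(b i a)) * x a"
  using b[of i] by (simp add: hat_def b_Sub bij_betw_inv_into_left)

lemma hat_inj:
  assumes "x \<in> fr_mod V F i" "y \<in> fr_mod V F i" "hat i x = hat i y" shows "x = y"
proof
  fix a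
  show "x a = y a"
  proof (cases "a < card (Sub i)")
    case True
    then show ?thesis using hat_b[OF True, of x] hat_b[OF True, of y] assms(3)
      by (simp add: xmon_cancel)
  next
    case False
    then show ?thesis using assms(1,2) by (simp add: fr_mod_def F_def)
  qed
qed

lemma hat_keys:
  assumes "x \<in> fr_mod V F i" "lk (hat i x S) u \<noteq> 0"
  shows "S \<in> Sub i" "\<Union>S \<subseteq> ks u" "ks u \<subseteq> V"
proof -
  show S: "S \<in> Sub i" using assms by (auto simp: hat_def split: if_splits)
  then obtain a where a: "a < card (Sub i)" "S = b i a" using b[of i] by (auto simp: bij_betw_def)
  have SV: "\<Union>S \<subseteq> V" "finite (\<Union>S)" using S Union_sub finite_Union_sub by (auto simp: Sub_def)
  have "lk (xmon (\<Union>S) * x a) u \<noteq> 0" using assms a hat_b by auto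
  then obtain w where w: "u = chi (\<Union>S) + w" "lk (x a) w \<noteq> 0" by (rule xmon_mult_nonzeroE)
  have "x a \<in> polys V" using assms(1) a by (auto simp: fr_mod_def F_def)
  then have "ks w \<subseteq> V" using w by (auto simp: polys_iff)
  then show "\<Union>S \<subseteq> ks u" "ks u \<subseteq> V" using SV w by (auto simp: keys_add_nat)
qed

lemma hat_surj:
  assumes "\<And>S u. lk (y S) u \<noteq> 0 \<Longrightarrow> S \<in> Sub i \<and> \<Union>S \<subseteq> ks u \<and> ks u \<subseteq> V"
  shows "\<exists>x\<in>fr_mod V F i. hat i x = y"
proof -
  have "\<exists>g. y S = xmon (\<Union>S) * g" if S: "S \<in> Sub i" for S
  proof -
    have "finite (\<Union>S)" using S by (intro finite_Union_sub) (simp add: Sub_def)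
    then obtain g where "y S = xmon (\<Union>S) * g"
      by (rule xmon_factor[of _ "y S"]) (use assms in blast)
    then show ?thesis by blast
  qed
  then obtain g where g: "\<And>S. S \<in> Sub i \<Longrightarrow> y S = xmon (\<Union>S) * g S" by metis
  have gV: "g S \<in> polys V" if S: "S \<in> Sub i" for S
    unfolding polys_iff
  proof (intro allI impI)
    fix u assume "lk (g S) u \<noteq> 0"
    then have "lk (y S) (chi (\<Union>S) + u) \<noteq> 0" using g S by (simp add: lookup_xmon_mult)
    then show "ks u \<subseteq> V" using assms[of S "chi (\<Union>S) + u"] by (auto simp: keys_add_nat)
  qed
  define x where "x a = (if a < card (Sub i) then g (b i a) else 0)" for a
  have "x \<in> fr_mod V F i" using gV b_Sub by (auto simp: fr_mod_def x_def F_def)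
  moreover have "hat i x = y"
  proof
    fix S show "hat i x S = y S"
    proof (cases "S \<in> Sub i")
      case True
      then obtain a where "a < card (Sub i)" "S = b i a" using b[of i] by (auto simp: bij_betw_def)
      then show ?thesis using g True by (simp add: hat_b x_def)
    next
      case False
      then have "lk (y S) u = 0" for u using assms by blast
      then show ?thesis using False by (intro poly_mapping_eqI) (simp add: hat_def)
    qed
  qed
  ultimately show ?thesis by blast
qed

lemma fr_map_closed: "x \<in> fr_mod V F (Suc i) \<Longrightarrow> fr_map F i x \<in> fr_mod V F i"
proof -
  assume x: "x \<in> fr_mod V F (Suc i)"
  have "fr_diff F i a c \<in> polys V" if "a < card (Sub i)" "c < card (Sub (Suc i))" for a c
  proof -
    have "b (Suc i) c \<subseteq> E" using b_Sub[OF that(2)] by (simp add: Sub_def)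
    then have *: "\<Union>(b (Suc i) c) \<subseteq> V" by (rule Union_sub)
    then have "finite (\<Union>(b (Suc i) c) - \<Union>(b i a))"
      by (intro finite_Diff finite_subset[OF _ V])
    then show ?thesis using *
      by (auto simp: F_def polys_iff lookup_sg xmon_def lookup_single when_def split: if_splits)
  qed
  then show ?thesis using x
    by (auto simp: fr_mod_def fr_map_def F_def intro!: polys_sum polys_mult)
qed

lemma hat_fr_map: "hat i (fr_map F i x) = bd r E (hat (Suc i) x)"
proof
  fix S
  have ext: "hat (Suc i) x (insert e S) = 0" if "S \<notin> Sub i" "S \<subseteq> E" "e \<in> E - S" for e
  proof -
    have "finite S" by (rule finite_subset[OF that(2) finE])
    then show ?thesis using that by (auto simp: hat_def Sub_def)
  qed
  show "hat i (fr_map F i x) S = bd r E (hat (Suc i) x) S"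
  proof (cases "S \<in> Sub i")
    case False
    then show ?thesis using ext by (auto simp: bd_def hat_def intro!: sum.neutral)
  next
    case True
    then obtain a where a: "a < card (Sub i)" "S = b i a" using b[of i] by (auto simp: bij_betw_def)
    have SE: "S \<subseteq> E" "finite S" "card S = i"
      using True by (auto simp: Sub_def intro: finite_subset[OF _ finE])
    define t where "t C = (if S \<subseteq> C then sg r (the_elem (C - S)) S * hat (Suc i) x C else 0)" for C
    have "hat i (fr_map F i x) S = xmon (\<Union>S) * (\<Sum>c<card (Sub (Suc i)). fr_diff F i a c * x c)"
      using a by (simp add: hat_b fr_map_def F_def)
    also have "\<dots> = (\<Sum>c<card (Sub (Suc i)). t (b (Suc i) c))"
      unfolding sum_distrib_left
    proof (intro sum.cong refl)
      fix c assume c: "c \<in> {..<card (Sub (Suc i))}"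
      define C where "C = b (Suc i) c"
      have CE: "C \<subseteq> E" using b_Sub c by (auto simp: C_def Sub_def)
      show "xmon (\<Union>S) * (fr_diff F i a c * x c) = t (b (Suc i) c)"
      proof (cases "S \<subseteq> C")
        case sub: True
        \<comment> \<open>The monomial of \<open>\<Union>C\<close> is that of
          \<open>\<Union>S\<close> times the matrix entry up to sign; this is how the monomials
          disappear from the differential.\<close>
        have "\<Union>C = \<Union>S \<union> (\<Union>C - \<Union>S)" using sub by auto
        then have "xmon (\<Union>C) = xmon (\<Union>S) * (xmon (\<Union>C - \<Union>S) :: ('v, 'k) mpoly)"
          using finite_Union_sub[OF CE] finite_Union_sub[OF SE(1)]
          by (metis Diff_disjoint finite_Diff xmon_union)
        then show ?thesis using c sub a
          by (simp add: t_def F_def C_def[symmetric] hat_b[of c "Suc i", folded C_def] ac_simps)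
      qed (use a in \<open>simp add: t_def F_def C_def\<close>)
    qed
    also have "\<dots> = (\<Sum>C\<in>Sub (Suc i). t C)"
      by (rule sum.reindex_bij_betw[OF b])
    also have "\<dots> = (\<Sum>C\<in>{C\<in>Sub (Suc i). S \<subseteq> C}. sg r (the_elem (C - S)) S * hat (Suc i) x C)"
      using finSub by (simp add: t_def sum.inter_filter)
    also have "\<dots> = (\<Sum>e\<in>E - S. sg r e S * hat (Suc i) x (insert e S))"
    proof (rule sym, rule sum.reindex_bij_witness[where i = "\<lambda>C. the_elem (C - S)" and j = "\<lambda>e. insert e S"])
      fix C assume C: "C \<in> {C\<in>Sub (Suc i). S \<subseteq> C}"
      then have "finite C" by (auto simp: Sub_def intro: finite_subset[OF _ finE])
      then have "card (C - S) = 1" using C SE by (auto simp: Sub_def card_Diff_subset)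
      then obtain e where e: "C - S = {e}" by (auto simp: card_1_singleton_iff)
      then have "the_elem (C - S) = e" by simp
      moreover have "e \<in> E - S" "insert e S = C" using e C by (auto simp: Sub_def)
      ultimately show "the_elem (C - S) \<in> E - S" "insert (the_elem (C - S)) S = C" by simp_all
    next
      fix e assume e: "e \<in> E - S"
      then have "insert e S - S = {e}" by auto
      then show "the_elem (insert e S - S) = e"
        "sg r (the_elem (insert e S - S)) S * hat (Suc i) x (insert e S) = sg r e S * hat (Suc i) x (insert e S)"
        by simp_all
      show "insert e S \<in> {C\<in>Sub (Suc i). S \<subseteq> C}" using e SE by (auto simp: Sub_def)
    qed
    finally show ?thesis using SE by (simp add: bd_def)
  qed
qed

text \<open>The support of the exponent is taken as apex; by \<open>nf\<close> it is a nonface.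
  Adjoining it to \<open>S\<close> preserves \<open>\<Union>S \<subseteq> ks u\<close>, so the
  contraction stays inside the image of \<open>hat\<close>.\<close>

lemma hat_contraction:
  assumes x: "x \<in> fr_mod V F i" and cyc: "\<And>T. bd r E (hat i x) T = 0"
    and nf: "\<And>S u. lk (hat i x S) u \<noteq> 0 \<Longrightarrow> ks u \<notin> K"
  shows "x \<in> fr_map F i ` fr_mod V F (Suc i)"
proof -
  have pk: "ks u \<in> E" if "lk (hat i x S) u \<noteq> 0" for S u
    using hat_keys[OF x that] nf[OF that] by (simp add: E_def)
  have bc: "bd r E (contraction r E ks (hat i x)) = hat i x"
  proof
    fix T
    show "bd r E (contraction r E ks (hat i x)) T = hat i x T"
    proof (cases "T \<subseteq> E")
      case True
      then show ?thesis by (intro bd_contraction finE r cyc) (auto intro: pk)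
    next
      case False
      then show ?thesis by (auto simp: bd_def hat_def Sub_def)
    qed
  qed
  have "\<exists>x'\<in>fr_mod V F (Suc i). hat (Suc i) x' = contraction r E ks (hat i x)"
  proof (rule hat_surj)
    fix S u assume nz: "lk (contraction r E ks (hat i x) S) u \<noteq> 0"
    then have S: "S \<subseteq> E" by (auto simp: contraction_def split: if_splits)
    then have fS: "finite S" by (rule finite_subset[OF _ finE])
    have *: "ks u \<in> S" "lk (hat i x (S - {ks u})) u \<noteq> 0"
      using nz unfolding lookup_contraction[OF fS S] by (auto split: if_splits)
    note h = hat_keys[OF x *(2)]
    have "card S = Suc i" using h(1) card.remove[OF fS *(1)] by (simp add: Sub_def)
    then show "S \<in> Sub (Suc i) \<and> \<Union>S \<subseteq> ks u \<and> ks u \<subseteq> V"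
      using S h by (auto simp: Sub_def)
  qed
  then obtain x' where x': "x' \<in> fr_mod V F (Suc i)" "hat (Suc i) x' = contraction r E ks (hat i x)"
    by blast
  then have "hat i (fr_map F i x') = hat i x" using bc by (simp add: hat_fr_map)
  then have "fr_map F i x' = x" using x x' fr_map_closed by (intro hat_inj) auto
  then show ?thesis using x'(1) by blast
qed

lemma Sub_0: "Sub 0 = {{}}"
  using finite_subset[OF _ finE] by (auto simp: Sub_def)

lemma rank_F: "fr_rank F i = card (Sub i)"
  by (simp add: F_def)

lemma eps_eq: "fr_eps F x = x 0"
  by (simp add: fr_eps_def F_def Sub_0)

lemma b_0: "b 0 0 = {}"
  using b_Sub[of 0 0] by (simp add: Sub_0)

lemma hat_0: "hat 0 x S = (if S = {} then x 0 else 0)"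
  using hat_b[of 0 0 x] by (auto simp: b_0 Sub_0 hat_def xmon_def)

lemma resolution: "graded_free_resolution V (face_ideal V K) F"
proof -
  note FI = face_ideal_eq[OF V K, where 'k = 'k]
  have "graded_free_complex V F"
    unfolding graded_free_complex_def
  proof (intro conjI allI impI ballI)
    fix a assume a: "a < fr_rank F 0"
    show "fr_aug F a \<in> polys V" by (simp add: F_def)
    have "a = 0" using a by (simp add: F_def Sub_0)
    then show "hom_of_deg (fr_deg F 0 a) (fr_aug F a)" by (simp add: F_def hom_of_deg_def b_0)
  next
    fix i a c assume "a < fr_rank F i" "c < fr_rank F (Suc i)"
    then have *: "b i a \<in> Sub i" "b (Suc i) c \<in> Sub (Suc i)" by (auto simp: F_def b_Sub)
    define A where "A = \<Union>(b i a)" define C where "C = \<Union>(b (Suc i) c)"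
    have AC: "finite A" "finite C" "C \<subseteq> V"
      using * finite_Union_sub Union_sub by (auto simp: Sub_def A_def C_def)
    have key: "u = chi (C - A) \<and> A \<subseteq> C" if "lk (fr_diff F i a c) u \<noteq> 0" for u
      using that by (auto simp: F_def lookup_sg xmon_def lookup_single when_def A_def C_def split: if_splits)
    have "ks (chi (C - A)) \<subseteq> V" using AC by simp auto
    then show "fr_diff F i a c \<in> polys V" unfolding polys_iff using key by blast
    fix u assume "u \<in> ks (fr_diff F i a c)"
    then have u: "u = chi (C - A)" "A \<subseteq> C" using key by (auto simp: in_keys_iff)
    have "card (C - A) + card A = card C" using u AC
      by (metis card_Diff_subset card_mono le_add_diff_inverse2)
    then show "mon_deg u + fr_deg F i a = fr_deg F (Suc i) c"
      using u AC by (simp add: mon_deg_chi F_def A_def[symmetric] C_def[symmetric])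
  qed
  moreover have "\<exists>x\<in>fr_mod V F 0. p - fr_eps F x \<in> face_ideal V K" if "p \<in> polys V" for p :: "('v, 'k) mpoly"
  proof (rule bexI)
    show "p - fr_eps F (\<lambda>a. if a = 0 then p else 0) \<in> face_ideal V K" by (simp add: eps_eq FI)
  qed (use that in \<open>simp add: fr_mod_def F_def Sub_0\<close>)
  moreover have "{x \<in> fr_mod V F 0. fr_eps F x \<in> face_ideal V K} = fr_map F 0 ` fr_mod V F 1"
  proof
    show "{x \<in> fr_mod V F 0. fr_eps F x \<in> face_ideal V K} \<subseteq> fr_map F 0 ` fr_mod V F 1"
    proof
      fix x assume x: "x \<in> {x \<in> fr_mod V F 0. fr_eps F x \<in> face_ideal V K}"
      have "x \<in> fr_map F 0 ` fr_mod V F (Suc 0)"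
      proof (rule hat_contraction)
        fix S u assume "lk (hat 0 x S) u \<noteq> 0"
        then show "ks u \<notin> K" using x by (auto simp: hat_0 eps_eq FI split: if_splits)
      qed (use x in \<open>auto simp: bd_def hat_0\<close>)
      then show "x \<in> fr_map F 0 ` fr_mod V F 1" by simp
    qed
    show "fr_map F 0 ` fr_mod V F 1 \<subseteq> {x \<in> fr_mod V F 0. fr_eps F x \<in> face_ideal V K}"
    proof clarify
      fix x assume x: "x \<in> fr_mod V F 1"
      then have c: "fr_map F 0 x \<in> fr_mod V F 0" using fr_map_closed[of x 0] by simp
      have e: "fr_eps F (fr_map F 0 x) = (\<Sum>e\<in>E. sg r e {} * hat 1 x {e})"
        using fun_cong[OF hat_fr_map[of 0 x], of "{}"] by (simp add: hat_0 eps_eq bd_def)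
      have "ks u \<notin> K" if u: "lk (fr_eps F (fr_map F 0 x)) u \<noteq> 0" for u
      proof -
        from u obtain e where "e \<in> E" "lk (sg r e {} * hat 1 x {e}) u \<noteq> 0"
          unfolding e by (rule lookup_sum_nonzeroE)
        then have "e \<in> E" "e \<subseteq> ks u" using hat_keys[OF x, of "{e}" u] by (auto simp: lookup_sg)
        then show ?thesis using K by (auto simp: E_def)
      qed
      moreover have "fr_eps F (fr_map F 0 x) \<in> polys V"
        using c by (auto simp: eps_eq fr_mod_def rank_F Sub_0)
      ultimately show "fr_map F 0 x \<in> fr_mod V F 0 \<and> fr_eps F (fr_map F 0 x) \<in> face_ideal V K"
        using c by (simp add: FI)
    qed
  qed
  moreover have "{x \<in> fr_mod V F (Suc i). fr_map F i x = 0} = fr_map F (Suc i) ` fr_mod V F (Suc (Suc i))" for i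
  proof
    have h0: "hat i (0 :: nat \<Rightarrow> ('v, 'k) mpoly) = (\<lambda>_. 0)" by (auto simp: hat_def)
    show "{x \<in> fr_mod V F (Suc i). fr_map F i x = 0} \<subseteq> fr_map F (Suc i) ` fr_mod V F (Suc (Suc i))"
    proof clarify
      fix x assume x: "x \<in> fr_mod V F (Suc i)" "fr_map F i x = 0"
      show "x \<in> fr_map F (Suc i) ` fr_mod V F (Suc (Suc i))"
      proof (rule hat_contraction[OF x(1)])
        show "bd r E (hat (Suc i) x) T = 0" for T
          using hat_fr_map[of i x] x(2) h0 by metis
        fix S u assume *: "lk (hat (Suc i) x S) u \<noteq> 0"
        note h = hat_keys[OF x(1) *]
        \<comment> \<open>In positive homological degree the monomial is divisible by that of a
          nonface in \<open>S\<close>, so its support is automatically a nonface; in degree 0 this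
          comes from membership in the ideal.\<close>
        then have "S \<noteq> {}" by (auto simp: Sub_def)
        then obtain e where "e \<in> S" by auto
        then have "e \<subseteq> ks u" "e \<notin> K" using h by (auto simp: Sub_def E_def)
        then show "ks u \<notin> K" using K by blast
      qed
    qed
    show "fr_map F (Suc i) ` fr_mod V F (Suc (Suc i)) \<subseteq> {x \<in> fr_mod V F (Suc i). fr_map F i x = 0}"
    proof clarify
      fix x assume x: "x \<in> fr_mod V F (Suc (Suc i))"
      then have c: "fr_map F (Suc i) x \<in> fr_mod V F (Suc i)" by (rule fr_map_closed)
      have "hat i (fr_map F i (fr_map F (Suc i) x)) = hat i 0"
        unfolding hat_fr_map h0 by (rule ext) (rule bd_bd[OF finE r])
      moreover have "(0 :: nat \<Rightarrow> ('v, 'k) mpoly) \<in> fr_mod V F i" by (simp add: fr_mod_def)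
      ultimately have "fr_map F i (fr_map F (Suc i) x) = 0"
        by (intro hat_inj[of _ i] fr_map_closed c)
      then show "fr_map F (Suc i) x \<in> fr_mod V F (Suc i) \<and> fr_map F i (fr_map F (Suc i) x) = 0"
        using c by simp
    qed
  qed
  ultimately show ?thesis unfolding graded_free_resolution_def by blast
qed

end

text \<open>Guarantees that the resolution selected by \<open>SOME\<close> in \<open>tor_dim\<close>
  really is one.\<close>

theorem face_ideal_resolution_exists:
  fixes V :: "'v set"
  assumes V: "finite V" and K: "\<And>S T. S \<in> K \<Longrightarrow> T \<subseteq> S \<Longrightarrow> T \<in> K"
  shows "\<exists>F :: ('v, 'k::field) mpoly free_complex. graded_free_resolution V (face_ideal V K) F"
proof -
  define E where "E = {S. S \<subseteq> V \<and> S \<notin> K}"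
  define Sub where "Sub i = {S. S \<subseteq> E \<and> card S = i}" for i
  have fE: "finite E" using V by (simp add: E_def)
  then obtain r :: "'v set \<Rightarrow> nat" where r: "inj_on r E"
    using finite_imp_inj_to_nat_seg by metis
  have "\<exists>b. bij_betw b {..<card (Sub i)} (Sub i)" for i
    using ex_bij_betw_nat_finite[of "Sub i"] fE by (auto simp: Sub_def atLeast0LessThan)
  then obtain b where b: "\<And>i. bij_betw (b i) {..<card (Sub i)} (Sub i)" by metis
  have "taylor V K r b"
    by unfold_locales (use V K r b in \<open>auto simp: E_def Sub_def\<close>)
  then show ?thesis using taylor.resolution by blast
qed

section \<open>Linear relations inducing isomorphisms of subquotients\<close>

text \<open>The relation \<open>R\<close> induces an isomorphism from \<open>Z1 / B1\<close> to \<open>Z2 / B2\<close>.\<close>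

definition corr ::
  "('k \<Rightarrow> 'x::ab_group_add \<Rightarrow> 'x) \<Rightarrow> ('k \<Rightarrow> 'y::ab_group_add \<Rightarrow> 'y) \<Rightarrow> 'x set \<Rightarrow> 'x set \<Rightarrow> 'y set \<Rightarrow> 'y set
    \<Rightarrow> ('x \<Rightarrow> 'y \<Rightarrow> bool) \<Rightarrow> bool" where
  "corr s1 s2 Z1 B1 Z2 B2 R \<longleftrightarrow>
     (\<forall>x y x' y'. R x y \<longrightarrow> R x' y' \<longrightarrow> R (x + x') (y + y')) \<and>
     (\<forall>c x y. R x y \<longrightarrow> R (s1 c x) (s2 c y)) \<and>
     (\<forall>x\<in>Z1. \<exists>y. R x y) \<and> (\<forall>y\<in>Z2. \<exists>x. R x y) \<and>
     (\<forall>x y. R x y \<longrightarrow> x \<in> Z1 \<and> y \<in> Z2 \<and> (x \<in> B1 \<longleftrightarrow> y \<in> B2))"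

lemma
  assumes "corr s1 s2 Z1 B1 Z2 B2 R"
  shows corr_add: "R x y \<Longrightarrow> R x' y' \<Longrightarrow> R (x + x') (y + y')"
    and corr_scale: "R x y \<Longrightarrow> R (s1 c x) (s2 c y)"
    and corr_total: "x \<in> Z1 \<Longrightarrow> \<exists>y. R x y"
    and corr_surj: "y \<in> Z2 \<Longrightarrow> \<exists>x. R x y"
    and corr_mem: "R x y \<Longrightarrow> x \<in> Z1 \<and> y \<in> Z2 \<and> (x \<in> B1 \<longleftrightarrow> y \<in> B2)"
  using assms by (simp_all add: corr_def)

lemma corr_trans:
  assumes "corr s1 s2 Z1 B1 Z2 B2 R" "corr s2 s3 Z2 B2 Z3 B3 Q"
  shows "corr s1 s3 Z1 B1 Z3 B3 (R OO Q)"
  unfolding corr_def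
proof (intro conjI allI impI ballI)
  fix x z x' z' assume "(R OO Q) x z" "(R OO Q) x' z'"
  then obtain y y' where "R x y" "Q y z" "R x' y'" "Q y' z'" by (auto simp: relcompp_apply)
  then show "(R OO Q) (x + x') (z + z')"
    using corr_add[OF assms(1)] corr_add[OF assms(2)] by (intro relcomppI)
next
  fix c x z assume "(R OO Q) x z"
  then obtain y where "R x y" "Q y z" by (auto simp: relcompp_apply)
  then show "(R OO Q) (s1 c x) (s3 c z)"
    using corr_scale[OF assms(1)] corr_scale[OF assms(2)] by (intro relcomppI)
next
  fix x assume "x \<in> Z1"
  then obtain y where y: "R x y" using corr_total[OF assms(1)] by auto
  then obtain z where "Q y z" using corr_mem[OF assms(1) y] corr_total[OF assms(2)] by auto
  then show "\<exists>z. (R OO Q) x z" using y by (intro exI relcomppI)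
next
  fix z assume "z \<in> Z3"
  then obtain y where y: "Q y z" using corr_surj[OF assms(2)] by auto
  then obtain x where "R x y" using corr_mem[OF assms(2) y] corr_surj[OF assms(1)] by auto
  then show "\<exists>x. (R OO Q) x z" using y by (intro exI relcomppI)
next
  fix x z assume "(R OO Q) x z"
  then obtain y where y: "R x y" "Q y z" by (auto simp: relcompp_apply)
  then show "x \<in> Z1" "z \<in> Z3" "x \<in> B1 \<longleftrightarrow> z \<in> B3"
    using corr_mem[OF assms(1) y(1)] corr_mem[OF assms(2) y(2)] by auto
qed

section \<open>Linearity of the boundary operator\<close>

lemma bd_add: "bd r E (\<lambda>S. y S + z S) T = bd r E y T + bd r E z T"
  by (simp add: bd_def sum.distrib distrib_left)

lemma bd_diff: "bd r E (\<lambda>S. y S - z S) T = bd r E y T - bd r E z T"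
  by (simp add: bd_def sum_subtractf right_diff_distrib)

lemma bd_mult: "bd r E (\<lambda>S. c * y S) T = c * bd r E y T"
  by (simp add: bd_def sum_distrib_left mult.left_commute)

lemma bd_sum: "bd r E (\<lambda>S. \<Sum>x\<in>A. f x S) T = (\<Sum>x\<in>A. bd r E (f x) T)"
  by (simp add: bd_def sum_distrib_left sum.swap[of _ _ A])

section \<open>The double complex of a resolution and the Koszul complex\<close>

locale resolution_koszul =
  fixes V :: "'v set" and K :: "'v set set" and r :: "'v \<Rightarrow> nat"
    and F :: "('v, 'k::field) mpoly free_complex" and d :: nat
  assumes V: "finite V" and K: "\<And>S T. S \<in> K \<Longrightarrow> T \<subseteq> S \<Longrightarrow> T \<in> K" and r: "inj_on r V"
    and F: "graded_free_resolution V (face_ideal V K) F"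
begin

text \<open>An element \<open>y\<close> of \<open>D p q\<close> is a chain of internal degree \<open>d\<close> in \<open>F\<^sub>p\<close> tensored with the \<open>q\<close>-th
  term of the Koszul complex; \<open>y a S\<close> is the coefficient at \<open>e\<^sub>a \<otimes> e\<^sub>S\<close> multiplied by the
  monomial of \<open>S\<close>.\<close>

definition D :: "nat \<Rightarrow> nat \<Rightarrow> (nat \<Rightarrow> 'v set \<Rightarrow> ('v, 'k) mpoly) set" where
  "D p q = {y. \<forall>a S u. lk (y a S) u \<noteq> 0 \<longrightarrow> a < fr_rank F p \<and> S \<subseteq> V \<and> card S = q \<and>
      S \<subseteq> ks u \<and> ks u \<subseteq> V \<and> mon_deg u + fr_deg F p a = d}"

text \<open>The differential of \<open>F\<close>, applied for each \<open>S\<close> separately, as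
  is the augmentation in \<open>ep\<close>. Both are linear over the polynomials and so compatible
  with the multiplication by the monomial of \<open>S\<close>.\<close>

definition df :: "nat \<Rightarrow> (nat \<Rightarrow> 'v set \<Rightarrow> ('v, 'k) mpoly) \<Rightarrow> nat \<Rightarrow> 'v set \<Rightarrow> ('v, 'k) mpoly" where
  "df p y = (\<lambda>a S. fr_map F p (\<lambda>c. y c S) a)"

text \<open>The Koszul differential sends the basis element of \<open>S\<close> to a signed sum of
  \<open>v\<close> times that of \<open>S - {v}\<close>. After multiplication by the monomial of
  \<open>S\<close> the factor \<open>v\<close> is absorbed, which leaves the boundary of a
  simplex.\<close>

definition dk :: "(nat \<Rightarrow> 'v set \<Rightarrow> ('v, 'k) mpoly) \<Rightarrow> nat \<Rightarrow> 'v set \<Rightarrow> ('v, 'k) mpoly" where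
  "dk y = (\<lambda>a. bd r V (y a))"

definition ep :: "(nat \<Rightarrow> 'v set \<Rightarrow> ('v, 'k) mpoly) \<Rightarrow> 'v set \<Rightarrow> ('v, 'k) mpoly" where
  "ep y = (\<lambda>S. fr_eps F (\<lambda>a. y a S))"

text \<open>\<open>XI S\<close> is the face ideal multiplied by the monomial of \<open>S\<close>, among the polynomials in \<open>V\<close> all of
  whose monomials are divisible by the latter.\<close>

definition XI :: "'v set \<Rightarrow> ('v, 'k) mpoly set" where
  "XI S = {p. \<forall>u. lk p u \<noteq> 0 \<longrightarrow> ks (u - chi S) \<notin> K}"

text \<open>\<open>kd\<close> and \<open>kk\<close> describe the kernels of the two differentials,
  with rows and columns extended by their augmentations: at \<open>p = 0\<close> the target comes
  from the face ring, at \<open>q = 0\<close> it is \<open>F \<otimes> k\<close>, where only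
  constant terms remain. With this convention rows and columns are exact everywhere.\<close>

definition kd :: "nat \<Rightarrow> (nat \<Rightarrow> 'v set \<Rightarrow> ('v, 'k) mpoly) \<Rightarrow> bool" where
  "kd p y \<longleftrightarrow> (case p of 0 \<Rightarrow> \<forall>S. ep y S \<in> XI S | Suc p' \<Rightarrow> df p' y = 0)"

definition kk :: "nat \<Rightarrow> (nat \<Rightarrow> 'v set \<Rightarrow> ('v, 'k) mpoly) \<Rightarrow> bool" where
  "kk q y \<longleftrightarrow> (case q of 0 \<Rightarrow> \<forall>a. lk (y a {}) 0 = 0 | Suc q' \<Rightarrow> dk y = 0)"

definition scal :: "'k \<Rightarrow> (nat \<Rightarrow> 'v set \<Rightarrow> ('v, 'k) mpoly) \<Rightarrow> nat \<Rightarrow> 'v set \<Rightarrow> ('v, 'k) mpoly" where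
  "scal c y = (\<lambda>a S. sing 0 c * y a S)"

section \<open>Linearity and commutation of the differentials\<close>

lemma finV: "S \<subseteq> V \<Longrightarrow> finite S"
  by (rule finite_subset[OF _ V])

lemma kd_0 [simp]: "kd 0 y \<longleftrightarrow> (\<forall>S. ep y S \<in> XI S)" and kd_Suc [simp]: "kd (Suc p) y \<longleftrightarrow> df p y = 0"
  by (simp_all add: kd_def)

lemma kk_0 [simp]: "kk 0 y \<longleftrightarrow> (\<forall>a. lk (y a {}) 0 = 0)" and kk_Suc [simp]: "kk (Suc q) y \<longleftrightarrow> dk y = 0"
  by (simp_all add: kk_def)

lemma DD:
  assumes "y \<in> D p q" "lk (y a S) u \<noteq> 0"
  shows "a < fr_rank F p" "S \<subseteq> V" "card S = q" "S \<subseteq> ks u" "ks u \<subseteq> V" "mon_deg u + fr_deg F p a = d"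
  using assms unfolding D_def by blast+

lemma D_zero: "y \<in> D p q \<Longrightarrow> \<not> (a < fr_rank F p \<and> S \<subseteq> V \<and> card S = q) \<Longrightarrow> y a S = 0"
  by (rule poly_mapping_eqI) (auto dest: DD)

lemma D_add: "x \<in> D p q \<Longrightarrow> y \<in> D p q \<Longrightarrow> x + y \<in> D p q"
  unfolding D_def by (clarsimp simp: lookup_add) (metis add.right_neutral)

lemma D_diff: "x \<in> D p q \<Longrightarrow> y \<in> D p q \<Longrightarrow> x - y \<in> D p q"
  unfolding D_def by (clarsimp simp: lookup_minus) (metis diff_zero)

lemma D_scal: "x \<in> D p q \<Longrightarrow> scal c x \<in> D p q"
  unfolding D_def scal_def by (simp add: lookup_mult_sing0) blast

lemma lookup_scal: "lk (scal c x a S) u = c * lk (x a S) u"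
  by (simp add: scal_def lookup_mult_sing0)

lemma df_eq: "df p y a S = (if a < fr_rank F p then \<Sum>c<fr_rank F (Suc p). fr_diff F p a c * y c S else 0)"
  by (simp add: df_def fr_map_def)

lemma ep_eq: "ep y S = (\<Sum>a<fr_rank F 0. fr_aug F a * y a S)"
  by (simp add: ep_def fr_eps_def)

lemma df_add: "df p (x + y) = df p x + df p y"
  by (intro ext) (simp add: df_eq sum.distrib distrib_left)

lemma df_diff: "df p (x - y) = df p x - df p y"
  by (intro ext) (simp add: df_eq sum_subtractf right_diff_distrib)

lemma df_scal: "df p (scal c x) = scal c (df p x)"
  by (intro ext) (simp add: df_eq scal_def sum_distrib_left mult.left_commute)

lemma ep_add: "ep (x + y) S = ep x S + ep y S"
  by (simp add: ep_eq sum.distrib distrib_left)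

lemma ep_diff: "ep (x - y) S = ep x S - ep y S"
  by (simp add: ep_eq sum_subtractf right_diff_distrib)

lemma ep_scal: "ep (scal c x) S = sing 0 c * ep x S"
  by (simp add: ep_eq scal_def sum_distrib_left mult.left_commute)

lemma dk_add: "dk (x + y) = dk x + dk y"
  by (intro ext) (simp add: dk_def bd_add plus_fun_def)

lemma dk_diff: "dk (x - y) = dk x - dk y"
  by (intro ext) (simp add: dk_def bd_diff fun_diff_def)

lemma dk_scal: "dk (scal c x) = scal c (dk x)"
  by (intro ext) (simp add: dk_def scal_def bd_mult)

lemma dk_dk: "dk (dk x) = 0"
  by (intro ext) (simp add: dk_def bd_bd[OF V r])

lemma df_dk: "df p (dk x) = dk (df p x)"
proof (intro ext)
  fix a T
  show "df p (dk x) a T = dk (df p x) a T"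
  proof (cases "a < fr_rank F p")
    case True
    then have "df p x a = (\<lambda>S. \<Sum>c<fr_rank F (Suc p). fr_diff F p a c * x c S)"
      by (intro ext) (simp add: df_eq)
    then show ?thesis using True by (simp add: df_eq dk_def bd_sum bd_mult)
  next
    case False
    then have "df p x a = (\<lambda>S. 0)" by (intro ext) (simp add: df_eq)
    then show ?thesis using False by (simp add: df_eq dk_def bd_def)
  qed
qed

lemma ep_dk: "ep (dk x) T = bd r V (ep x) T"
  unfolding ep_eq[abs_def] dk_def bd_sum bd_mult ..

lemma XI_0: "0 \<in> XI S"
  by (simp add: XI_def)

lemma XI_add: "p \<in> XI S \<Longrightarrow> q \<in> XI S \<Longrightarrow> p + q \<in> XI S"
  unfolding XI_def by (clarsimp simp: lookup_add) (metis add.right_neutral)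

lemma FI: "face_ideal V K = {p \<in> polys V. \<forall>u. lk p u \<noteq> (0 :: 'k) \<longrightarrow> ks u \<notin> K}"
  by (rule face_ideal_eq[OF V K])

section \<open>Degrees and vanishing composites\<close>

lemma diff_keys:
  assumes "a < fr_rank F p" "c < fr_rank F (Suc p)" "lk (fr_diff F p a c) u \<noteq> 0"
  shows "ks u \<subseteq> V" "mon_deg u + fr_deg F p a = fr_deg F (Suc p) c"
  using F assms unfolding graded_free_resolution_def graded_free_complex_def
  by (auto simp: polys_iff in_keys_iff)

lemma aug_keys:
  assumes "a < fr_rank F 0" "lk (fr_aug F a) u \<noteq> 0"
  shows "ks u \<subseteq> V" "mon_deg u = fr_deg F 0 a"
  using F assms unfolding graded_free_resolution_def graded_free_complex_def
  by (auto simp: polys_iff in_keys_iff hom_of_deg_def)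

lemma df_closed: assumes y: "y \<in> D (Suc p) q" shows "df p y \<in> D p q"
  unfolding D_def
proof (intro CollectI allI impI)
  fix a S u assume u: "lk (df p y a S) u \<noteq> 0"
  then have a: "a < fr_rank F p" by (auto simp: df_eq split: if_splits)
  with u have "lk (\<Sum>c<fr_rank F (Suc p). fr_diff F p a c * y c S) u \<noteq> 0" by (simp add: df_eq)
  then obtain c where c: "c < fr_rank F (Suc p)" "lk (fr_diff F p a c * y c S) u \<noteq> 0"
    by (rule lookup_sum_nonzeroE) auto
  from c(2) obtain m w where m: "u = m + w" "lk (fr_diff F p a c) m \<noteq> 0" "lk (y c S) w \<noteq> 0"
    by (rule in_keys_multE)
  note DD[OF y m(3)] diff_keys[OF a c(1) m(2)]
  then show "a < fr_rank F p \<and> S \<subseteq> V \<and> card S = q \<and> S \<subseteq> ks u \<and> ks u \<subseteq> V \<and> mon_deg u + fr_deg F p a = d"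
    using a m(1) by (auto simp: keys_add_nat mon_deg_add)
qed

lemma dk_closed: assumes y: "y \<in> D p (Suc q)" shows "dk y \<in> D p q"
  unfolding D_def
proof (intro CollectI allI impI)
  fix a T u assume u: "lk (dk y a T) u \<noteq> 0"
  then have T: "T \<subseteq> V" by (auto simp: dk_def bd_def split: if_splits)
  with u have "lk (\<Sum>e\<in>V - T. sg r e T * y a (insert e T)) u \<noteq> 0" by (simp add: dk_def bd_def)
  then obtain e where e: "e \<in> V - T" "lk (sg r e T * y a (insert e T)) u \<noteq> 0"
    by (rule lookup_sum_nonzeroE)
  then have "lk (y a (insert e T)) u \<noteq> 0" by (simp add: lookup_sg)
  note DD[OF y this]
  then show "a < fr_rank F p \<and> T \<subseteq> V \<and> card T = q \<and> T \<subseteq> ks u \<and> ks u \<subseteq> V \<and> mon_deg u + fr_deg F p a = d"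
    using e finV[OF T] by auto
qed

text \<open>For a fixed \<open>S\<close>, dividing by its monomial gives an element of the free
  module itself, to which the exactness of the resolution applies.\<close>

lemma D_factor:
  assumes y: "y \<in> D p q"
  obtains g where "g \<in> fr_mod V F p" "\<And>a. y a S = xmon S * g a"
proof (cases "S \<subseteq> V")
  case False
  then have "y a S = 0" for a using D_zero[OF y] by blast
  moreover have "0 \<in> fr_mod V F p" by (simp add: fr_mod_def)
  ultimately show ?thesis using that[of 0] by simp
next
  case True
  have "\<exists>g. y a S = xmon S * g" for a
  proof -
    obtain g where "y a S = xmon S * g"
      by (rule xmon_factor[OF finV[OF True], of "y a S"]) (use DD(4)[OF y] in blast)
    then show ?thesis by blast
  qed
  then obtain g where g: "\<And>a. y a S = xmon S * g a" by metis
  have "g \<in> fr_mod V F p"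
  proof -
    have "lk (g a) u = 0 \<or> (a < fr_rank F p \<and> ks u \<subseteq> V)" for a u
    proof (cases "lk (g a) u = 0")
      case False
      then have *: "lk (y a S) (chi S + u) \<noteq> 0" by (simp add: g lookup_xmon_mult)
      show ?thesis using DD(1,5)[OF y *] by (simp add: keys_add_nat)
    qed simp
    then show ?thesis unfolding fr_mod_def polys_iff
      by (auto intro!: poly_mapping_eqI) (metis leD)
  qed
  then show ?thesis using that g by blast
qed

lemma fr_map_xmon: "fr_map F p (\<lambda>a. x * g a) a = x * fr_map F p g a"
  by (simp add: fr_map_def sum_distrib_left mult.left_commute)

lemma fr_eps_xmon: "fr_eps F (\<lambda>a. x * g a) = x * fr_eps F g"
  by (simp add: fr_eps_def sum_distrib_left mult.left_commute)

lemma xmon_XI: "finite S \<Longrightarrow> g \<in> face_ideal V K \<Longrightarrow> xmon S * g \<in> XI S"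
  unfolding XI_def FI by (auto elim!: xmon_mult_nonzeroE)

lemma xmon_XI_D: "xmon S * g \<in> XI S \<Longrightarrow> g \<in> polys V \<Longrightarrow> g \<in> face_ideal V K"
proof -
  assume a: "xmon S * g \<in> XI S" "g \<in> polys V"
  have "ks u \<notin> K" if "lk g u \<noteq> 0" for u
  proof -
    have "lk (xmon S * g) (chi S + u) \<noteq> 0" using that by (simp add: lookup_xmon_mult)
    then have "ks (chi S + u - chi S) \<notin> K" using a(1) unfolding XI_def by blast
    then show ?thesis by simp
  qed
  then show ?thesis using a(2) by (simp add: FI)
qed

lemma eps_polys: "x \<in> fr_mod V F 0 \<Longrightarrow> fr_eps F x \<in> polys V"
  unfolding fr_eps_def
proof (intro polys_sum polys_mult)
  fix a assume "a \<in> {..<fr_rank F 0}"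
  then show "fr_aug F a \<in> polys V" using F
    by (simp add: graded_free_resolution_def graded_free_complex_def)
qed (auto simp: fr_mod_def)

lemma kd_df: assumes y: "y \<in> D (Suc p) q" shows "kd p (df p y)"
proof (cases p)
  case (Suc p')
  have "fr_map F p' (fr_map F p (\<lambda>c. y c S)) = 0" for S
  proof -
    obtain g where g: "g \<in> fr_mod V F (Suc p)" "\<And>a. y a S = xmon S * g a" using D_factor[OF y] by blast
    have "fr_map F (Suc p') g \<in> {x \<in> fr_mod V F (Suc p'). fr_map F p' x = 0}"
      using F g Suc unfolding graded_free_resolution_def by blast
    then have "fr_map F p' (fr_map F p g) = 0" using Suc by simp
    then have "fr_map F p' (fr_map F p (\<lambda>c. y c S)) a = 0" for a
      unfolding g(2) fr_map_xmon by simp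
    then show ?thesis by auto
  qed
  then show ?thesis using Suc by (auto simp: df_def fun_eq_iff)
next
  case 0
  have "ep (df p y) S \<in> XI S" for S
  proof (cases "S \<subseteq> V")
    case True
    obtain g where g: "g \<in> fr_mod V F (Suc p)" "\<And>a. y a S = xmon S * g a" using D_factor[OF y] by blast
    have "fr_map F 0 g \<in> {x \<in> fr_mod V F 0. fr_eps F x \<in> face_ideal V K}"
      using F g 0 unfolding graded_free_resolution_def by auto
    then have "xmon S * fr_eps F (fr_map F 0 g) \<in> XI S"
      by (intro xmon_XI finV True) simp
    then show ?thesis unfolding ep_def df_def g(2) 0 fr_map_xmon fr_eps_xmon .
  next
    case False
    then have "y c S = 0" for c using D_zero[OF y] by blast
    then have "df p y a S = 0" for a by (simp add: df_eq)
    then have "ep (df p y) S = 0" by (simp add: ep_eq)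
    then show ?thesis by (simp add: XI_0)
  qed
  then show ?thesis using 0 by simp
qed

lemma kk_dk: assumes y: "y \<in> D p (Suc q)" shows "kk q (dk y)"
proof (cases q)
  case 0
  have "lk (dk y a {}) 0 = 0" for a
  proof (rule ccontr)
    assume "\<not> ?thesis"
    then have "lk (\<Sum>e\<in>V - {}. sg r e {} * y a (insert e {})) 0 \<noteq> 0" by (simp add: dk_def bd_def)
    then obtain e where "lk (sg r e {} * y a {e}) 0 \<noteq> 0" by (rule lookup_sum_nonzeroE)
    then have "lk (y a {e}) 0 \<noteq> 0" by (simp add: lookup_sg)
    \<comment> \<open>The coefficient at \<open>{e}\<close> is divisible by the variable
      \<open>e\<close>, so it has no constant term.\<close>
    from DD(4)[OF y this] show False by simp
  qed
  then show ?thesis using 0 by simp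
qed (simp add: dk_dk)

section \<open>Exactness in a fixed internal degree\<close>

lemma cut_fr_map:
  assumes a: "a < fr_rank F p"
  shows "cut (\<lambda>u. mon_deg u + fr_deg F p a = d) (fr_map F p x a) =
    fr_map F p (\<lambda>c. cut (\<lambda>u. mon_deg u + fr_deg F (Suc p) c = d) (x c)) a"
  using a unfolding fr_map_def
  by (auto simp: cut_sum mon_deg_add dest!: diff_keys(2)[OF a] intro!: sum.cong cut_mult)

lemma cut_fr_eps:
  "cut (\<lambda>u. mon_deg u = d) (fr_eps F x) = fr_eps F (\<lambda>a. cut (\<lambda>u. mon_deg u + fr_deg F 0 a = d) (x a))"
  unfolding fr_eps_def
  by (auto simp: cut_sum mon_deg_add dest!: aug_keys(2) intro!: sum.cong cut_mult)

text \<open>Exactness of the resolution is not stated degree by degree, so a preimage obtained from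
  it may be inhomogeneous; its component of internal degree \<open>d\<close> is used
  instead.\<close>

definition hom_part :: "nat \<Rightarrow> 'v set \<Rightarrow> (nat \<Rightarrow> ('v, 'k) mpoly) \<Rightarrow> nat \<Rightarrow> ('v, 'k) mpoly" where
  "hom_part p S g = (\<lambda>a. cut (\<lambda>u. mon_deg u + fr_deg F p a = d) (xmon S * g a))"

lemma D_hom_part:
  assumes "\<And>S. g S \<in> fr_mod V F p"
  shows "(\<lambda>a S. if S \<subseteq> V \<and> card S = q then hom_part p S (g S) a else 0) \<in> D p q"
  unfolding D_def
proof (intro CollectI allI impI)
  fix a S u assume "lk (if S \<subseteq> V \<and> card S = q then hom_part p S (g S) a else 0) u \<noteq> 0"
  then have S: "S \<subseteq> V" "card S = q" "mon_deg u + fr_deg F p a = d" "lk (xmon S * g S a) u \<noteq> 0"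
    by (auto simp: hom_part_def split: if_splits)
  from S(4) obtain w where w: "u = chi S + w" "lk (g S a) w \<noteq> 0" by (rule xmon_mult_nonzeroE)
  have a: "a < fr_rank F p"
  proof (rule ccontr)
    assume "\<not> a < fr_rank F p"
    then have "g S a = 0" using assms[of S] by (simp add: fr_mod_def)
    then show False using w(2) by simp
  qed
  then have "ks w \<subseteq> V"
    using assms[of S] w(2) by (auto simp: fr_mod_def polys_iff)
  then show "a < fr_rank F p \<and> S \<subseteq> V \<and> card S = q \<and> S \<subseteq> ks u \<and> ks u \<subseteq> V \<and> mon_deg u + fr_deg F p a = d"
    using a S w finV[OF S(1)] by (auto simp: keys_add_nat)
qed

text \<open>Preimages are found for each \<open>S\<close> separately and then cut down to degree
  \<open>d\<close>. The image stays the same, because the differential preserves internal degrees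
  and \<open>z\<close> is already homogeneous.\<close>

lemma exact_df:
  assumes z: "z \<in> D p q" and k: "kd p z"
  shows "\<exists>x\<in>D (Suc p) q. df p x = z"
proof -
  have "\<exists>g'\<in>fr_mod V F (Suc p). \<forall>a. z a S = xmon S * fr_map F p g' a" for S
  proof -
    obtain g where g: "g \<in> fr_mod V F p" "\<And>a. z a S = xmon S * g a" using D_factor[OF z] by blast
    have "g \<in> fr_map F p ` fr_mod V F (Suc p)"
    proof (cases p)
      case 0
      have "ep z S = xmon S * fr_eps F g" by (simp add: ep_def g(2) fr_eps_xmon)
      then have "xmon S * fr_eps F g \<in> XI S" using k 0 by (metis kd_0)
      then have "fr_eps F g \<in> face_ideal V K" using g 0 eps_polys by (intro xmon_XI_D[of S]) auto
      then show ?thesis using F g 0 unfolding graded_free_resolution_def by auto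
    next
      case (Suc p')
      have "xmon S * fr_map F p' g a = xmon S * 0" for a
        using k Suc unfolding fr_map_xmon[symmetric] g(2)[symmetric] by (simp add: df_def fun_eq_iff)
      then have "fr_map F p' g = 0" unfolding xmon_cancel by auto
      then have "g \<in> {x \<in> fr_mod V F (Suc p'). fr_map F p' x = 0}" using g(1) Suc by simp
      moreover have "{x \<in> fr_mod V F (Suc p'). fr_map F p' x = 0} = fr_map F (Suc p') ` fr_mod V F (Suc (Suc p'))"
        using F unfolding graded_free_resolution_def by blast
      ultimately show ?thesis using Suc by simp
    qed
    then show ?thesis using g by auto
  qed
  then obtain g' where g': "\<And>S. g' S \<in> fr_mod V F (Suc p)" "\<And>S a. z a S = xmon S * fr_map F p (g' S) a"
    by metis
  let ?x = "\<lambda>a S. if S \<subseteq> V \<and> card S = q then hom_part (Suc p) S (g' S) a else 0"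
  have "df p ?x a S = z a S" for a S
  proof (cases "a < fr_rank F p \<and> S \<subseteq> V \<and> card S = q")
    case True
    have "df p ?x a S = fr_map F p (\<lambda>c. cut (\<lambda>u. mon_deg u + fr_deg F (Suc p) c = d) (xmon S * g' S c)) a"
      using True by (simp add: df_def hom_part_def)
    also have "\<dots> = cut (\<lambda>u. mon_deg u + fr_deg F p a = d) (z a S)"
      using True by (simp add: cut_fr_map[symmetric] fr_map_xmon g'(2))
    also have "\<dots> = z a S" by (rule cut_id) (rule DD(6)[OF z])
    finally show ?thesis .
  next
    case False
    then have "z a S = 0" using D_zero[OF z] by blast
    moreover have "df p ?x a S = 0"
    proof (cases "a < fr_rank F p")
      case True
      then have "(S \<subseteq> V \<and> card S = q) = False" using False by blast
      then show ?thesis by (simp only: df_eq if_False) simp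
    qed (simp add: df_eq)
    ultimately show ?thesis by simp
  qed
  then show ?thesis using D_hom_part[of g' "Suc p" q] g'(1) by (intro bexI[of _ ?x]) auto
qed

text \<open>The augmentation is surjective only modulo the ideal, hence the error term in
  \<open>XI S\<close>.\<close>

lemma surj_ep:
  assumes z: "\<And>S u. lk (z S) u \<noteq> 0 \<Longrightarrow> S \<subseteq> V \<and> card S = q \<and> S \<subseteq> ks u \<and> ks u \<subseteq> V \<and> mon_deg u = d"
  shows "\<exists>x\<in>D 0 q. \<forall>S. z S - ep x S \<in> XI S"
proof -
  have "\<exists>x\<in>fr_mod V F 0. S \<subseteq> V \<longrightarrow> z S - xmon S * fr_eps F x \<in> XI S" for S
  proof (cases "S \<subseteq> V")
    case True
    obtain g where g: "z S = xmon S * g"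
      by (rule xmon_factor[OF finV[OF True], of "z S"]) (use z in blast)
    have "g \<in> polys V" unfolding polys_iff
    proof (intro allI impI)
      fix u assume "lk g u \<noteq> 0"
      then have "lk (z S) (chi S + u) \<noteq> 0" by (simp add: g lookup_xmon_mult)
      then show "ks u \<subseteq> V" using z[of S "chi S + u"] by (simp add: keys_add_nat)
    qed
    then obtain x where x: "x \<in> fr_mod V F 0" "g - fr_eps F x \<in> face_ideal V K"
      using F unfolding graded_free_resolution_def by blast
    have "z S - xmon S * fr_eps F x \<in> XI S"
      using xmon_XI[OF finV[OF True] x(2)] by (simp add: g right_diff_distrib)
    then show ?thesis using x by blast
  next
    case False
    moreover have "0 \<in> fr_mod V F 0" by (simp add: fr_mod_def)
    ultimately show ?thesis by blast
  qed
  then obtain g where g: "\<And>S. g S \<in> fr_mod V F 0" "\<And>S. S \<subseteq> V \<Longrightarrow> z S - xmon S * fr_eps F (g S) \<in> XI S"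
    by metis
  let ?x = "\<lambda>a S. if S \<subseteq> V \<and> card S = q then hom_part 0 S (g S) a else 0"
  have "z S - ep ?x S \<in> XI S" for S
  proof (cases "S \<subseteq> V \<and> card S = q")
    case True
    have "ep ?x S = cut (\<lambda>u. mon_deg u = d) (xmon S * fr_eps F (g S))"
      using True by (simp add: ep_def hom_part_def cut_fr_eps[symmetric] fr_eps_xmon)
    moreover have "z S = cut (\<lambda>u. mon_deg u = d) (z S)" by (rule cut_id[symmetric]) (use z in blast)
    moreover have "cut (\<lambda>u. mon_deg u = d) (z S - xmon S * fr_eps F (g S)) =
        cut (\<lambda>u. mon_deg u = d) (z S) - cut (\<lambda>u. mon_deg u = d) (xmon S * fr_eps F (g S))"
      by (rule poly_mapping_eqI) (simp add: lookup_minus)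
    ultimately have "z S - ep ?x S = cut (\<lambda>u. mon_deg u = d) (z S - xmon S * fr_eps F (g S))"
      by simp
    then show ?thesis using g(2)[of S] True by (auto simp: XI_def)
  next
    case False
    then have "lk (z S) u = 0" for u using z by blast
    then have "z S = 0" by (intro poly_mapping_eqI) simp
    moreover have "ep ?x S = 0" unfolding ep_eq using False by (intro sum.neutral) auto
    ultimately show ?thesis by (simp add: XI_0)
  qed
  then show ?thesis using D_hom_part[of g 0 q] g(1) by (intro bexI[of _ ?x]) auto
qed

text \<open>Any variable dividing \<open>u\<close> can be the apex of the cone, which is why
  \<open>u \<noteq> 0\<close> is required. The exponents of the result already occur in
  \<open>z\<close>, so degrees are preserved.\<close>

lemma koszul_exact:
  fixes z :: "'v set \<Rightarrow> ('v, 'k) mpoly"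
  assumes keys: "\<And>S u. lk (z S) u \<noteq> 0 \<Longrightarrow> S \<subseteq> V \<and> card S = q \<and> S \<subseteq> ks u \<and> ks u \<subseteq> V \<and> u \<noteq> 0"
    and cyc: "\<And>T. bd r V z T = 0"
  shows "\<exists>y. (\<forall>S u. lk (y S) u \<noteq> 0 \<longrightarrow> S \<subseteq> V \<and> card S = Suc q \<and> S \<subseteq> ks u \<and> (\<exists>S'. lk (z S') u \<noteq> (0 :: 'k)))
    \<and> bd r V y = z"
proof -
  define pick where "pick u = (SOME v. v \<in> ks u)" for u :: "'v \<Rightarrow>\<^sub>0 nat"
  have pick: "pick u \<in> ks u" if "u \<noteq> 0" for u
  proof -
    have "\<exists>v. v \<in> ks u" using that by (simp add: ex_in_conv)
    then show ?thesis unfolding pick_def by (rule someI_ex)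
  qed
  have pk: "pick u \<in> V" if "lk (z S) u \<noteq> 0" for S u
    using pick[of u] keys[OF that] by blast
  have 1: "S \<subseteq> V \<and> card S = Suc q \<and> S \<subseteq> ks u \<and> (\<exists>S'. lk (z S') u \<noteq> 0)"
    if nz: "lk (contraction r V pick z S) u \<noteq> 0" for S u
  proof -
    have S: "S \<subseteq> V" using nz by (auto simp: contraction_def split: if_splits)
    have fS: "finite S" by (rule finV[OF S])
    have *: "pick u \<in> S" "lk (z (S - {pick u})) u \<noteq> 0"
      using nz unfolding lookup_contraction[OF fS S] by (auto split: if_splits)
    have "pick u \<in> ks u" using keys[OF *(2)] pick by blast
    moreover have "card S = Suc q" using keys[OF *(2)] card.remove[OF fS *(1)] by simp
    moreover have "S - {pick u} \<subseteq> ks u" using keys[OF *(2)] by blast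
    ultimately show ?thesis using S *(2) by blast
  qed
  have "bd r V (contraction r V pick z) T = z T" for T
  proof (cases "T \<subseteq> V")
    case True
    then show ?thesis by (intro bd_contraction V r cyc) (auto intro: pk)
  next
    case False
    then have "lk (z T) u = 0" for u using keys by blast
    then have "z T = 0" by (intro poly_mapping_eqI) simp
    then show ?thesis using False by (simp add: bd_def)
  qed
  then show ?thesis using 1 by blast
qed

lemma exact_dk:
  assumes z: "z \<in> D p q" and k: "kk q z"
  shows "\<exists>y\<in>D p (Suc q). dk y = z"
proof -
  have "\<exists>y. (\<forall>S u. lk (y S) u \<noteq> 0 \<longrightarrow> S \<subseteq> V \<and> card S = Suc q \<and> S \<subseteq> ks u \<and> (\<exists>S'. lk (z a S') u \<noteq> 0))
      \<and> bd r V y = z a" for a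
  proof (rule koszul_exact)
    fix S u assume nz: "lk (z a S) u \<noteq> 0"
    note h = DD[OF z nz]
    \<comment> \<open>For \<open>q > 0\<close> some variable divides the monomial since
      \<open>S\<close> is nonempty; for \<open>q = 0\<close> the constant terms vanish by
      \<open>kk\<close>.\<close>
    have "u \<noteq> 0"
    proof (cases q)
      case 0
      then have "S = {}" using h(2,3) finV by auto
      then show ?thesis using nz k 0 by auto
    next
      case (Suc q')
      then have "S \<noteq> {}" using h by auto
      then show ?thesis using h by auto
    qed
    then show "S \<subseteq> V \<and> card S = q \<and> S \<subseteq> ks u \<and> ks u \<subseteq> V \<and> u \<noteq> 0" using h by blast
  next
    fix T
    show "bd r V (z a) T = 0"
    proof (cases q)
      case 0
      have "z a (insert e T) = 0" if "T \<subseteq> V" for e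
        using D_zero[OF z, of a "insert e T"] 0 finV[OF that] by auto
      then show ?thesis by (auto simp: bd_def)
    next
      case (Suc q')
      then show ?thesis using k by (simp add: dk_def fun_eq_iff)
    qed
  qed
  then obtain y where y: "\<And>a S u. lk (y a S) u \<noteq> 0 \<Longrightarrow>
      S \<subseteq> V \<and> card S = Suc q \<and> S \<subseteq> ks u \<and> (\<exists>S'. lk (z a S') u \<noteq> 0)" "\<And>a. bd r V (y a) = z a"
    by metis
  have "y \<in> D p (Suc q)" unfolding D_def
  proof (intro CollectI allI impI)
    fix a S u assume *: "lk (y a S) u \<noteq> 0"
    then obtain S' where "lk (z a S') u \<noteq> 0" using y(1) by blast
    note h = DD[OF z this]
    show "a < fr_rank F p \<and> S \<subseteq> V \<and> card S = Suc q \<and> S \<subseteq> ks u \<and> ks u \<subseteq> V \<and> mon_deg u + fr_deg F p a = d"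
      using h(1,5,6) y(1)[OF *] by blast
  qed
  moreover have "dk y = z" using y(2) by (simp add: dk_def)
  ultimately show ?thesis by blast
qed

text \<open>In the interior both conditions say that the composite of \<open>df\<close> and
  \<open>dk\<close> vanishes. At \<open>q = 0\<close> the elements represent cycles of
  \<open>F \<otimes> k\<close>, at \<open>p = 0\<close> Koszul cycles of the face ring; the zigzag
  connects these two ends.\<close>

definition ZZ :: "nat \<Rightarrow> nat \<Rightarrow> (nat \<Rightarrow> 'v set \<Rightarrow> ('v, 'k) mpoly) set" where
  "ZZ p q = {x \<in> D p q. (\<forall>p'. p = Suc p' \<longrightarrow> kk q (df p' x)) \<and> (\<forall>q'. q = Suc q' \<longrightarrow> kd p (dk x))}"

definition BB :: "nat \<Rightarrow> nat \<Rightarrow> (nat \<Rightarrow> 'v set \<Rightarrow> ('v, 'k) mpoly) set" where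
  "BB p q = {x1 + x2 | x1 x2. x1 \<in> D p q \<and> x2 \<in> D p q \<and> kd p x1 \<and> kk q x2}"

text \<open>One step of the zigzag through the double complex. Both subquotients \<open>ZZ / BB\<close> are of the form
  (kernel of the composite differential) / (sum of the kernels of the two differentials).\<close>

lemma corr_step:
  "corr scal scal (ZZ (Suc p) q) (BB (Suc p) q) (ZZ p (Suc q)) (BB p (Suc q))
     (\<lambda>x y. x \<in> D (Suc p) q \<and> y \<in> D p (Suc q) \<and> df p x = dk y)"
  unfolding corr_def
proof (intro conjI allI impI ballI)
  fix x assume "x \<in> ZZ (Suc p) q"
  then have "x \<in> D (Suc p) q" "kk q (df p x)" by (auto simp: ZZ_def)
  then show "\<exists>y. x \<in> D (Suc p) q \<and> y \<in> D p (Suc q) \<and> df p x = dk y"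
    using exact_dk[OF df_closed] by metis
next
  fix y assume "y \<in> ZZ p (Suc q)"
  then have "y \<in> D p (Suc q)" "kd p (dk y)" by (auto simp: ZZ_def)
  then show "\<exists>x. x \<in> D (Suc p) q \<and> y \<in> D p (Suc q) \<and> df p x = dk y"
    using exact_df[OF dk_closed] by metis
next
  fix x y assume "x \<in> D (Suc p) q \<and> y \<in> D p (Suc q) \<and> df p x = dk y"
  then have x: "x \<in> D (Suc p) q" and y: "y \<in> D p (Suc q)" and e: "df p x = dk y" by auto
  have "df p (dk x) = 0" unfolding df_dk e dk_dk ..
  then show "x \<in> ZZ (Suc p) q" using x e kk_dk[OF y] by (simp add: ZZ_def)
  have "dk (df p' y) = 0" if "p = Suc p'" for p'
    using kd_df[OF x] that unfolding df_dk[symmetric] e[symmetric] by simp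
  then show "y \<in> ZZ p (Suc q)" using y e kd_df[OF x] by (simp add: ZZ_def)
  show "x \<in> BB (Suc p) q \<longleftrightarrow> y \<in> BB p (Suc q)"
  proof
    assume "x \<in> BB (Suc p) q"
    then obtain x1 x2 where x12: "x1 \<in> D (Suc p) q" "x2 \<in> D (Suc p) q" "df p x1 = 0" "kk q x2" "x = x1 + x2"
      by (auto simp: BB_def)
    \<comment> \<open>The summand \<open>x1\<close> is killed by \<open>df\<close>, and
      \<open>x2\<close> is lifted to \<open>w\<close>; then \<open>y\<close> and
      \<open>df p w\<close> have the same image under \<open>dk\<close>.\<close>
    obtain w where w: "w \<in> D (Suc p) (Suc q)" "dk w = x2" using exact_dk x12 by blast
    have "dk y = dk (df p w)" unfolding e[symmetric] x12 df_add w(2)[symmetric] df_dk by (simp add: x12(3))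
    then have "kk (Suc q) (y - df p w)" by (simp add: dk_diff)
    moreover have "df p w \<in> D p (Suc q)" using w by (intro df_closed)
    moreover have "y = df p w + (y - df p w)" by simp
    ultimately show "y \<in> BB p (Suc q)" unfolding BB_def using kd_df[OF w(1)] D_diff[OF y] by blast
  next
    assume "y \<in> BB p (Suc q)"
    then obtain y1 y2 where y12: "y1 \<in> D p (Suc q)" "y2 \<in> D p (Suc q)" "kd p y1" "dk y2 = 0" "y = y1 + y2"
      by (auto simp: BB_def)
    obtain w where w: "w \<in> D (Suc p) (Suc q)" "df p w = y1" using exact_df y12 by blast
    have "df p x = df p (dk w)" unfolding e y12 dk_add w(2)[symmetric] df_dk by (simp add: y12(4))
    then have "kd (Suc p) (x - dk w)" by (simp add: df_diff)
    moreover have "dk w \<in> D (Suc p) q" using w by (intro dk_closed)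
    moreover have "x = (x - dk w) + dk w" by simp
    ultimately show "x \<in> BB (Suc p) q" unfolding BB_def using kk_dk[OF w(1)] D_diff[OF x] by blast
  qed
next
  fix x y x' y'
  assume "x \<in> D (Suc p) q \<and> y \<in> D p (Suc q) \<and> df p x = dk y" "x' \<in> D (Suc p) q \<and> y' \<in> D p (Suc q) \<and> df p x' = dk y'"
  then show "x + x' \<in> D (Suc p) q" "y + y' \<in> D p (Suc q)" "df p (x + x') = dk (y + y')"
    by (simp_all add: D_add df_add dk_add)
next
  fix c x y assume "x \<in> D (Suc p) q \<and> y \<in> D p (Suc q) \<and> df p x = dk y"
  then show "scal c x \<in> D (Suc p) q" "scal c y \<in> D p (Suc q)" "df p (scal c x) = dk (scal c y)"
    by (simp_all add: D_scal df_scal dk_scal)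
qed

lemma corr_zigzag:
  "\<exists>R. corr scal scal (ZZ (Suc p) q) (BB (Suc p) q) (ZZ 0 (Suc p + q)) (BB 0 (Suc p + q)) R"
proof (induction p arbitrary: q)
  case 0
  then show ?case using corr_step[of 0 q] by auto
next
  case (Suc p)
  obtain R where "corr scal scal (ZZ (Suc p) (Suc q)) (BB (Suc p) (Suc q)) (ZZ 0 (Suc p + Suc q)) (BB 0 (Suc p + Suc q)) R"
    using Suc by blast
  from corr_trans[OF corr_step[of "Suc p" q] this] show ?case by auto
qed

section \<open>The end of the zigzag: constant terms\<close>

lemma lookup_df_0: "lk (df p x a S) 0 = tens_map F p (\<lambda>c. lk (x c S) 0) a"
  by (simp add: df_eq tens_map_def lookup_sum lookup_mult_0)

definition const :: "(nat \<Rightarrow> 'k) \<Rightarrow> nat \<Rightarrow> 'v set \<Rightarrow> ('v, 'k) mpoly" where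
  "const t = (\<lambda>a S. if S = {} then sing 0 (t a) else 0)"

lemma const_D: "t \<in> tens_space F p d \<Longrightarrow> const t \<in> D p 0"
  unfolding tens_space_def D_def const_def by (auto simp: lookup_single when_def split: if_splits)

lemma const_lookup [simp]: "lk (const t a {}) 0 = t a"
  by (simp add: const_def)

lemma D_const: assumes "x \<in> D p 0" shows "(\<lambda>a. lk (x a {}) 0) \<in> tens_space F p d"
  using DD[OF assms, of _ "{}" 0] by (auto simp: tens_space_def)

text \<open>Taking constant terms identifies the end \<open>q = 0\<close> of the zigzag with the
  homology of \<open>F \<otimes> k\<close>, and \<open>const\<close> is a section. A chain without
  constant terms lies in \<open>BB\<close> by the convention for \<open>kk 0\<close>.\<close>

lemma corr_tens:
  "corr fun_scale scal (tens_cycles F (Suc p) d) (tens_boundaries F (Suc p) d) (ZZ (Suc p) 0) (BB (Suc p) 0)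
    (\<lambda>t x. x \<in> ZZ (Suc p) 0 \<and> t = (\<lambda>a. lk (x a {}) 0))"
  unfolding corr_def
proof (intro conjI allI impI ballI)
  fix t assume t: "t \<in> tens_cycles F (Suc p) d"
  then have "const t \<in> D (Suc p) 0" "tens_map F p t = 0" by (auto simp: tens_cycles_def const_D)
  then have "const t \<in> ZZ (Suc p) 0" by (simp add: ZZ_def lookup_df_0)
  then show "\<exists>x. x \<in> ZZ (Suc p) 0 \<and> t = (\<lambda>a. lk (x a {}) 0)" by (intro exI[of _ "const t"]) simp
next
  fix t x assume a: "x \<in> ZZ (Suc p) 0 \<and> t = (\<lambda>a. lk (x a {}) 0)"
  then have x: "x \<in> D (Suc p) 0" and k: "kk 0 (df p x)" and t: "t = (\<lambda>a. lk (x a {}) 0)"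
    by (auto simp: ZZ_def)
  show "x \<in> ZZ (Suc p) 0" using a by blast
  show "t \<in> tens_cycles F (Suc p) d"
    using D_const[OF x] k by (auto simp: tens_cycles_def t lookup_df_0 fun_eq_iff)
  show "t \<in> tens_boundaries F (Suc p) d \<longleftrightarrow> x \<in> BB (Suc p) 0"
  proof
    assume "t \<in> tens_boundaries F (Suc p) d"
    then obtain t' where t': "t' \<in> tens_space F (Suc (Suc p)) d" "t = tens_map F (Suc p) t'"
      by (auto simp: tens_boundaries_def)
    let ?w = "df (Suc p) (const t')"
    have w: "const t' \<in> D (Suc (Suc p)) 0" using t' by (intro const_D)
    have "lk (x a {}) 0 = lk (?w a {}) 0" for a
      using fun_cong[OF t, of a] fun_cong[OF t'(2), of a] by (simp add: lookup_df_0)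
    then have "kk 0 (x - ?w)" by (simp add: lookup_minus)
    moreover have "x = ?w + (x - ?w)" by simp
    ultimately show "x \<in> BB (Suc p) 0" unfolding BB_def
      using kd_df[OF w] df_closed[OF w] D_diff[OF x] by blast
  next
    assume "x \<in> BB (Suc p) 0"
    then obtain x1 x2 where x12: "x1 \<in> D (Suc p) 0" "x2 \<in> D (Suc p) 0" "kd (Suc p) x1" "kk 0 x2" "x = x1 + x2"
      by (auto simp: BB_def)
    obtain w where w: "w \<in> D (Suc (Suc p)) 0" "df (Suc p) w = x1" using exact_df x12 by blast
    have "t = tens_map F (Suc p) (\<lambda>a. lk (w a {}) 0)"
      using x12(4) by (auto simp: t x12(5) w(2)[symmetric] lookup_add lookup_df_0 fun_eq_iff)
    then show "t \<in> tens_boundaries F (Suc p) d" using D_const[OF w(1)] by (auto simp: tens_boundaries_def)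
  qed
next
  fix c t x assume a: "x \<in> ZZ (Suc p) 0 \<and> t = (\<lambda>a. lk (x a {}) 0)"
  then show "scal c x \<in> ZZ (Suc p) 0"
    by (auto simp: ZZ_def D_scal df_scal lookup_scal)
  show "fun_scale c t = (\<lambda>a. lk (scal c x a {}) 0)"
    using a by (auto simp: fun_scale_def lookup_scal)
next
  fix t x t' x' assume a: "x \<in> ZZ (Suc p) 0 \<and> t = (\<lambda>a. lk (x a {}) 0)" "x' \<in> ZZ (Suc p) 0 \<and> t' = (\<lambda>a. lk (x' a {}) 0)"
  then show "x + x' \<in> ZZ (Suc p) 0" by (auto simp: ZZ_def D_add df_add lookup_add)
  show "t + t' = (\<lambda>a. lk ((x + x') a {}) 0)" using a by (auto simp: lookup_add fun_eq_iff)
qed auto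

end

section \<open>Dimensions\<close>

definition unit_fun :: "nat \<Rightarrow> nat \<Rightarrow> 'k::field" where
  "unit_fun k = (\<lambda>j. if j = k then 1 else 0)"

lemma sum_unit_fun:
  assumes "\<forall>k\<ge>M. f k = 0"
  shows "(\<Sum>k<M. fun_scale (f k) (unit_fun k)) = (f :: nat \<Rightarrow> 'k::field)"
proof
  fix j
  have "(\<Sum>k<M. fun_scale (f k) (unit_fun k)) j = (\<Sum>k<M. fun_scale (f k) (unit_fun k) j)"
    by (induction M) (auto simp: zero_fun_def plus_fun_def)
  also have "\<dots> = (\<Sum>k<M. if k = j then f j else 0)"
    by (rule sum.cong) (auto simp: fun_scale_def unit_fun_def)
  also have "\<dots> = f j" using assms by (auto simp: not_less)
  finally show "(\<Sum>k<M. fun_scale (f k) (unit_fun k)) j = f j" .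
qed

text \<open>The functions vanishing from \<open>M\<close> on are a model of the
  \<open>M\<close>-dimensional space. A basis of \<open>B\<close> is extended by elements related to
  the unit vectors; the bound \<open>n\<close> on the supports in \<open>Z\<close> makes that basis
  finite.\<close>

lemma corr_dim:
  fixes Z B :: "(nat \<Rightarrow> 'k::field) set"
  assumes R: "corr fun_scale fun_scale Z B {f :: nat \<Rightarrow> 'k. \<forall>k\<ge>M. f k = 0} {0} R"
    and BZ: "B \<subseteq> Z" and Z: "\<And>x a. x \<in> Z \<Longrightarrow> a \<ge> n \<Longrightarrow> x a = 0"
  shows "funs.dim Z = funs.dim B + M"
proof -
  note Radd = corr_add[OF R] and Rsc = corr_scale[OF R] and Rmem = corr_mem[OF R]
  have B_iff: "x \<in> B \<longleftrightarrow> R x 0" for x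
  proof
    assume x: "x \<in> B"
    then obtain f where f: "R x f" using BZ corr_total[OF R] by blast
    then show "R x 0" using Rmem[OF f] x by auto
  next
    assume "R x 0" then show "x \<in> B" using Rmem by blast
  qed
  have sc0: "fun_scale 0 y = 0" for y :: "nat \<Rightarrow> 'k" by (auto simp: fun_scale_def)
  have R00: "R 0 0"
  proof -
    obtain x where "R x 0" using corr_surj[OF R, of 0] by auto
    from Rsc[OF this, of 0] show ?thesis by (simp add: sc0)
  qed
  have Rsum: "R (\<Sum>k\<in>A. fun_scale (c k) (x k)) (\<Sum>k\<in>A. fun_scale (c k) (y k))"
    if "finite A" "\<And>k. k \<in> A \<Longrightarrow> R (x k) (y k)" for A c x and y :: "nat \<Rightarrow> nat \<Rightarrow> 'k"
    using that by (induction A rule: finite_induct) (auto intro: R00 Radd Rsc)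
  have Rdiff: "R (x - x') (f - f')" if "R x f" "R x' f'" for x x' f f'
  proof -
    have "R (x + fun_scale (-1) x') (f + fun_scale (-1) f')" by (intro Radd Rsc that)
    moreover have "x + fun_scale (-1) x' = x - x'" "f + fun_scale (-1) f' = f - f'"
      by (auto simp: fun_scale_def fun_eq_iff)
    ultimately show ?thesis by simp
  qed
  have sub: "funs.subspace B"
    unfolding funs.subspace_def B_iff
  proof (intro conjI ballI allI)
    show "R 0 0" by (rule R00)
    fix x y assume "x \<in> B" "y \<in> B"
    then show "R (x + y) 0" using Radd[of x 0 y 0] by (simp add: B_iff)
  next
    fix c x assume "x \<in> B"
    then show "R (fun_scale c x) 0" using Rsc[of x 0 c] by (simp add: B_iff fun_scale_def zero_fun_def)
  qed
  obtain b where b: "b \<subseteq> B" "funs.independent b" "B \<subseteq> funs.span b" "card b = funs.dim B"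
    using funs.basis_exists by blast
  have "finite b"
  proof -
    have "b \<subseteq> funs.span (unit_fun ` {..<n})"
    proof
      fix x assume "x \<in> b"
      then have "x = (\<Sum>k<n. fun_scale (x k) (unit_fun k))"
        using b(1) BZ Z by (intro sum_unit_fun[symmetric]) blast
      also have "\<dots> \<in> funs.span (unit_fun ` {..<n})"
        by (intro funs.span_sum funs.span_scale funs.span_base) auto
      finally show "x \<in> funs.span (unit_fun ` {..<n})" .
    qed
    then show ?thesis using funs.independent_span_bound[OF _ b(2)] by blast
  qed
  have "\<exists>x. k < M \<longrightarrow> R x (unit_fun k)" for k
    using corr_surj[OF R, of "unit_fun k"] by (auto simp: unit_fun_def)
  then obtain x where x: "\<And>k. k < M \<Longrightarrow> R (x k) (unit_fun k)" by metis
  have main: "funs.independent (b \<union> x ` {..<m}) \<and> card (b \<union> x ` {..<m}) = card b + m" if "m \<le> M" for m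
    using that
  proof (induction m)
    case 0 then show ?case using b by simp
  next
    case (Suc m)
    \<comment> \<open>The elements related to a function that vanishes at \<open>m\<close> form a
      subspace. It contains everything adjoined so far but not \<open>x m\<close>, which gives
      independence.\<close>
    define S where "S = {y. \<exists>f. R y f \<and> f m = 0}"
    have "funs.subspace S" unfolding funs.subspace_def
    proof (intro conjI ballI allI)
      show "0 \<in> S" unfolding S_def using R00 by (intro CollectI exI[of _ 0]) simp
      fix y z c assume "y \<in> S" "z \<in> S"
      then obtain f g where "R y f" "f m = 0" "R z g" "g m = 0" by (auto simp: S_def)
      then show "y + z \<in> S" unfolding S_def by (intro CollectI exI[of _ "f + g"]) (simp add: Radd)
    next
      fix y c assume "y \<in> S"
      then obtain f where "R y f" "f m = 0" by (auto simp: S_def)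
      then show "fun_scale c y \<in> S" unfolding S_def
        by (intro CollectI exI[of _ "fun_scale c f"]) (simp add: Rsc, simp add: fun_scale_def)
    qed
    moreover have "b \<union> x ` {..<m} \<subseteq> S"
    proof -
      have "b \<subseteq> S"
      proof
        fix y assume "y \<in> b"
        then have "R y 0" using b(1) B_iff by blast
        then show "y \<in> S" unfolding S_def by (intro CollectI exI[of _ 0]) simp
      qed
      moreover have "x k \<in> S" if "k < m" for k
        unfolding S_def using that Suc.prems x[of k]
        by (intro CollectI exI[of _ "unit_fun k"]) (simp add: unit_fun_def)
      ultimately show ?thesis by blast
    qed
    ultimately have sp: "funs.span (b \<union> x ` {..<m}) \<subseteq> S" by (intro funs.span_minimal)
    have nS: "x m \<notin> S"
    proof
      assume "x m \<in> S"
      then obtain f where f: "R (x m) f" "f m = 0" by (auto simp: S_def)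
      then have "R (x m - x m) (unit_fun m - f)" using x[of m] Suc.prems by (intro Rdiff) auto
      then have "R 0 (unit_fun m - f)" by simp
      from Rmem[OF this] have "unit_fun m - f = 0" using R00 B_iff by auto
      then have "unit_fun m m - f m = 0" by (metis fun_diff_def zero_fun_def)
      then show False using f by (simp add: unit_fun_def)
    qed
    have ns: "x m \<notin> funs.span (b \<union> x ` {..<m})" by (rule contra_subsetD[OF sp nS])
    then have nm: "x m \<notin> b \<union> x ` {..<m}" by (rule contrapos_nn) (rule funs.span_base)
    have e: "b \<union> x ` {..<Suc m} = insert (x m) (b \<union> x ` {..<m})" by (auto simp: less_Suc_eq)
    show ?case unfolding e using Suc ns nm \<open>finite b\<close> by (simp add: funs.independent_insert)
  qed
  have "funs.dim Z = card b + M"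
  proof (rule funs.dim_unique)
    show "b \<union> x ` {..<M} \<subseteq> Z" using b(1) BZ x Rmem by blast
    show "funs.independent (b \<union> x ` {..<M})" "card (b \<union> x ` {..<M}) = card b + M" using main by auto
    show "Z \<subseteq> funs.span (b \<union> x ` {..<M})"
    proof
      fix z assume "z \<in> Z"
      then obtain f where f: "R z f" using corr_total[OF R] by blast
      then have f0: "\<forall>k\<ge>M. f k = 0" using Rmem by blast
      define y where "y = (\<Sum>k<M. fun_scale (f k) (x k))"
      have "R y f"
        using Rsum[of "{..<M}" x unit_fun f] x by (simp add: y_def sum_unit_fun[OF f0])
      then have "R (z - y) (f - f)" using f by (intro Rdiff)
      then have "z - y \<in> B" by (simp add: B_iff)
      then have "z - y \<in> funs.span (b \<union> x ` {..<M})" using b(3) funs.span_mono[of b "b \<union> x ` {..<M}"] by blast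
      moreover have "y \<in> funs.span (b \<union> x ` {..<M})" unfolding y_def
        by (intro funs.span_sum funs.span_scale funs.span_base) auto
      ultimately have "(z - y) + y \<in> funs.span (b \<union> x ` {..<M})" by (rule funs.span_add)
      then show "z \<in> funs.span (b \<union> x ` {..<M})" by simp
    qed
  qed
  then show ?thesis using b(4) by simp
qed

section \<open>The linear strand\<close>

text \<open>In homological degree \<open>i\<close>, a Koszul basis element accounts for
  \<open>2 * i\<close> of the internal degree, so the coefficient is left with a single
  variable.\<close>

locale linear_strand = resolution_koszul V K r F d
  for V :: "'v set" and K r and F :: "('v, 'k::field) mpoly free_complex" and d :: nat +
  fixes i :: nat
  assumes d: "d = 2 * (i + 1)" and vertex: "\<And>v. v \<in> V \<Longrightarrow> {v} \<in> K" and empty: "{} \<in> K" and i: "i > 0"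
begin

text \<open>The counterpart of \<open>D\<close> for the Koszul complex of the polynomial ring
  itself.\<close>

definition keyd :: "nat \<Rightarrow> ('v set \<Rightarrow> ('v, 'k) mpoly) \<Rightarrow> bool" where
  "keyd q z \<longleftrightarrow> (\<forall>S u. lk (z S) u \<noteq> 0 \<longrightarrow> S \<subseteq> V \<and> card S = q \<and> S \<subseteq> ks u \<and> ks u \<subseteq> V \<and> mon_deg u = d)"

text \<open>Up to sign, the coefficients of \<open>z\<close> at the monomial of \<open>U\<close> form a function on \<open>U\<close>; a square-free \<open>z\<close> is a cycle
  modulo the face ideal iff these functions are constant along the edges, and a cycle iff they are
  constant.\<close>

definition hh :: "('v set \<Rightarrow> ('v, 'k) mpoly) \<Rightarrow> 'v set \<Rightarrow> 'v \<Rightarrow> 'k" where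
  "hh z U v = sg r v (U - {v}) * lk (z (U - {v})) (chi U)"

definition sqfree :: "('v set \<Rightarrow> ('v, 'k) mpoly) \<Rightarrow> bool" where
  "sqfree z \<longleftrightarrow> (\<forall>S u. lk (z S) u \<noteq> 0 \<longrightarrow> (\<exists>U. U \<subseteq> V \<and> card U = Suc i \<and> u = chi U))"

lemma keydD:
  assumes "keyd q z" "lk (z S) u \<noteq> 0"
  shows "S \<subseteq> V" "card S = q" "S \<subseteq> ks u" "ks u \<subseteq> V" "mon_deg u = d"
  using assms unfolding keyd_def by blast+

lemma keyd_ep: assumes x: "x \<in> D 0 q" shows "keyd q (ep x)"
  unfolding keyd_def
proof (intro allI impI)
  fix S u assume u: "lk (ep x S) u \<noteq> 0"
  then obtain a where a: "a < fr_rank F 0" "lk (fr_aug F a * x a S) u \<noteq> 0"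
    unfolding ep_eq by (rule lookup_sum_nonzeroE) auto
  from a(2) obtain m w where m: "u = m + w" "lk (fr_aug F a) m \<noteq> 0" "lk (x a S) w \<noteq> 0"
    by (rule in_keys_multE)
  show "S \<subseteq> V \<and> card S = q \<and> S \<subseteq> ks u \<and> ks u \<subseteq> V \<and> mon_deg u = d"
    using DD[OF x m(3)] aug_keys[OF a(1) m(2)] by (auto simp: m(1) keys_add_nat mon_deg_add)
qed

lemma key_deg:
  assumes "S \<subseteq> V" "S \<subseteq> ks u" "mon_deg u = 2 * (card S + 1)"
  shows "\<exists>v\<in>ks u. u = chi S + chi {v}"
proof -
  obtain w where w: "u = chi S + w" using chi_le[OF finV[OF assms(1)] assms(2)] by blast
  then have "mon_deg w = 2" using assms(3) finV[OF assms(1)] by (simp add: mon_deg_add mon_deg_chi)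
  then obtain v where "w = chi {v}" using mon_deg_eq_2D by blast
  then show ?thesis using w by (intro bexI[of _ v]) (simp_all add: keys_add_nat)
qed

text \<open>After division by the monomial of \<open>S\<close>, a degree of at most 2 is left, hence
  the monomial 1 or a single variable; their supports are faces. So the face ideal does not affect
  chains of this degree.\<close>

lemma XI_linear:
  assumes z: "keyd q z" and q: "i \<le> q" and S: "z S \<in> XI S" shows "z S = 0"
proof (rule poly_mapping_eqI, rule ccontr)
  fix u assume "lk (z S) u \<noteq> lk 0 u"
  then have u: "lk (z S) u \<noteq> 0" by simp
  note h = keydD[OF z u]
  obtain w where w: "u = chi S + w" using chi_le[OF finV[OF h(1)] h(3)] by blast
  then have "mon_deg w + 2 * q = 2 * (i + 1)"
    using h finV[OF h(1)] d by (simp add: mon_deg_add mon_deg_chi)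
  then have "mon_deg w \<le> 2" using q by simp
  then consider "mon_deg w = 0" | "mon_deg w = 2" | "mon_deg w = 1" by linarith
  then have "ks w \<in> K"
  proof cases
    case 1 then show ?thesis using empty by (simp add: mon_deg_eq_0_iff)
  next
    case 2
    then obtain v where v: "w = chi {v}" using mon_deg_eq_2D by blast
    then have "v \<in> V" using w h(4) by (simp add: keys_add_nat)
    then show ?thesis using v vertex by simp
  next
    \<comment> \<open>Variables have degree 2, so this case is contradictory.\<close>
    case 3 then show ?thesis by (simp add: mon_deg_def)
  qed
  moreover have "ks (u - chi S) \<notin> K" using S u unfolding XI_def by blast
  ultimately show False using w by simp
qed

lemma ep_surj_linear:
  assumes z: "keyd q z" and q: "i \<le> q" shows "\<exists>x\<in>D 0 q. ep x = z"
proof -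
  obtain x where x: "x \<in> D 0 q" "\<And>S. z S - ep x S \<in> XI S"
    using surj_ep[of z q] z unfolding keyd_def by blast
  have e: "keyd q (ep x)" by (rule keyd_ep[OF x(1)])
  have "keyd q (\<lambda>S. z S - ep x S)"
    unfolding keyd_def
  proof (intro allI impI)
    fix S u assume "lk (z S - ep x S) u \<noteq> 0"
    then have "lk (z S) u \<noteq> 0 \<or> lk (ep x S) u \<noteq> 0" by (auto simp: lookup_minus)
    then show "S \<subseteq> V \<and> card S = q \<and> S \<subseteq> ks u \<and> ks u \<subseteq> V \<and> mon_deg u = d"
      using z e unfolding keyd_def by blast
  qed
  then have "z S - ep x S = 0" for S
    using XI_linear[of q "\<lambda>S. z S - ep x S" S] q x(2) by blast
  then show ?thesis using x(1) by (intro bexI[of _ x] ext) auto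
qed

text \<open>If a variable \<open>v\<close> is repeated, \<open>u\<close> has support
  \<open>S\<close>. Then \<open>z S\<close> alone contributes to the boundary at
  \<open>T = S - {v}\<close>, and after removal of the monomial of \<open>T\<close> the square of
  \<open>v\<close> is left, whose support is a face. This contradicts the cycle condition modulo the
  ideal.\<close>

lemma sqfree:
  assumes z: "keyd i z" and XI: "\<And>T. bd r V z T \<in> XI T" shows "sqfree z"
  unfolding sqfree_def
proof (intro allI impI)
  fix S u assume u: "lk (z S) u \<noteq> 0"
  note h = keydD[OF z u]
  have fS: "finite S" by (rule finV[OF h(1)])
  obtain v where v: "v \<in> ks u" "u = chi S + chi {v}"
    using key_deg[of S u] h d by auto
  show "\<exists>U. U \<subseteq> V \<and> card U = Suc i \<and> u = chi U"
  proof (cases "v \<in> S")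
    case False
    then have "u = chi (insert v S)" using v fS by (simp add: chi_insert[OF fS])
    then show ?thesis using False fS h v by (intro exI[of _ "insert v S"]) auto
  next
    case True
    define T where "T = S - {v}"
    have T: "insert v T = S" "v \<notin> T" "finite T" "T \<subseteq> V" using True fS h by (auto simp: T_def)
    have ks: "ks u = S" using v fS True by (auto simp: keys_add_nat)
    have "lk (bd r V z T) u = (\<Sum>e\<in>V - T. sg r e T * lk (z (insert e T)) u)"
      using T by (simp add: bd_def lookup_sum lookup_sg)
    also have "\<dots> = (\<Sum>e\<in>V - T. if e = v then sg r v T * lk (z S) u else 0)"
    proof (intro sum.cong refl)
      fix e assume e: "e \<in> V - T"
      have "lk (z (insert e T)) u = 0" if "e \<noteq> v"
      proof (rule ccontr)
        assume "lk (z (insert e T)) u \<noteq> 0"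
        then have "e \<in> ks u" using keydD(3)[OF z] by blast
        then show False using that e T ks by blast
      qed
      then show "sg r e T * lk (z (insert e T)) u = (if e = v then sg r v T * lk (z S) u else 0)"
        using T by auto
    qed
    also have "\<dots> = sg r v T * lk (z S) u" using T h True V by auto
    finally have "lk (bd r V z T) u \<noteq> 0" using u by simp
    then have "ks (u - chi T) \<notin> K" using XI unfolding XI_def by blast
    moreover have "u - chi T = chi {v} + chi {v}"
    proof -
      have "u = chi T + (chi {v} + chi {v})"
        using v(2) T chi_insert[of T v] by (simp add: add.assoc)
      then show ?thesis by (simp only: add_diff_cancel_left')
    qed
    moreover have "{v} \<in> K" using vertex True h by blast
    ultimately show ?thesis by (simp add: keys_add_nat)
  qed
qed

text \<open>The boundary at \<open>U - {v, w}\<close> has only two summands at the monomial of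
  \<open>U\<close>. The sign in \<open>hh\<close> is chosen so that they combine to a
  difference.\<close>

lemma bd_pair:
  assumes z: "keyd i z" and U: "U \<subseteq> V" "v \<in> U" "w \<in> U" "v \<noteq> w"
  shows "\<exists>c. c \<noteq> 0 \<and> lk (bd r V z (U - {v, w})) (chi U) = c * (hh z U w - hh z U v)"
proof -
  define T where "T = U - {v, w}"
  have fU: "finite U" by (rule finV[OF U(1)])
  have T: "T \<subseteq> V" "v \<notin> T" "w \<notin> T" "finite T" "insert v T = U - {w}" "insert w T = U - {v}"
    using U fU by (auto simp: T_def)
  have rr: "r v \<noteq> r w" using U r by (auto simp: inj_on_def)
  have "lk (bd r V z T) (chi U) = (\<Sum>e\<in>V - T. sg r e T * lk (z (insert e T)) (chi U))"
    using T by (simp add: bd_def lookup_sum lookup_sg)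
  also have "\<dots> = (\<Sum>e\<in>{v, w}. sg r e T * lk (z (insert e T)) (chi U))"
  proof (rule sum.mono_neutral_right)
    show "\<forall>e\<in>V - T - {v, w}. sg r e T * lk (z (insert e T)) (chi U) = 0"
    proof
      fix e assume e: "e \<in> V - T - {v, w}"
      have "lk (z (insert e T)) (chi U) = 0"
      proof (rule ccontr)
        assume "lk (z (insert e T)) (chi U) \<noteq> 0"
        then have "e \<in> ks (chi U)" using keydD(3)[OF z] by blast
        then show False using e fU by (auto simp: T_def)
      qed
      then show "sg r e T * lk (z (insert e T)) (chi U) = 0" by simp
    qed
  qed (use V U T in auto)
  also have "\<dots> = sg r v T * lk (z (U - {w})) (chi U) + sg r w T * lk (z (U - {v})) (chi U)"
    using U T by simp
  also have "\<dots> = sg r v T * (sg r w (U - {w}) * hh z U w) + sg r w T * (sg r v (U - {v}) * hh z U v)"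
    by (simp add: hh_def)
  also have "\<dots> = (sg r v T * sg r w (insert v T)) * hh z U w + (sg r w T * sg r v (insert w T)) * hh z U v"
    using T by (simp add: mult.assoc)
  also have "\<dots> = (sg r v T * sg r w (insert v T)) * (hh z U w - hh z U v)"
    using sg_swap[of T v w r, where 'c = 'k] T rr by (simp add: algebra_simps)
  finally show ?thesis unfolding T_def[symmetric]
    by (intro exI[of _ "sg r v T * sg r w (insert v T)"]) simp
qed

text \<open>The monomial of \<open>U\<close> divided by that of \<open>U - {v, w}\<close> has
  support \<open>{v, w}\<close>. If this is a face, the cycle condition modulo the ideal forces the
  difference in \<open>bd_pair\<close> to vanish.\<close>

lemma hh_const:
  assumes z: "keyd i z" and XI: "\<And>T. bd r V z T \<in> XI T"
    and U: "U \<subseteq> V" "v \<in> U" "w \<in> U" "{v, w} \<in> K"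
  shows "hh z U v = hh z U w"
proof (rule ccontr)
  assume ne: "hh z U v \<noteq> hh z U w"
  then have vw: "v \<noteq> w" by auto
  define T where "T = U - {v, w}"
  have fU: "finite U" by (rule finV[OF U(1)])
  have "lk (bd r V z T) (chi U) \<noteq> 0" using bd_pair[OF z U(1-3) vw] ne by (auto simp: T_def)
  then have "ks (chi U - chi T) \<notin> K" using XI unfolding XI_def by blast
  moreover have "chi U = chi T + chi {v, w}"
  proof -
    have "U = T \<union> {v, w}" using U by (auto simp: T_def)
    then show ?thesis using chi_union[of T "{v, w}"] fU by (simp add: T_def)
  qed
  ultimately show False using U by simp
qed

lemma bd_zero:
  assumes z: "keyd i z" and sq: "sqfree z"
    and c: "\<And>U v w. U \<subseteq> V \<Longrightarrow> card U = Suc i \<Longrightarrow> v \<in> U \<Longrightarrow> w \<in> U \<Longrightarrow> hh z U v = hh z U w"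
  shows "bd r V z T = 0"
proof (rule poly_mapping_eqI, rule ccontr)
  fix u assume "lk (bd r V z T) u \<noteq> lk 0 u"
  then have u: "lk (bd r V z T) u \<noteq> 0" by simp
  then have T: "T \<subseteq> V" by (auto simp: bd_def split: if_splits)
  with u have "lk (\<Sum>e\<in>V - T. sg r e T * z (insert e T)) u \<noteq> 0" by (simp add: bd_def)
  then obtain e where e: "e \<in> V - T" "lk (sg r e T * z (insert e T)) u \<noteq> 0"
    by (rule lookup_sum_nonzeroE)
  then have nz: "lk (z (insert e T)) u \<noteq> 0" by (simp add: lookup_sg)
  note h = keydD[OF z nz]
  obtain U where U: "U \<subseteq> V" "card U = Suc i" "u = chi U" using sq nz unfolding sqfree_def by blast
  have fU: "finite U" by (rule finV[OF U(1)])
  have sub: "insert e T \<subseteq> U" using h(3) U(3) fU by simp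
  have "card (U - insert e T) = 1"
    using h(2) U(2) card_Diff_subset[OF finite_subset[OF sub fU] sub] by simp
  then obtain w where w: "U - insert e T = {w}" by (auto simp: card_1_singleton_iff)
  have T_eq: "T = U - {e, w}" "e \<in> U" "w \<in> U" "e \<noteq> w" using w sub e(1) by auto
  have "lk (bd r V z T) u = 0"
    using bd_pair[OF z U(1) T_eq(2-4)] c[OF U(1,2) T_eq(2,3)] unfolding T_eq(1)[symmetric] U(3) by auto
  then show False using u by simp
qed

text \<open>Chains of this degree are not affected by the face ideal, and the Koszul complex of k[V]
  is exact; what is divided out is therefore exactly the chains that are cycles already over
  k[V].\<close>

lemma BB_iff:
  assumes x: "x \<in> D 0 i"
  shows "x \<in> BB 0 i \<longleftrightarrow> (\<forall>T. bd r V (ep x) T = 0)"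
proof
  assume "x \<in> BB 0 i"
  then obtain x1 x2 where x12: "x1 \<in> D 0 i" "x2 \<in> D 0 i" "kd 0 x1" "kk i x2" "x = x1 + x2"
    by (auto simp: BB_def)
  have "ep x1 S = 0" for S using x12(3) XI_linear[OF keyd_ep[OF x12(1)], of S] by simp
  then have "ep x = ep x2" by (auto simp: x12(5) ep_add)
  moreover have "dk x2 = 0" using x12(4) i by (cases i) auto
  then have "ep (dk x2) T = 0" for T by (simp add: ep_eq)
  ultimately show "\<forall>T. bd r V (ep x) T = 0" by (simp add: ep_dk)
next
  assume c: "\<forall>T. bd r V (ep x) T = 0"
  note e = keyd_ep[OF x]
  have "\<exists>y. (\<forall>S u. lk (y S) u \<noteq> 0 \<longrightarrow> S \<subseteq> V \<and> card S = Suc i \<and> S \<subseteq> ks u \<and> (\<exists>S'. lk (ep x S') u \<noteq> (0 :: 'k)))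
    \<and> bd r V y = ep x"
  proof (rule koszul_exact)
    fix S u assume "lk (ep x S) u \<noteq> 0"
    from keydD[OF e this] show "S \<subseteq> V \<and> card S = i \<and> S \<subseteq> ks u \<and> ks u \<subseteq> V \<and> u \<noteq> 0" using d by auto
  qed (use c in blast)
  then obtain y where y: "\<And>S u. lk (y S) u \<noteq> 0 \<Longrightarrow> S \<subseteq> V \<and> card S = Suc i \<and> S \<subseteq> ks u \<and> (\<exists>S'. lk (ep x S') u \<noteq> 0)"
    "bd r V y = ep x" by blast
  have "keyd (Suc i) y" unfolding keyd_def
  proof (intro allI impI)
    fix S u assume "lk (y S) u \<noteq> 0"
    note h = y(1)[OF this]
    then obtain S' where "lk (ep x S') u \<noteq> 0" by blast
    from keydD[OF e this] h show "S \<subseteq> V \<and> card S = Suc i \<and> S \<subseteq> ks u \<and> ks u \<subseteq> V \<and> mon_deg u = d"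
      by blast
  qed
  then obtain w where w: "w \<in> D 0 (Suc i)" "ep w = y" using ep_surj_linear[of "Suc i" y] by auto
  have "ep (x - dk w) S = 0" for S by (simp add: ep_diff ep_dk w(2) y(2))
  then have "kd 0 (x - dk w)" by (simp add: XI_0)
  moreover have "dk w \<in> D 0 i" by (rule dk_closed[OF w(1)])
  moreover have "x = (x - dk w) + dk w" by simp
  ultimately show "x \<in> BB 0 i" unfolding BB_def using D_diff[OF x] kk_dk[OF w(1)] by blast
qed

text \<open>By \<open>disc\<close>, a nonconstant function that respects the edges lives on some
  \<open>W k\<close> and is constant off \<open>pt k\<close>. As \<open>pt k\<close> is joined to no
  other point of \<open>W k\<close>, its value is free; modulo constants each \<open>W k\<close>
  contributes one dimension.\<close>

theorem tens_homology_dim_linear: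
  fixes W :: "nat \<Rightarrow> 'v set" and pt :: "nat \<Rightarrow> 'v" and M :: nat
  assumes W: "\<And>k. k < M \<Longrightarrow> W k \<subseteq> V \<and> card (W k) = Suc i \<and> pt k \<in> W k \<and> (\<forall>y\<in>W k - {pt k}. {pt k, y} \<notin> K)"
    and inj: "inj_on W {..<M}"
    and disc: "\<And>U (h :: 'v \<Rightarrow> 'k). U \<subseteq> V \<Longrightarrow> card U = Suc i \<Longrightarrow>
       (\<And>x y. x \<in> U \<Longrightarrow> y \<in> U \<Longrightarrow> {x, y} \<in> K \<Longrightarrow> h x = h y) \<Longrightarrow>
       (\<exists>c. \<forall>x\<in>U. h x = c) \<or> (\<exists>k<M. U = W k \<and> (\<exists>c. \<forall>x\<in>U - {pt k}. h x = c))"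
  shows "tens_homology_dim F i d = M"
proof -
  define ot where "ot k = (SOME y. y \<in> W k - {pt k})" for k
  have ot: "ot k \<in> W k - {pt k}" if "k < M" for k
  proof -
    have f: "finite (W k)" using W[OF that] finV by blast
    then have "card (W k - {pt k}) > 0" using W[OF that] i by simp
    then have "\<exists>y. y \<in> W k - {pt k}" by (auto simp: card_gt_0_iff)
    then show ?thesis unfolding ot_def by (rule someI_ex)
  qed
  \<comment> \<open>The jump at \<open>pt k\<close>, measured against an arbitrary other point, is
    the coordinate that \<open>W k\<close> contributes.\<close>
  define ff where "ff z = (\<lambda>k. if k < M then hh z (W k) (pt k) - hh z (W k) (ot k) else 0)" for z
  have XIz: "bd r V (ep x) T \<in> XI T" if "x \<in> ZZ 0 i" for x T
  proof -
    have "kd 0 (dk x)" using that i by (cases i) (auto simp: ZZ_def)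
    then show ?thesis by (simp add: ep_dk)
  qed
  have c2: "corr scal fun_scale (ZZ 0 i) (BB 0 i) {f. \<forall>k\<ge>M. f k = 0} {0} (\<lambda>x f. x \<in> ZZ 0 i \<and> f = ff (ep x))"
    unfolding corr_def
  proof (intro conjI allI impI ballI)
    fix f :: "nat \<Rightarrow> 'k" assume f: "f \<in> {f. \<forall>k\<ge>M. f k = 0}"
    \<comment> \<open>The cycle that corresponds on each \<open>W k\<close> to the function with
      value \<open>f k\<close> at \<open>pt k\<close> and 0 elsewhere.\<close>
    define z where "z S = (\<Sum>k<M. if S = W k - {pt k} then
        sing (chi (W k)) (sg r (pt k) (W k - {pt k}) * f k) else 0)" for S
    have lz: "lk (z S) u = (\<Sum>k<M. if S = W k - {pt k} \<and> u = chi (W k) then sg r (pt k) (W k - {pt k}) * f k else 0)" for S u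
      unfolding z_def lookup_sum by (rule sum.cong) (auto simp: lookup_single when_def)
    have kz: "\<exists>k<M. S = W k - {pt k} \<and> u = chi (W k)" if nz: "lk (z S) u \<noteq> 0" for S u
    proof (rule ccontr)
      assume "\<not> ?thesis"
      then have "(\<Sum>k<M. if S = W k - {pt k} \<and> u = chi (W k) then sg r (pt k) (W k - {pt k}) * f k else 0) = 0"
        by (intro sum.neutral) auto
      then show False using nz unfolding lz by blast
    qed
    have fW: "finite (W k)" if "k < M" for k using W[OF that] finV by blast
    have "keyd i z" unfolding keyd_def
    proof (intro allI impI)
      fix S u assume "lk (z S) u \<noteq> 0"
      then obtain k where k: "k < M" "S = W k - {pt k}" "u = chi (W k)" using kz by blast
      then show "S \<subseteq> V \<and> card S = i \<and> S \<subseteq> ks u \<and> ks u \<subseteq> V \<and> mon_deg u = d"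
        using W[OF k(1)] fW[OF k(1)] by (auto simp: mon_deg_chi d)
    qed
    then obtain x where x: "x \<in> D 0 i" "ep x = z" using ep_surj_linear[of i z] by auto
    have "bd r V z T \<in> XI T" for T
      unfolding XI_def
    proof (intro CollectI allI impI)
      fix u assume u: "lk (bd r V z T) u \<noteq> 0"
      then have T: "T \<subseteq> V" by (auto simp: bd_def split: if_splits)
      with u have "lk (\<Sum>e\<in>V - T. sg r e T * z (insert e T)) u \<noteq> 0" by (simp add: bd_def)
      then obtain e where e: "e \<in> V - T" "lk (sg r e T * z (insert e T)) u \<noteq> 0"
        by (rule lookup_sum_nonzeroE)
      then have "lk (z (insert e T)) u \<noteq> 0" by (simp add: lookup_sg)
      then obtain k where k: "k < M" "insert e T = W k - {pt k}" "u = chi (W k)" using kz by blast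
      \<comment> \<open>Each boundary term leaves the monomial of a pair \<open>{pt k, e}\<close>,
        which is not an edge, so the term lies in the ideal.\<close>
      have "W k = T \<union> {pt k, e}" "T \<inter> {pt k, e} = {}" using k e W[OF k(1)] by auto
      then have "chi (W k) = chi T + chi {pt k, e}" using chi_union[of T "{pt k, e}"] finV[OF T] by simp
      then have "ks (u - chi T) = {pt k, e}" using k(3) by simp
      moreover have "e \<in> W k - {pt k}" using k(2) by blast
      ultimately show "ks (u - chi T) \<notin> K" using W[OF k(1)] by simp
    qed
    then have "x \<in> ZZ 0 i" using x by (simp add: ZZ_def ep_dk)
    moreover have "ff z = f"
    proof
      fix k
      show "ff z k = f k"
      proof (cases "k < M")
        case True
        have hp: "hh z (W k) v = (if v = pt k then f k else 0)" if v: "v \<in> W k" for v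
        proof -
          have "lk (z (W k - {v})) (chi (W k)) = (\<Sum>k'<M. if k' = k then (if v = pt k then sg r v (W k - {v}) * f k else 0) else 0)"
            unfolding lz
          proof (intro sum.cong refl)
            fix k' assume k': "k' \<in> {..<M}"
            have "chi (W k) = chi (W k') \<longleftrightarrow> k' = k"
              using chi_inject[OF fW fW, of k k'] True k' inj by (auto simp: inj_on_def)
            moreover have "W k - {v} = W k - {pt k} \<longleftrightarrow> v = pt k" using v W[OF True] by blast
            ultimately show "(if W k - {v} = W k' - {pt k'} \<and> chi (W k) = chi (W k') then sg r (pt k') (W k' - {pt k'}) * f k' else 0) =
              (if k' = k then (if v = pt k then sg r v (W k - {v}) * f k else 0) else 0)" by auto
          qed
          also have "\<dots> = (if v = pt k then sg r v (W k - {v}) * f k else 0)" using True by simp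
          finally show ?thesis by (simp add: hh_def)
        qed
        show ?thesis using True W[OF True] ot[OF True] by (simp add: ff_def hp)
      qed (use f in \<open>simp add: ff_def\<close>)
    qed
    ultimately show "\<exists>x. x \<in> ZZ 0 i \<and> f = ff (ep x)" using x by (intro exI[of _ x]) simp
  next
    fix x f assume a: "x \<in> ZZ 0 i \<and> f = ff (ep x)"
    then have x: "x \<in> ZZ 0 i" "x \<in> D 0 i" and f: "f = ff (ep x)" by (auto simp: ZZ_def)
    note e = keyd_ep[OF x(2)]
    show "x \<in> ZZ 0 i" by fact
    show "f \<in> {f. \<forall>k\<ge>M. f k = 0}" by (simp add: f ff_def)
    have "(\<forall>T. bd r V (ep x) T = 0) \<longleftrightarrow> f = 0"
    proof
      assume c: "\<forall>T. bd r V (ep x) T = 0"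
      show "f = 0"
      proof
        fix k show "f k = 0 k"
        proof (cases "k < M")
          case True
          have "pt k \<in> W k" "ot k \<in> W k" "pt k \<noteq> ot k" "W k \<subseteq> V" using W[OF True] ot[OF True] by auto
          from bd_pair[OF e this(4,1-3)] show ?thesis using c True by (auto simp: f ff_def)
        qed (simp add: f ff_def)
      qed
    next
      assume f0: "f = 0"
      have "hh (ep x) U v = hh (ep x) U w" if U: "U \<subseteq> V" "card U = Suc i" "v \<in> U" "w \<in> U" for U v w
      proof -
        have "(\<exists>c. \<forall>y\<in>U. hh (ep x) U y = c) \<or> (\<exists>k<M. U = W k \<and> (\<exists>c. \<forall>y\<in>U - {pt k}. hh (ep x) U y = c))"
          by (rule disc[OF U(1,2)]) (rule hh_const[OF e XIz[OF x(1)] U(1)])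
        then show ?thesis
        proof
          assume "\<exists>k<M. U = W k \<and> (\<exists>c. \<forall>y\<in>U - {pt k}. hh (ep x) U y = c)"
          then obtain k c where k: "k < M" "U = W k" "\<forall>y\<in>U - {pt k}. hh (ep x) U y = c" by blast
          have "hh (ep x) U (pt k) = hh (ep x) U (ot k)"
            using fun_cong[OF f0, of k] k(1,2) by (simp add: f ff_def)
          moreover have "hh (ep x) U (ot k) = c" using k ot[OF k(1)] by blast
          ultimately have "hh (ep x) U y = c" if "y \<in> U" for y using k(3) that by (cases "y = pt k") auto
          then show ?thesis using U by simp
        qed (use U in metis)
      qed
      then show "\<forall>T. bd r V (ep x) T = 0" using bd_zero[OF e sqfree[OF e XIz[OF x(1)]]] by blast
    qed
    then show "x \<in> BB 0 i \<longleftrightarrow> f \<in> {0}" using BB_iff[OF x(2)] by simp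
  next
    fix x f x' f' assume a: "x \<in> ZZ 0 i \<and> f = ff (ep x)" "x' \<in> ZZ 0 i \<and> f' = ff (ep x')"
    have "ep (dk (x + x')) S = ep (dk x) S + ep (dk x') S" for S by (simp add: dk_add ep_add)
    then show "x + x' \<in> ZZ 0 i" using a by (auto simp: ZZ_def D_add XI_add)
    have "hh (ep (x + x')) U v = hh (ep x) U v + hh (ep x') U v" for U v
      by (simp add: hh_def ep_add lookup_add distrib_left)
    then show "f + f' = ff (ep (x + x'))" using a by (auto simp: ff_def fun_eq_iff)
  next
    fix c x f assume a: "x \<in> ZZ 0 i \<and> f = ff (ep x)"
    have XIs: "p \<in> XI S \<Longrightarrow> sing 0 c * p \<in> XI S" for p S by (auto simp: XI_def lookup_mult_sing0)
    have "ep (dk (scal c x)) S = sing 0 c * ep (dk x) S" for S by (simp add: dk_scal ep_scal)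
    then show "scal c x \<in> ZZ 0 i" using a by (auto simp: ZZ_def D_scal XIs)
    have "hh (ep (scal c x)) U v = c * hh (ep x) U v" for U v
      by (simp add: hh_def ep_scal lookup_mult_sing0)
    then show "fun_scale c f = ff (ep (scal c x))"
      using a by (auto simp: ff_def fun_scale_def fun_eq_iff right_diff_distrib)
  qed auto
  \<comment> \<open>Constant terms, zigzag and jumps are composed into one relation from the cycles
    of \<open>F \<otimes> k\<close> to the \<open>M\<close>-dimensional space.\<close>
  obtain j where j: "i = Suc j" using i by (cases i) auto
  obtain R where "corr scal scal (ZZ i 0) (BB i 0) (ZZ 0 i) (BB 0 i) R"
    using corr_zigzag[of j 0] j by auto
  from corr_trans[OF this c2] obtain R' where "corr scal fun_scale (ZZ i 0) (BB i 0) {f :: nat \<Rightarrow> 'k. \<forall>k\<ge>M. f k = 0} {0} R'"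
    by blast
  from corr_trans[OF corr_tens[of j, folded j] this]
  obtain R'' where R'': "corr fun_scale fun_scale (tens_cycles F i d) (tens_boundaries F i d)
      {f :: nat \<Rightarrow> 'k. \<forall>k\<ge>M. f k = 0} {0} R''" by blast
  have "funs.dim (tens_cycles F i d) = funs.dim (tens_boundaries F i d) + M"
  proof (rule corr_dim[OF R''])
    show "tens_boundaries F i d \<subseteq> tens_cycles F i d"
    proof
      fix t assume "t \<in> tens_boundaries F i d"
      then obtain t' where t': "t' \<in> tens_space F (Suc i) d" "t = tens_map F i t'"
        by (auto simp: tens_boundaries_def)
      have w: "const t' \<in> D (Suc i) 0" by (rule const_D[OF t'(1)])
      have y: "df i (const t') \<in> D i 0" by (rule df_closed[OF w])
      have te: "t = (\<lambda>a. lk (df i (const t') a {}) 0)" by (simp add: t'(2) lookup_df_0)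
      have "df j (df i (const t')) = 0" using kd_df[OF w] j by simp
      then have "tens_map F j t = 0"
        using lookup_df_0[of j "df i (const t')" _ "{}"] by (auto simp: te fun_eq_iff)
      then show "t \<in> tens_cycles F i d"
        using D_const[OF y] by (simp add: tens_cycles_def te j)
    qed
    fix t a assume "t \<in> tens_cycles F i d" "fr_rank F i \<le> a"
    then show "t a = 0" by (auto simp: tens_cycles_def tens_space_def)
  qed
  then show ?thesis by (simp add: tens_homology_dim_def)
qed

end

theorem tor_dim_linear_strand:
  fixes V :: "'v set" and W :: "nat \<Rightarrow> 'v set" and pt :: "nat \<Rightarrow> 'v" and M i :: nat
  assumes V: "finite V" and K: "\<And>S T. S \<in> K \<Longrightarrow> T \<subseteq> S \<Longrightarrow> T \<in> K"
    and vertex: "\<And>v. v \<in> V \<Longrightarrow> {v} \<in> K" and empty: "{} \<in> K" and i: "i > 0"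
    and W: "\<And>k. k < M \<Longrightarrow> W k \<subseteq> V \<and> card (W k) = Suc i \<and> pt k \<in> W k \<and> (\<forall>y\<in>W k - {pt k}. {pt k, y} \<notin> K)"
    and inj: "inj_on W {..<M}"
    and disc: "\<And>U (h :: 'v \<Rightarrow> 'k::field). U \<subseteq> V \<Longrightarrow> card U = Suc i \<Longrightarrow>
       (\<And>x y. x \<in> U \<Longrightarrow> y \<in> U \<Longrightarrow> {x, y} \<in> K \<Longrightarrow> h x = h y) \<Longrightarrow>
       (\<exists>c. \<forall>x\<in>U. h x = c) \<or> (\<exists>k<M. U = W k \<and> (\<exists>c. \<forall>x\<in>U - {pt k}. h x = c))"
  shows "tor_dim V (face_ideal V K :: ('v, 'k) mpoly set) i (2 * (i + 1)) = M"
proof -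
  define F where "F = (SOME F :: ('v, 'k) mpoly free_complex. graded_free_resolution V (face_ideal V K) F)"
  have F: "graded_free_resolution V (face_ideal V K) F"
    unfolding F_def by (rule someI_ex) (rule face_ideal_resolution_exists[OF V K])
  obtain r :: "'v \<Rightarrow> nat" where r: "inj_on r V" using finite_imp_inj_to_nat_seg[OF V] by metis
  interpret linear_strand V K r F "2 * (i + 1)" i
    by unfold_locales (use V K r F vertex empty i in auto)
  show ?thesis unfolding tor_dim_def F_def[symmetric]
    by (rule tens_homology_dim_linear[OF W inj disc])
qed

section \<open>Crossing diagonals\<close>

text \<open>Alternation of the endpoints around the polygon. The strict inequalities make diagonals
  with a common endpoint noncrossing; in particular, a diagonal does not cross itself.\<close>

definition crossing :: "nat \<times> nat \<Rightarrow> nat \<times> nat \<Rightarrow> bool" where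
  "crossing D E \<longleftrightarrow> fst D < fst E \<and> fst E < snd D \<and> snd D < snd E \<or>
                    fst E < fst D \<and> fst D < snd E \<and> snd E < snd D"

lemma crossing_sym: "crossing D E \<longleftrightarrow> crossing E D"
  by (auto simp: crossing_def)

definition crossers :: "nat \<Rightarrow> nat \<times> nat \<Rightarrow> (nat \<times> nat) set" where
  "crossers N p = {e \<in> polygon_diagonals N. crossing p e}"

definition max_crossers :: "nat \<Rightarrow> nat" where
  "max_crossers n = (if even n then n * (n + 2) div 4 else (n + 1) ^ 2 div 4)"

definition central_diagonals :: "nat \<Rightarrow> (nat \<times> nat) set" where
  "central_diagonals n = {p \<in> polygon_diagonals (n + 3). card (crossers (n + 3) p) = max_crossers n}"

definition star :: "nat \<Rightarrow> nat \<times> nat \<Rightarrow> (nat \<times> nat) set" where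
  "star N p = insert p (crossers N p)"

lemma finite_polygon_diagonals: "finite (polygon_diagonals N)"
  by (rule finite_subset[of _ "{..<N} \<times> {..<N}"]) (auto simp: polygon_diagonals_def)

section \<open>The largest number of crossings and the diagonals attaining it\<close>

lemma max_crossers_even: "n = 2 * m \<Longrightarrow> max_crossers n = m * (m + 1)"
proof -
  assume n: "n = 2 * m"
  have "n * (n + 2) = 4 * (m * (m + 1))" using n by (simp add: algebra_simps)
  then show ?thesis using n by (simp add: max_crossers_def)
qed

lemma max_crossers_odd: "n + 1 = 2 * m \<Longrightarrow> max_crossers n = m * m"
proof -
  assume n: "n + 1 = 2 * m"
  then have "odd n" by presburger
  moreover have "(n + 1) ^ 2 = 4 * (m * m)" unfolding n by (simp add: power2_eq_square)
  ultimately show ?thesis by (simp add: max_crossers_def)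
qed

text \<open>Expresses the integer part of \<open>(n + 1)^2 / 4\<close> without division or parity,
  in a form suited to linear arithmetic; the slack 1 occurs for even \<open>n\<close>.\<close>

lemma max_crossers_bounds: "4 * max_crossers n \<le> (n + 1)^2 \<and> (n + 1)^2 \<le> 4 * max_crossers n + 1"
proof (cases "even n")
  case True
  then obtain m where "n = 2 * m" by (elim evenE)
  then show ?thesis
    using max_crossers_even[of n m] by (simp add: power2_eq_square algebra_simps)
next
  case False
  then have "even (n + 1)" by simp
  then obtain m where m: "n + 1 = 2 * m" by (elim evenE)
  then show ?thesis
    using max_crossers_odd[OF m] unfolding m by (simp add: power2_eq_square)
qed

text \<open>With \<open>s = t + d\<close>, the maximum exceeds \<open>s * t\<close> by
  \<open>e * e\<close> if \<open>d = 2 * e\<close>, and by \<open>e * (e + 1)\<close> if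
  \<open>d = 2 * e + 1\<close>. Hence equality means \<open>e = 0\<close>.\<close>

lemma max_crossers_eq_iff_le:
  assumes "s + t = n + 1" "t \<le> s"
  shows "s * t = max_crossers n \<longleftrightarrow> s \<le> t + 1"
proof -
  obtain d where d: "s = t + d" using assms(2) le_Suc_ex by blast
  show ?thesis
  proof (cases "even d")
    case True
    then obtain e where e: "d = 2 * e" by (elim evenE)
    then have "max_crossers n = (t + e) * (t + e)"
      using assms d by (intro max_crossers_odd) simp
    then show ?thesis using d e by (auto simp: algebra_simps)
  next
    case False
    then obtain e where e: "d = 2 * e + 1" by (elim oddE)
    then have "max_crossers n = (t + e) * (t + e + 1)"
      using assms d by (intro max_crossers_even) simp
    then show ?thesis using d e by (auto simp: algebra_simps)
  qed
qed

lemma max_crossers_eq_iff: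
  assumes "s + t = n + 1"
  shows "s * t = max_crossers n \<longleftrightarrow> s \<le> t + 1 \<and> t \<le> s + 1"
proof (cases "t \<le> s")
  case True then show ?thesis using max_crossers_eq_iff_le[OF assms True] by auto
next
  case False
  then show ?thesis using max_crossers_eq_iff_le[of t s n] assms by (auto simp: mult.commute)
qed

text \<open>A crossing diagonal joins one of the \<open>b - a - 1\<close> vertices strictly between
  \<open>a\<close> and \<open>b\<close> to a vertex outside; \<open>min\<close> and
  \<open>max\<close> restore the order of its endpoints.\<close>

lemma crossers_product:
  assumes p: "(a, b) \<in> polygon_diagonals N"
  shows "crossers N (a, b) = (\<lambda>(x, y). (min x y, max x y)) ` ({a<..<b} \<times> ({..<a} \<union> {b<..<N}))"
    and "card (crossers N (a, b)) = (b - a - 1) * (N - 2 - (b - a - 1))"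
proof -
  let ?X = "{a<..<b}" and ?Y = "{..<a} \<union> {b<..<N}" and ?f = "\<lambda>(x :: nat, y). (min x y, max x y)"
  have ab: "Suc a < b" "b < N" using p by (auto simp: polygon_diagonals_def)
  show eq: "crossers N (a, b) = ?f ` (?X \<times> ?Y)"
  proof
    show "?f ` (?X \<times> ?Y) \<subseteq> crossers N (a, b)"
      using ab by (auto simp: crossers_def polygon_diagonals_def crossing_def)
    show "crossers N (a, b) \<subseteq> ?f ` (?X \<times> ?Y)"
    proof
      fix e assume "e \<in> crossers N (a, b)"
      then obtain c d where e: "e = (c, d)" and cr: "c < d" "d < N" "a < c \<and> c < b \<and> b < d \<or> c < a \<and> a < d \<and> d < b"
        by (cases e) (auto simp: crossers_def polygon_diagonals_def crossing_def)
      from cr(3) show "e \<in> ?f ` (?X \<times> ?Y)"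
      proof
        assume "a < c \<and> c < b \<and> b < d"
        then show ?thesis using cr e by (intro image_eqI[of _ _ "(c, d)"]) auto
      next
        assume "c < a \<and> a < d \<and> d < b"
        then show ?thesis using cr e by (intro image_eqI[of _ _ "(d, c)"]) auto
      qed
    qed
  qed
  have inj: "inj_on ?f (?X \<times> ?Y)"
    by (auto simp: inj_on_def min_def max_def split: if_splits)
  have "card ?Y = a + (N - b - 1)"
    by (subst card_Un_disjoint) (use ab in auto)
  then have "card (?X \<times> ?Y) = (b - a - 1) * (a + (N - b - 1))"
    by (simp add: card_cartesian_product)
  moreover have "a + (N - b - 1) = N - 2 - (b - a - 1)" using ab by simp
  ultimately show "card (crossers N (a, b)) = (b - a - 1) * (N - 2 - (b - a - 1))"
    unfolding eq using card_image[OF inj] by simp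
qed

lemma central_iff:
  assumes "(a, b) \<in> polygon_diagonals (n + 3)"
  shows "(a, b) \<in> central_diagonals n \<longleftrightarrow>
    b - a - 1 \<le> (n + 1 - (b - a - 1)) + 1 \<and> n + 1 - (b - a - 1) \<le> (b - a - 1) + 1"
proof -
  have "(b - a - 1) + (n + 1 - (b - a - 1)) = n + 1"
    using assms by (auto simp: polygon_diagonals_def)
  from max_crossers_eq_iff[OF this] show ?thesis
    using assms by (simp add: central_diagonals_def crossers_product(2))
qed

text \<open>These are the longest diagonals. For odd \<open>n + 3\<close> every vertex is an
  endpoint of two of them; as ordered pairs they have \<open>m\<close> or \<open>m + 1\<close>
  vertices between their endpoints, hence the two families. For even \<open>n + 3\<close> they join
  opposite vertices.\<close>

lemma card_central_diagonals:
  assumes "n \<ge> 3"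
  shows "card (central_diagonals n) = (if even n then n + 3 else (n + 3) div 2)"
proof (cases "even n")
  case True
  then obtain m where m: "n = 2 * m" by (elim evenE)
  have "central_diagonals n = (\<lambda>a. (a, a + m + 1)) ` {..<m + 2} \<union> (\<lambda>a. (a, a + m + 2)) ` {..<m + 1}" (is "_ = ?A \<union> ?B")
  proof
    show "central_diagonals n \<subseteq> ?A \<union> ?B"
    proof
      fix p assume p: "p \<in> central_diagonals n"
      obtain a b where ab: "p = (a, b)" by (cases p)
      have d: "(a, b) \<in> polygon_diagonals (n + 3)" using p ab by (simp add: central_diagonals_def)
      then have "Suc a < b" "b < n + 3" by (auto simp: polygon_diagonals_def)
      moreover have "b - a - 1 \<le> (n + 1 - (b - a - 1)) + 1 \<and> n + 1 - (b - a - 1) \<le> (b - a - 1) + 1"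
        using central_iff[OF d] p ab by simp
      moreover obtain t where "b = Suc a + t" using \<open>Suc a < b\<close> less_imp_le le_Suc_ex by blast
      ultimately have t: "t \<le> 2 * m + 1 - t + 1" "2 * m + 1 - t \<le> t + 1" "b = Suc a + t" "b < n + 3"
        using m by simp_all
      then have "t = m \<or> t = m + 1" by arith
      then have "b = a + m + 1 \<and> a < m + 2 \<or> b = a + m + 2 \<and> a < m + 1" using t m by auto
      then show "p \<in> ?A \<union> ?B" using ab by auto
    qed
    show "?A \<union> ?B \<subseteq> central_diagonals n"
    proof
      fix p assume "p \<in> ?A \<union> ?B"
      then obtain a b where ab: "p = (a, b)" "b = a + m + 1 \<and> a < m + 2 \<or> b = a + m + 2 \<and> a < m + 1" by auto
      then have d: "(a, b) \<in> polygon_diagonals (n + 3)" using m assms by (auto simp: polygon_diagonals_def)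
      show "p \<in> central_diagonals n" unfolding ab(1) central_iff[OF d] using ab(2) m by auto
    qed
  qed
  moreover have "card (?A \<union> ?B) = card ?A + card ?B" by (rule card_Un_disjoint) auto
  moreover have "card ?A = m + 2" by (subst card_image) (auto simp: inj_on_def)
  moreover have "card ?B = m + 1" by (subst card_image) (auto simp: inj_on_def)
  ultimately show ?thesis using m by simp
next
  case False
  then obtain m where m: "n = 2 * m + 1" by (elim oddE)
  have "central_diagonals n = (\<lambda>a. (a, a + m + 2)) ` {..<m + 2}" (is "_ = ?A")
  proof
    show "central_diagonals n \<subseteq> ?A"
    proof
      fix p assume p: "p \<in> central_diagonals n"
      obtain a b where ab: "p = (a, b)" by (cases p)
      have d: "(a, b) \<in> polygon_diagonals (n + 3)" using p ab by (simp add: central_diagonals_def)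
      then have "Suc a < b" "b < n + 3" by (auto simp: polygon_diagonals_def)
      moreover have "b - a - 1 \<le> (n + 1 - (b - a - 1)) + 1 \<and> n + 1 - (b - a - 1) \<le> (b - a - 1) + 1"
        using central_iff[OF d] p ab by simp
      moreover obtain t where "b = Suc a + t" using \<open>Suc a < b\<close> less_imp_le le_Suc_ex by blast
      ultimately have t: "t \<le> 2 * m + 2 - t + 1" "2 * m + 2 - t \<le> t + 1" "b = Suc a + t" "b < n + 3"
        using m by simp_all
      then have "t = m + 1" by arith
      then have "b = a + m + 2 \<and> a < m + 2" using t m by simp
      then show "p \<in> ?A" using ab by auto
    qed
    show "?A \<subseteq> central_diagonals n"
    proof
      fix p assume "p \<in> ?A"
      then obtain a b where ab: "p = (a, b)" "b = a + m + 2 \<and> a < m + 2" by auto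
      then have d: "(a, b) \<in> polygon_diagonals (n + 3)" using m assms by (auto simp: polygon_diagonals_def)
      show "p \<in> central_diagonals n" unfolding ab(1) central_iff[OF d] using ab(2) m by auto
    qed
  qed
  moreover have "card ?A = m + 2" by (subst card_image) (auto simp: inj_on_def)
  ultimately show ?thesis using m by simp
qed

text \<open>Moving one endpoint of \<open>p'\<close> to another vertex on the same side of
  \<open>p\<close> gives a crosser that shares the other endpoint with \<open>p'\<close> and so does
  not cross it. The two vertices needed between the endpoints of \<open>p\<close> are provided by
  \<open>n \<ge> 3\<close>. Thus \<open>p\<close> is the only possible centre of its star.\<close>

lemma star_unique_center:
  assumes n: "n \<ge> 3" and p: "p \<in> central_diagonals n" and p': "p' \<in> crossers (n + 3) p"
  shows "\<exists>e\<in>crossers (n + 3) p. e \<noteq> p' \<and> \<not> crossing p' e"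
proof -
  obtain a b where ab: "p = (a, b)" by (cases p)
  have d: "(a, b) \<in> polygon_diagonals (n + 3)" using p ab by (simp add: central_diagonals_def)
  then have ab': "Suc a < b" "b < n + 3" by (auto simp: polygon_diagonals_def)
  have c: "b - a - 1 \<le> (n + 1 - (b - a - 1)) + 1 \<and> n + 1 - (b - a - 1) \<le> (b - a - 1) + 1"
    using central_iff[OF d] p ab by simp
  let ?X = "{a<..<b}" and ?Y = "{..<a} \<union> {b<..<n + 3}" and ?f = "\<lambda>(x :: nat, y). (min x y, max x y)"
  have eq: "crossers (n + 3) p = ?f ` (?X \<times> ?Y)" unfolding ab by (rule crossers_product(1)[OF d])
  obtain x y where xy: "x \<in> ?X" "y \<in> ?Y" "p' = ?f (x, y)"
    using p' unfolding eq by (elim imageE SigmaE) simp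
  have "card ?X \<ge> 2" unfolding card_greaterThanLessThan using c ab' n by linarith
  then have "card (?X - {x}) > 0" using xy by simp
  then have "?X - {x} \<noteq> {}" by (metis card.empty less_irrefl)
  then obtain x' where x': "x' \<in> ?X" "x' \<noteq> x" by blast
  let ?e = "?f (x', y)"
  have "?e \<in> crossers (n + 3) p" unfolding eq using x' xy by blast
  moreover have "?e \<noteq> p'" using x' xy by (auto simp: min_def max_def split: if_splits)
  moreover have "\<not> crossing p' ?e" using x' xy by (auto simp: crossing_def min_def max_def)
  ultimately show ?thesis by blast
qed

section \<open>Sets of diagonals that cross each other completely\<close>

definition endpoints :: "(nat \<times> nat) set \<Rightarrow> nat set" where
  "endpoints A = fst ` A \<union> snd ` A"

text \<open>A diagonal crossing all diagonals of \<open>A\<close> separates their endpoints into two classes, and each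
  diagonal of \<open>A\<close> has one endpoint in each class.\<close>

lemma card_le_endpoints:
  assumes A: "A \<subseteq> polygon_diagonals N" and cr: "\<And>a. a \<in> A \<Longrightarrow> crossing a b"
  shows "4 * card A \<le> (card (endpoints A))^2"
proof -
  have fin: "finite A" using finite_subset[OF A finite_polygon_diagonals] .
  define X where "X = endpoints A \<inter> {fst b<..<snd b}"
  define Y where "Y = endpoints A - X"
  have fe: "finite (endpoints A)" using fin by (simp add: endpoints_def)
  then have fXY: "finite X" "finite Y" by (auto simp: X_def Y_def)
  \<comment> \<open>Every diagonal of \<open>A\<close> is turned so that its endpoint in
    \<open>X\<close> comes first; this can be undone because the smaller endpoint of a diagonal is
    listed first.\<close>
  define g where "g a = (if fst a \<in> X then a else (snd a, fst a))" for a
  have "inj_on g A"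
  proof (rule inj_onI)
    fix x y assume xy: "x \<in> A" "y \<in> A" "g x = g y"
    then have "fst x < snd x" "fst y < snd y" using A by (auto simp: polygon_diagonals_def)
    then show "x = y" using xy(3) by (auto simp: g_def prod_eq_iff split: if_splits)
  qed
  moreover have "g ` A \<subseteq> X \<times> Y"
  proof
    fix z assume "z \<in> g ` A"
    then obtain x where x: "x \<in> A" "z = g x" by auto
    have e: "fst x \<in> endpoints A" "snd x \<in> endpoints A" using x by (auto simp: endpoints_def)
    have "crossing x b" using cr x by blast
    then show "z \<in> X \<times> Y" using x(2) e by (auto simp: g_def X_def Y_def crossing_def mem_Times_iff)
  qed
  ultimately have "card A \<le> card (X \<times> Y)"
    by (rule card_inj_on_le) (simp add: fXY)
  then have le: "card A \<le> card X * card Y" by (simp add: card_cartesian_product)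
  have "card (endpoints A) = card X + card Y"
  proof -
    have "endpoints A = X \<union> Y" "X \<inter> Y = {}" by (auto simp: X_def Y_def)
    then show ?thesis using card_Un_disjoint[OF fXY] by simp
  qed
  moreover have "4 * (card X * card Y) \<le> (card X + card Y)^2"
  proof -
    have "int (4 * (card X * card Y)) \<le> int ((card X + card Y)^2)"
      using sum_squares_ge_zero[of "int (card X) - int (card Y)" 0]
      by (simp add: power2_eq_square algebra_simps)
    then show ?thesis by linarith
  qed
  ultimately show ?thesis using le by (metis mult_le_mono2 order_trans)
qed

text \<open>The two sets share no endpoint, so the numbers of endpoints satisfy
  \<open>s + t \<le> n + 3\<close>. If one of them is 2, that set is a single diagonal and the other
  has at most \<open>(n + 1)^2 / 4\<close> elements; otherwise the bound is not reached.\<close>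

lemma crossing_sets_bound:
  assumes n: "n \<ge> 3" and A: "A \<subseteq> polygon_diagonals (n + 3)" "A \<noteq> {}"
    and B: "B \<subseteq> polygon_diagonals (n + 3)" "B \<noteq> {}"
    and cr: "\<And>a b. a \<in> A \<Longrightarrow> b \<in> B \<Longrightarrow> crossing a b"
  shows "card A + card B \<le> max_crossers n + 1"
    and "card A + card B = max_crossers n + 1 \<Longrightarrow> card A = 1 \<or> card B = 1"
proof -
  have fA: "finite A" and fB: "finite B"
    using finite_subset[OF _ finite_polygon_diagonals] A B by auto
  have cA0: "card A > 0" "card B > 0" using fA fB A B by (auto simp: card_gt_0_iff)
  define s where "s = card (endpoints A)" define t where "t = card (endpoints B)"
  obtain a0 b0 where a0: "a0 \<in> A" and b0: "b0 \<in> B" using A B by auto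
  have As: "4 * card A \<le> s^2" unfolding s_def
    by (rule card_le_endpoints[OF A(1), of b0]) (use cr b0 in blast)
  have Bt: "4 * card B \<le> t^2" unfolding t_def
    by (rule card_le_endpoints[OF B(1), of a0]) (use cr a0 crossing_sym in blast)
  have two: "2 \<le> card (endpoints C)" if "C \<subseteq> polygon_diagonals (n + 3)" "c \<in> C" "finite C" for C c
  proof -
    have "{fst c, snd c} \<subseteq> endpoints C" using that by (auto simp: endpoints_def)
    moreover have "card {fst c, snd c} = 2" using that(1,2) by (auto simp: polygon_diagonals_def)
    moreover have "finite (endpoints C)" using that(3) by (simp add: endpoints_def)
    ultimately show ?thesis by (metis card_mono)
  qed
  have s2: "2 \<le> s" and t2: "2 \<le> t" unfolding s_def t_def using two A B a0 b0 fA fB by auto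
  have "endpoints A \<inter> endpoints B = {}"
  proof -
    have "x \<noteq> y" if "x \<in> endpoints A" "y \<in> endpoints B" for x y
    proof -
      obtain a b where "a \<in> A" "x = fst a \<or> x = snd a" "b \<in> B" "y = fst b \<or> y = snd b"
        using \<open>x \<in> endpoints A\<close> \<open>y \<in> endpoints B\<close> by (auto simp: endpoints_def)
      then show ?thesis using cr[of a b] by (auto simp: crossing_def)
    qed
    then show ?thesis by blast
  qed
  moreover have "endpoints A \<union> endpoints B \<subseteq> {..<n + 3}"
    using A B by (fastforce simp: endpoints_def polygon_diagonals_def)
  ultimately have st: "s + t \<le> n + 3"
    using card_Un_disjoint[of "endpoints A" "endpoints B"] card_mono[of "{..<n + 3}" "endpoints A \<union> endpoints B"] fA fB
    by (simp add: s_def t_def endpoints_def)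
  note mc = max_crossers_bounds[of n]
  have small: "card C = 1 \<and> card C' \<le> max_crossers n"
    if "x = 2" "4 * card C \<le> x^2" "4 * card C' \<le> y^2" "x + y \<le> n + 3" "card C > 0" for x y :: nat and C C' :: "(nat \<times> nat) set"
  proof -
    have "y \<le> n + 1" using that by simp
    then have "y^2 \<le> (n + 1)^2" by (intro power_mono) auto
    then have "4 * card C' \<le> 4 * max_crossers n + 1" using that mc by linarith
    then show ?thesis using that by simp
  qed
  have big: "card A + card B < max_crossers n + 1" if "3 \<le> s" "3 \<le> t"
  proof -
    obtain x y where x: "s = 3 + x" and y: "t = 3 + y" using \<open>3 \<le> s\<close> \<open>3 \<le> t\<close> le_Suc_ex by metis
    \<comment> \<open>For a fixed sum the squares are largest at the extremes 3 and
      \<open>3 + x + y\<close>; the difference is \<open>2 * x * y\<close>. For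
      \<open>n \<ge> 3\<close> the resulting \<open>9 + n^2\<close> is at most
      \<open>(n + 1)^2 + 2\<close>.\<close>
    have "s^2 + t^2 \<le> 9 + (3 + x + y)^2" by (simp add: x y power2_eq_square algebra_simps)
    also have "(3 + x + y)^2 \<le> n^2" using st x y by (intro power_mono) auto
    finally have "4 * (card A + card B) \<le> 9 + n^2" using As Bt by simp
    moreover have "(n + 1)^2 = n^2 + 2 * n + 1" by (simp add: power2_eq_square)
    ultimately have "4 * (card A + card B) \<le> 4 * max_crossers n + 3" using mc n by linarith
    then show ?thesis by simp
  qed
  consider "s = 2" | "t = 2" | "3 \<le> s" "3 \<le> t" using s2 t2 by linarith
  then have "card A + card B \<le> max_crossers n + 1 \<and>
      (card A + card B = max_crossers n + 1 \<longrightarrow> card A = 1 \<or> card B = 1)"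
  proof cases
    case 1 then show ?thesis using small[OF 1 As Bt st cA0(1)] by auto
  next
    case 2 then show ?thesis using small[OF 2 Bt As _ cA0(2)] st by auto
  next
    case 3 then show ?thesis using big by auto
  qed
  then show "card A + card B \<le> max_crossers n + 1"
    and "card A + card B = max_crossers n + 1 \<Longrightarrow> card A = 1 \<or> card B = 1" by auto
qed

text \<open>For any \<open>x0\<close> in \<open>U\<close>, the level set of \<open>h\<close> through
  \<open>x0\<close> and its complement cross completely, since \<open>h\<close> agrees on
  noncrossing diagonals. \<open>crossing_sets_bound\<close> then leaves only the extreme size and
  makes one of the two sets a singleton.\<close>

theorem disconnected_diagonals:
  fixes h :: "nat \<times> nat \<Rightarrow> 'k"
  assumes n: "n \<ge> 3" and U: "U \<subseteq> polygon_diagonals (n + 3)" "card U \<ge> max_crossers n + 1"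
    and h: "\<And>x y. x \<in> U \<Longrightarrow> y \<in> U \<Longrightarrow> \<not> crossing x y \<Longrightarrow> h x = h y"
    and nc: "\<not> (\<exists>c. \<forall>x\<in>U. h x = c)"
  shows "card U = max_crossers n + 1"
    and "\<exists>p\<in>central_diagonals n. U = star (n + 3) p \<and> (\<exists>c. \<forall>x\<in>U - {p}. h x = c)"
proof -
  have fU: "finite U" by (rule finite_subset[OF U(1) finite_polygon_diagonals])
  have split: "card U = max_crossers n + 1 \<and>
      (card {x \<in> U. h x = h x0} = 1 \<or> card {x \<in> U. h x \<noteq> h x0} = 1)" if x0: "x0 \<in> U" for x0
  proof -
    define A where "A = {x \<in> U. h x = h x0}" define B where "B = {x \<in> U. h x \<noteq> h x0}"
    have AB: "A \<subseteq> polygon_diagonals (n + 3)" "A \<noteq> {}" "B \<subseteq> polygon_diagonals (n + 3)" "B \<noteq> {}"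
    proof -
      obtain x where "x \<in> U" "h x \<noteq> h x0" using nc by blast
      then have "x \<in> B" by (simp add: B_def)
      then show "B \<noteq> {}" by blast
      have "x0 \<in> A" using x0 by (simp add: A_def)
      then show "A \<noteq> {}" by blast
    qed (use U(1) in \<open>auto simp: A_def B_def\<close>)
    have cr: "crossing a b" if "a \<in> A" "b \<in> B" for a b
      using h[of a b] that unfolding A_def B_def by force
    have "U = A \<union> B" "A \<inter> B = {}" by (auto simp: A_def B_def)
    then have c: "card U = card A + card B" using fU by (auto intro: card_Un_disjoint)
    show ?thesis unfolding A_def[symmetric] B_def[symmetric]
      using crossing_sets_bound[OF n AB cr] c U(2) by linarith
  qed
  obtain x0 where x0: "x0 \<in> U" using nc by auto
  show cU: "card U = max_crossers n + 1" using split[OF x0] by blast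
  have st: "p \<in> central_diagonals n \<and> U = star (n + 3) p"
    if p: "p \<in> U" "\<And>x. x \<in> U \<Longrightarrow> x \<noteq> p \<Longrightarrow> crossing p x" for p
  proof -
    have d: "p \<in> polygon_diagonals (n + 3)" using p U by blast
    obtain a b where ab: "p = (a, b)" by (cases p)
    have f: "finite (crossers (n + 3) p)"
      by (rule finite_subset[OF _ finite_polygon_diagonals[of "n + 3"]]) (auto simp: crossers_def)
    have sub: "U - {p} \<subseteq> crossers (n + 3) p" using p U by (auto simp: crossers_def)
    then have "max_crossers n \<le> card (crossers (n + 3) p)"
      using card_mono[OF f sub] cU p(1) fU by simp
    \<comment> \<open>The same bound for \<open>{p}\<close> and its crossers shows that
      \<open>p\<close> has at most \<open>max_crossers n\<close> of them, so \<open>U\<close>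
      exhausts the star.\<close>
    moreover have "card {p} + card (crossers (n + 3) p) \<le> max_crossers n + 1"
    proof (cases "crossers (n + 3) p = {}")
      case False
      then show ?thesis using d by (intro crossing_sets_bound(1)[OF n]) (auto simp: crossers_def)
    qed simp
    ultimately have c: "card (crossers (n + 3) p) = max_crossers n" by simp
    then have "U - {p} = crossers (n + 3) p"
      using cU p(1) fU by (intro card_subset_eq[OF f sub]) simp
    then show ?thesis using c d p(1) by (auto simp: central_diagonals_def star_def)
  qed
  have key: "\<exists>p\<in>U. (\<forall>x\<in>U. x \<noteq> p \<longrightarrow> crossing p x \<and> h x \<noteq> h p)"
  proof -
    have "card {x \<in> U. h x = h x0} = 1 \<or> card {x \<in> U. h x \<noteq> h x0} = 1" using split[OF x0] by blast
    then obtain p where "{x \<in> U. h x = h x0} = {p} \<or> {x \<in> U. h x \<noteq> h x0} = {p}"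
      by (auto simp: card_1_singleton_iff)
    then have "(\<forall>x. x \<in> U \<and> h x = h x0 \<longleftrightarrow> x = p) \<or> (\<forall>x. x \<in> U \<and> h x \<noteq> h x0 \<longleftrightarrow> x = p)"
      unfolding set_eq_iff by simp
    then have "p \<in> U \<and> (\<forall>x\<in>U. x \<noteq> p \<longrightarrow> h x \<noteq> h p)" by metis
    then show ?thesis using h by metis
  qed
  then obtain p where p: "p \<in> U" "\<And>x. x \<in> U \<Longrightarrow> x \<noteq> p \<Longrightarrow> crossing p x \<and> h x \<noteq> h p" by blast
  have sp: "p \<in> central_diagonals n" "U = star (n + 3) p" using st[of p] p by auto
  \<comment> \<open>Otherwise the split at some \<open>x \<noteq> p\<close> has both
    \<open>p\<close> and \<open>y\<close> on the other side, so \<open>x\<close> is alone in its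
    level set and crosses the rest of \<open>U\<close>. It would be a second centre of the
    star.\<close>
  have "\<exists>c. \<forall>x\<in>U - {p}. h x = c"
  proof (rule ccontr)
    assume nc': "\<not> ?thesis"
    then obtain x where x: "x \<in> U" "x \<noteq> p" by blast
    have "\<not> (\<forall>y\<in>U - {p}. h y = h x)" using nc' by blast
    then obtain y where y: "y \<in> U" "y \<noteq> p" "h y \<noteq> h x" by blast
    have "card {z \<in> U. h z \<noteq> h x} \<noteq> 1"
    proof
      assume "card {z \<in> U. h z \<noteq> h x} = 1"
      then obtain z where "{z \<in> U. h z \<noteq> h x} = {z}" by (auto simp: card_1_singleton_iff)
      moreover have "p \<in> {z \<in> U. h z \<noteq> h x}" "y \<in> {z \<in> U. h z \<noteq> h x}" using p(1) p(2)[OF x] y by auto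
      ultimately show False using y by auto
    qed
    then have "card {z \<in> U. h z = h x} = 1" using split[OF x(1)] by blast
    then obtain x' where x': "{z \<in> U. h z = h x} = {x'}" by (auto simp: card_1_singleton_iff)
    have only: "h z \<noteq> h x" if "z \<in> U" "z \<noteq> x" for z
    proof
      assume "h z = h x"
      then have "z \<in> {x'}" "x \<in> {x'}" using that x unfolding x'[symmetric] by simp_all
      then show False using that by simp
    qed
    have "x \<in> crossers (n + 3) p" using x sp by (auto simp: star_def)
    then obtain e where e: "e \<in> crossers (n + 3) p" "e \<noteq> x" "\<not> crossing x e"
      using star_unique_center[OF n sp(1)] by blast
    then have "e \<in> U" using sp(2) by (simp add: star_def)
    then show False using only e h x by metis
  qed
  then show "\<exists>p\<in>central_diagonals n. U = star (n + 3) p \<and> (\<exists>c. \<forall>x\<in>U - {p}. h x = c)"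
    using sp by blast
qed

text \<open>A second centre of the same star would be a crosser of the first one and would cross all
  the others.\<close>

lemma star_inj: assumes n: "n \<ge> 3" shows "inj_on (star (n + 3)) (central_diagonals n)"
proof (rule inj_onI, rule ccontr)
  fix p p' assume p: "p \<in> central_diagonals n" "p' \<in> central_diagonals n"
    and eq: "star (n + 3) p = star (n + 3) p'" and ne: "p \<noteq> p'"
  have "p' \<in> crossers (n + 3) p" using eq ne by (auto simp: star_def)
  then obtain e where e: "e \<in> crossers (n + 3) p" "e \<noteq> p'" "\<not> crossing p' e"
    using star_unique_center[OF n p(1)] by blast
  then have "e \<in> star (n + 3) p" by (simp add: star_def)
  then have "e \<in> star (n + 3) p'" unfolding eq .
  then show False using e by (auto simp: star_def crossers_def)
qed

lemma card_star: "p \<in> central_diagonals n \<Longrightarrow> card (star (n + 3) p) = max_crossers n + 1"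
proof -
  assume p: "p \<in> central_diagonals n"
  have "finite (crossers (n + 3) p)"
    by (rule finite_subset[OF _ finite_polygon_diagonals[of "n + 3"]]) (auto simp: crossers_def)
  moreover have "p \<notin> crossers (n + 3) p" by (simp add: crossers_def crossing_def)
  ultimately show ?thesis using p by (simp add: star_def central_diagonals_def)
qed

section \<open>Intersections of diagonals of a convex polygon\<close>

text \<open>Twice the signed area of the triangle \<open>p\<close>, \<open>q\<close>,
  \<open>z\<close>: positive if \<open>z\<close> lies to the left of the line directed from
  \<open>p\<close> to \<open>q\<close>.\<close>

definition side :: "complex \<Rightarrow> complex \<Rightarrow> complex \<Rightarrow> real" where
  "side p q z = Im (cnj (q - p) * (z - p))"

lemma side_segment: "side p q ((1 - t) *\<^sub>R x + t *\<^sub>R y) = (1 - t) * side p q x + t * side p q y"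
  by (simp add: side_def algebra_simps)

lemma side_rotate: "side q r p = side p q r"
  by (simp add: side_def algebra_simps)

lemma side_swap: "side q p r = - side p q r"
  by (simp add: side_def algebra_simps)

lemma side_swap': "side p r q = - side p q r"
  by (simp add: side_def algebra_simps)

lemma side_ends [simp]: "side p q p = 0" "side p q q = 0"
  by (simp_all add: side_def algebra_simps)

text \<open>\<open>side p q\<close> is affine, vanishes on the line through \<open>p\<close> and
  \<open>q\<close>, and is positive inside the segment from \<open>x\<close> to
  \<open>y\<close>.\<close>

lemma open_segments_disjoint:
  assumes "side p q x \<ge> 0" "side p q y \<ge> 0" "side p q x > 0 \<or> side p q y > 0"
  shows "open_segment p q \<inter> open_segment x y = {}"
proof -
  have False if z: "z \<in> open_segment p q" "z \<in> open_segment x y" for z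
  proof -
    obtain t where t: "z = (1 - t) *\<^sub>R p + t *\<^sub>R q" using z(1) by (auto simp: in_segment)
    have "side p q z = 0" unfolding t side_segment by simp
    obtain s where s: "0 < s" "s < 1" "z = (1 - s) *\<^sub>R x + s *\<^sub>R y" using z(2) by (auto simp: in_segment)
    have "side p q z > 0" unfolding s(3) side_segment using s(1,2) assms
      by (smt (verit, best) mult_pos_pos mult_nonneg_nonneg)
    then show False using \<open>side p q z = 0\<close> by simp
  qed
  then show ?thesis by blast
qed

text \<open>Along the segment from \<open>x\<close> to \<open>y\<close>, \<open>side p q\<close>
  vanishes at the parameter \<open>t\<close>, so that point is on the line through \<open>p\<close>
  and \<open>q\<close>. As \<open>p\<close> and \<open>q\<close> are on different sides of the line
  through \<open>x\<close> and \<open>y\<close>, it is strictly between them.\<close>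

lemma open_segments_meet:
  assumes "side p q x < 0" "side p q y > 0" "side x y p > 0" "side x y q < 0"
  shows "open_segment p q \<inter> open_segment x y \<noteq> {}"
proof -
  have pq: "p \<noteq> q" "x \<noteq> y" using assms by (auto simp: side_def)
  define t where "t = side p q x / (side p q x - side p q y)"
  have t: "0 < t" "t < 1" using assms by (auto simp: t_def field_simps)
  define z where "z = (1 - t) *\<^sub>R x + t *\<^sub>R y"
  have "side p q z = 0"
    unfolding z_def side_segment t_def using assms by (simp add: field_simps)
  define u where "u = q - p"
  have u: "u \<noteq> 0" using pq by (simp add: u_def)
  \<comment> \<open>The coordinate of \<open>z\<close> along \<open>u\<close>: the product
    \<open>cnj u * (z - p)\<close> is real, so \<open>z - p\<close> is a real multiple of
    \<open>u\<close>.\<close>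
  define s where "s = Re (cnj u * (z - p)) / (cmod u)^2"
  have "cnj u * (z - p) = of_real (Re (cnj u * (z - p)))"
    using \<open>side p q z = 0\<close> by (simp add: complex_eq_iff side_def u_def)
  then have "u * cnj u * (z - p) = u * of_real (Re (cnj u * (z - p)))" by (simp only: mult.assoc)
  then have "of_real ((cmod u)^2) * (z - p) = u * of_real (Re (cnj u * (z - p)))"
    by (simp only: complex_norm_square)
  then have "z - p = of_real s * u" using u by (simp add: s_def field_simps)
  then have zs: "z = (1 - s) *\<^sub>R p + s *\<^sub>R q"
    by (simp add: u_def scaleR_conv_of_real algebra_simps)
  have "side x y z = 0" unfolding z_def side_segment by simp
  then have "(1 - s) * side x y p + s * side x y q = 0" unfolding zs side_segment .
  then have e: "side x y p = s * (side x y p - side x y q)" by (simp add: algebra_simps)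
  have pos: "side x y p - side x y q > 0" using assms by simp
  then have seq: "s = side x y p / (side x y p - side x y q)" using e by (simp add: eq_divide_eq)
  have "0 < s" unfolding seq using pos assms by (intro divide_pos_pos) auto
  moreover have "s < 1" unfolding seq using pos assms by (simp add: divide_less_eq)
  ultimately have "0 < s" "s < 1" by auto
  then have "z \<in> open_segment p q" using zs pq by (auto simp: in_segment)
  moreover have "z \<in> open_segment x y" using t pq z_def by (auto simp: in_segment)
  ultimately show ?thesis by blast
qed

lemma convex_polygon_side:
  assumes w: "convex_polygon N w" and ab: "a < b" "b < N" "k < N"
  shows "a < k \<Longrightarrow> k < b \<Longrightarrow> side (w a) (w b) (w k) < 0"
    and "k < a \<or> b < k \<Longrightarrow> side (w a) (w b) (w k) > 0"
proof -
  have pos: "side (w x) (w y) (w z) > 0" if "x < y" "y < z" "z < N" for x y z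
    using w that unfolding convex_polygon_def side_def by blast
  show "side (w a) (w b) (w k) < 0" if "a < k" "k < b"
    using pos[of a k b] that ab side_swap'[of "w a" "w k" "w b"] by simp
  show "side (w a) (w b) (w k) > 0" if "k < a \<or> b < k"
    using pos[of k a b] pos[of a b k] that ab side_rotate[of "w a" "w b" "w k"] by auto
qed

text \<open>For \<open>D = E\<close> the segments coincide although nothing crosses, hence
  \<open>ne\<close>. Without a crossing, both endpoints of \<open>E\<close> lie on the same closed
  side of \<open>D\<close>, and at least one strictly, as the diagonals differ.\<close>

lemma nonintersecting_iff:
  assumes w: "convex_polygon N w" and D: "D \<in> polygon_diagonals N" and E: "E \<in> polygon_diagonals N"
    and ne: "D \<noteq> E"
  shows "nonintersecting w D E \<longleftrightarrow> \<not> crossing D E"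
proof -
  obtain a b c d where DE: "D = (a, b)" "E = (c, d)" by (cases D, cases E)
  have o: "a < b" "b < N" "c < d" "d < N" using D E by (auto simp: DE polygon_diagonals_def)
  note ab = convex_polygon_side[OF w o(1,2)] and cd = convex_polygon_side[OF w o(3,4)]
  have meet: "open_segment (w a) (w b) \<inter> open_segment (w c) (w d) \<noteq> {}" if "crossing D E"
  proof -
    have "a < c \<and> c < b \<and> b < d \<or> c < a \<and> a < d \<and> d < b" using that by (simp add: crossing_def DE)
    then show ?thesis
    proof
      assume "a < c \<and> c < b \<and> b < d"
      then show ?thesis using o
        by (intro open_segments_meet ab(1) ab(2) cd(1) cd(2)) auto
    next
      assume *: "c < a \<and> a < d \<and> d < b"
      have "open_segment (w c) (w d) \<inter> open_segment (w a) (w b) \<noteq> {}"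
        using * o by (intro open_segments_meet ab(1) ab(2) cd(1) cd(2)) auto
      then show ?thesis by blast
    qed
  qed
  have disj: "open_segment (w a) (w b) \<inter> open_segment (w c) (w d) = {}" if nc: "\<not> crossing D E"
  proof -
    have nn: "\<not> (a = c \<and> b = d)" using ne DE by auto
    have sb: "side (w a) (w b) (w k) \<le> 0" "k \<noteq> a \<Longrightarrow> k \<noteq> b \<Longrightarrow> side (w a) (w b) (w k) < 0" if "a \<le> k" "k \<le> b" for k
    proof -
      show "k \<noteq> a \<Longrightarrow> k \<noteq> b \<Longrightarrow> side (w a) (w b) (w k) < 0" using ab(1)[of k] that o by simp
      then show "side (w a) (w b) (w k) \<le> 0" by (cases "k = a \<or> k = b") auto
    qed
    have so: "side (w a) (w b) (w k) \<ge> 0" "k \<noteq> a \<Longrightarrow> k \<noteq> b \<Longrightarrow> side (w a) (w b) (w k) > 0" if "k \<le> a \<or> b \<le> k" "k < N" for k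
    proof -
      show "k \<noteq> a \<Longrightarrow> k \<noteq> b \<Longrightarrow> side (w a) (w b) (w k) > 0" using ab(2)[of k] that o by auto
      then show "side (w a) (w b) (w k) \<ge> 0" by (cases "k = a \<or> k = b") auto
    qed
    have "(a \<le> c \<and> c \<le> b \<and> a \<le> d \<and> d \<le> b) \<or> ((c \<le> a \<or> b \<le> c) \<and> (d \<le> a \<or> b \<le> d))"
      using nc o by (auto simp: crossing_def DE)
    moreover have ends: "\<not> ((c = a \<or> c = b) \<and> (d = a \<or> d = b))" using nn o by auto
    ultimately show ?thesis
    proof (elim disjE conjE)
      assume i: "a \<le> c" "c \<le> b" "a \<le> d" "d \<le> b"
      \<comment> \<open>Reversing the direction of the first diagonal makes the side of the inner
        vertices the positive one.\<close>
      have "side (w b) (w a) (w c) \<ge> 0" "side (w b) (w a) (w d) \<ge> 0"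
        using sb(1)[OF i(1,2)] sb(1)[OF i(3,4)] by (simp_all add: side_swap[of "w a"])
      moreover have "side (w b) (w a) (w c) > 0 \<or> side (w b) (w a) (w d) > 0"
        using sb(2)[OF i(1,2)] sb(2)[OF i(3,4)] ends by (auto simp: side_swap[of "w a"])
      ultimately have "open_segment (w b) (w a) \<inter> open_segment (w c) (w d) = {}"
        by (rule open_segments_disjoint)
      then show ?thesis by (simp add: open_segment_commute)
    qed (use so[of c] so[of d] ends o in \<open>intro open_segments_disjoint; auto\<close>)+
  qed
  show ?thesis using meet disj by (auto simp: nonintersecting_def DE)
qed

section \<open>The associahedron\<close>

text \<open>Facets carry single diagonals. If two facets meet, their intersection is a face whose
  set of diagonals contains both; conversely, two noncrossing diagonals are the set of a face of
  dimension \<open>n - 2\<close>, which is nonempty and lies in both facets.\<close>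

lemma associahedron_facets:
  fixes P :: "'a::euclidean_space set"
  assumes n: "n \<ge> 3" and P: "associahedron n P"
  obtains f where "bij_betw f (facets P) (polygon_diagonals (n + 3))"
    "\<And>x y. x \<in> facets P \<Longrightarrow> y \<in> facets P \<Longrightarrow> {x, y} \<in> polytope_complex P \<longleftrightarrow> \<not> crossing (f x) (f y)"
    "\<And>x. x \<in> facets P \<Longrightarrow> x \<noteq> {}"
proof -
  obtain w \<delta> where sp: "simple_polytope n P" and w: "convex_polygon (n + 3) w"
    and bij: "\<And>i. i < n \<Longrightarrow> bij_betw \<delta> {H. H face_of P \<and> aff_dim H = int i} (diagonal_sets (n + 3) w (n - i))"
    and sub: "\<And>H H'. H face_of P \<Longrightarrow> H' face_of P \<Longrightarrow> aff_dim H \<in> {0..<int n} \<Longrightarrow> aff_dim H' \<in> {0..<int n} \<Longrightarrow>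
         (H \<subseteq> H' \<longleftrightarrow> \<delta> H' \<subseteq> \<delta> H)"
    using P unfolding associahedron_def by blast
  have pP: "polytope P" and dP: "aff_dim P = int n" using sp by (auto simp: simple_polytope_def)
  have fac: "facets P = {H. H face_of P \<and> aff_dim H = int (n - 1)}"
  proof -
    have "F facet_of P \<longleftrightarrow> F face_of P \<and> aff_dim F = int (n - 1)" for F
      using n dP by (auto simp: facet_of_def of_nat_diff aff_dim_empty)
    then show ?thesis by (simp add: facets_def)
  qed
  have dfac: "H face_of P" "aff_dim H = int (n - 1)" "aff_dim H \<in> {0..<int n}" if "H \<in> facets P" for H
    using that n by (auto simp: fac)
  have b1: "bij_betw \<delta> (facets P) (diagonal_sets (n + 3) w 1)"
    using bij[of "n - 1"] n by (simp add: fac)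
  have ds1: "diagonal_sets (n + 3) w 1 = (\<lambda>d. {d}) ` polygon_diagonals (n + 3)"
    by (auto simp: diagonal_sets_def card_1_singleton_iff pairwise_def)
  define f where "f H = the_elem (\<delta> H)" for H
  have \<delta>f: "\<delta> H = {f H} \<and> f H \<in> polygon_diagonals (n + 3)" if HP: "H \<in> facets P" for H
  proof -
    have "\<delta> H \<in> (\<lambda>d. {d}) ` polygon_diagonals (n + 3)"
      using bij_betw_apply[OF b1 HP] unfolding ds1 .
    then obtain d where "\<delta> H = {d}" "d \<in> polygon_diagonals (n + 3)" by (rule imageE)
    then show ?thesis by (simp add: f_def)
  qed
  have "inj_on f (facets P)"
  proof (rule inj_onI)
    fix x y assume "x \<in> facets P" "y \<in> facets P" "f x = f y"
    then show "x = y" using \<delta>f[of x] \<delta>f[of y] inj_onD[OF bij_betw_imp_inj_on[OF b1], of x y] by simp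
  qed
  moreover have "f ` facets P = polygon_diagonals (n + 3)"
  proof
    show "polygon_diagonals (n + 3) \<subseteq> f ` facets P"
    proof
      fix d assume "d \<in> polygon_diagonals (n + 3)"
      then have "{d} \<in> \<delta> ` facets P" unfolding bij_betw_imp_surj_on[OF b1] ds1 by blast
      then obtain H where H: "H \<in> facets P" "{d} = \<delta> H" by (rule imageE)
      then have "f H = d" by (simp add: f_def flip: H(2))
      then show "d \<in> f ` facets P" using H(1) by (rule image_eqI[OF sym])
    qed
  qed (use \<delta>f in blast)
  ultimately have "bij_betw f (facets P) (polygon_diagonals (n + 3))" by (simp add: bij_betw_def)
  moreover have nonempty: "x \<noteq> {}" if "x \<in> facets P" for x
    using dfac(2)[OF that] by auto
  moreover have "{x, y} \<in> polytope_complex P \<longleftrightarrow> \<not> crossing (f x) (f y)"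
    if x: "x \<in> facets P" and y: "y \<in> facets P" for x y
  proof (cases "x = y")
    case True
    then show ?thesis using nonempty[OF x] x by (simp add: polytope_complex_def crossing_def)
  next
    case False
    then have fne: "f x \<noteq> f y" 
      using \<delta>f[OF x] \<delta>f[OF y] inj_onD[OF bij_betw_imp_inj_on[OF b1], of x y] x y by auto
    have ni: "nonintersecting w (f x) (f y) \<longleftrightarrow> \<not> crossing (f x) (f y)"
      by (rule nonintersecting_iff[OF w]) (use \<delta>f x y fne in auto)
    have iff: "{x, y} \<in> polytope_complex P \<longleftrightarrow> x \<inter> y \<noteq> {}" using x y by (simp add: polytope_complex_def)
    show ?thesis
    proof
      assume "{x, y} \<in> polytope_complex P"
      then have xy: "x \<inter> y \<noteq> {}" using iff by simp
      have face: "(x \<inter> y) face_of P" using dfac(1) x y by (intro face_of_Int)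
      have le: "aff_dim (x \<inter> y) \<le> aff_dim x" by (rule aff_dim_subset) blast
      have ge: "aff_dim (x \<inter> y) \<ge> 0"
        using xy aff_dim_geq[of "x \<inter> y"] aff_dim_empty[of "x \<inter> y"] by linarith
      have r: "aff_dim (x \<inter> y) \<in> {0..<int n}" using le ge dfac(3)[OF x] by auto
      then obtain i where i: "i < n" "aff_dim (x \<inter> y) = int i"
        using that[of "nat (aff_dim (x \<inter> y))"] by simp
      have "\<delta> (x \<inter> y) \<in> diagonal_sets (n + 3) w (n - i)"
        by (rule bij_betw_apply[OF bij[OF i(1)]]) (use face i(2) in simp)
      then have pw: "pairwise (nonintersecting w) (\<delta> (x \<inter> y))" by (simp add: diagonal_sets_def)
      have "\<delta> x \<subseteq> \<delta> (x \<inter> y)" "\<delta> y \<subseteq> \<delta> (x \<inter> y)"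
        using sub[OF face dfac(1)[OF x] r dfac(3)[OF x]] sub[OF face dfac(1)[OF y] r dfac(3)[OF y]] by blast+
      then have "f x \<in> \<delta> (x \<inter> y)" "f y \<in> \<delta> (x \<inter> y)" using \<delta>f[OF x] \<delta>f[OF y] by auto
      then have "nonintersecting w (f x) (f y)" using pw fne by (simp add: pairwise_def)
      then show "\<not> crossing (f x) (f y)" using ni by simp
    next
      assume nc: "\<not> crossing (f x) (f y)"
      then have nc': "\<not> crossing (f y) (f x)" using crossing_sym by blast
      have "nonintersecting w (f y) (f x) \<longleftrightarrow> \<not> crossing (f y) (f x)"
        by (rule nonintersecting_iff[OF w]) (use \<delta>f x y fne in auto)
      then have "{f x, f y} \<in> diagonal_sets (n + 3) w (n - (n - 2))"
        using ni nc nc' fne \<delta>f[OF x] \<delta>f[OF y] n by (auto simp: diagonal_sets_def pairwise_def)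
      moreover have "n - 2 < n" using n by simp
      ultimately have "{f x, f y} \<in> \<delta> ` {H. H face_of P \<and> aff_dim H = int (n - 2)}"
        using bij_betw_imp_surj_on[OF bij[of "n - 2"]] by simp
      then obtain H where H: "H face_of P" "aff_dim H = int (n - 2)" "\<delta> H = {f x, f y}" by auto
      have r: "aff_dim H \<in> {0..<int n}" using H(2) n by simp
      have "H \<subseteq> x" "H \<subseteq> y"
        using sub[OF H(1) dfac(1)[OF x] r dfac(3)[OF x]] sub[OF H(1) dfac(1)[OF y] r dfac(3)[OF y]]
          H(3) \<delta>f[OF x] \<delta>f[OF y] by auto
      moreover have "H \<noteq> {}" using H(2) by auto
      ultimately show "{x, y} \<in> polytope_complex P" using iff by blast
    qed
  qed
  ultimately show ?thesis using that by blast
qed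

text \<open>Facets are translated to diagonals by \<open>f\<close> and back by \<open>g\<close>. As
  \<open>M = 0\<close> for \<open>i > max_crossers n\<close>, one application of the linear strand
  gives the vanishing as well.\<close>

lemma associahedron_linear_betti:
  fixes P :: "'a::euclidean_space set"
  assumes n: "n \<ge> 3" and P: "associahedron n P" and i: "i \<ge> max_crossers n"
  shows "bigraded_betti TYPE('k::field) P i (2 * (i + 1)) =
    (if i = max_crossers n then card (central_diagonals n) else 0)"
proof -
  obtain f where f: "bij_betw f (facets P) (polygon_diagonals (n + 3))"
    and edge: "\<And>x y. x \<in> facets P \<Longrightarrow> y \<in> facets P \<Longrightarrow> {x, y} \<in> polytope_complex P \<longleftrightarrow> \<not> crossing (f x) (f y)"
    and ne: "\<And>x. x \<in> facets P \<Longrightarrow> x \<noteq> {}"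
    using associahedron_facets[OF n P] by blast
  define M where "M = (if i = max_crossers n then card (central_diagonals n) else 0)"
  have cd: "central_diagonals n \<subseteq> polygon_diagonals (n + 3)" by (auto simp: central_diagonals_def)
  have "finite (central_diagonals n)" by (rule finite_subset[OF cd finite_polygon_diagonals])
  then obtain c where c: "bij_betw c {..<card (central_diagonals n)} (central_diagonals n)"
    using ex_bij_betw_nat_finite[of "central_diagonals n"] by (auto simp: atLeast0LessThan)
  define g where "g = inv_into (facets P) f"
  have gf: "g (f x) = x" if "x \<in> facets P" for x
    using that f by (simp add: g_def bij_betw_inv_into_left)
  have fg: "f (g d) = d" "g d \<in> facets P" if "d \<in> polygon_diagonals (n + 3)" for d
    using that f bij_betw_apply[OF bij_betw_inv_into[OF f] that]
    by (simp_all add: g_def bij_betw_inv_into_right)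
  have ginj: "inj_on g (polygon_diagonals (n + 3))" by (rule inj_on_inverseI) (rule fg(1))
  have star_sub: "star (n + 3) p \<subseteq> polygon_diagonals (n + 3)" if "p \<in> central_diagonals n" for p
    using that cd by (auto simp: star_def crossers_def)
  have M: "k < card (central_diagonals n)" "i = max_crossers n" if "k < M" for k
    using that by (simp_all add: M_def split: if_splits)
  have ck: "c k \<in> central_diagonals n" if "k < M" for k
    using bij_betw_apply[OF c] M(1)[OF that] by simp
  have "tor_dim (facets P) (face_ideal (facets P) (polytope_complex P) :: ('a set, 'k) mpoly set) i (2 * (i + 1)) = M"
  proof (rule tor_dim_linear_strand)
    show "finite (facets P)"
      using P by (simp add: associahedron_def simple_polytope_def facets_def finite_polytope_facets)
    show "{} \<in> polytope_complex P" by (simp add: polytope_complex_def)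
    show "{v} \<in> polytope_complex P" if "v \<in> facets P" for v
      using ne[OF that] that by (simp add: polytope_complex_def)
    show "T \<in> polytope_complex P" if "S \<in> polytope_complex P" "T \<subseteq> S" for S T
      using that Inter_anti_mono[OF that(2)] unfolding polytope_complex_def by blast
    \<comment> \<open>Positivity of \<open>max_crossers n\<close> follows from
      \<open>(n + 1)^2 \<le> 4 * max_crossers n + 1\<close>.\<close>
    have "16 \<le> (n + 1)^2" using power_mono[of 4 "n + 1" 2] n by simp
    then show "i > 0" using max_crossers_bounds[of n] i by linarith
  next
    fix k assume k: "k < M"
    have s: "star (n + 3) (c k) \<subseteq> polygon_diagonals (n + 3)" by (rule star_sub[OF ck[OF k]])
    have p: "c k \<in> polygon_diagonals (n + 3)" using ck[OF k] cd by blast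
    show "g ` star (n + 3) (c k) \<subseteq> facets P \<and> card (g ` star (n + 3) (c k)) = Suc i \<and>
      g (c k) \<in> g ` star (n + 3) (c k) \<and>
      (\<forall>y\<in>g ` star (n + 3) (c k) - {g (c k)}. {g (c k), y} \<notin> polytope_complex P)"
    proof (intro conjI ballI)
      show "g ` star (n + 3) (c k) \<subseteq> facets P" using s fg(2) by blast
      show "card (g ` star (n + 3) (c k)) = Suc i"
        using card_image[OF inj_on_subset[OF ginj s]] card_star[OF ck[OF k]] M(2)[OF k] by simp
      show "g (c k) \<in> g ` star (n + 3) (c k)" by (simp add: star_def)
      fix y assume y: "y \<in> g ` star (n + 3) (c k) - {g (c k)}"
      then obtain d where d: "d \<in> star (n + 3) (c k)" "y = g d" "d \<noteq> c k" by blast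
      then have "crossing (c k) d" "d \<in> polygon_diagonals (n + 3)" by (auto simp: star_def crossers_def)
      then show "{g (c k), y} \<notin> polytope_complex P"
        using edge[OF fg(2)[OF p] fg(2)[of d]] fg(1)[OF p] fg(1)[of d] d(2) by simp
    qed
  next
    show "inj_on (\<lambda>k. g ` star (n + 3) (c k)) {..<M}"
    proof (rule inj_onI)
      fix k l assume k: "k \<in> {..<M}" "l \<in> {..<M}" and eq: "g ` star (n + 3) (c k) = g ` star (n + 3) (c l)"
      then have cc: "c k \<in> central_diagonals n" "c l \<in> central_diagonals n" using ck by auto
      have "star (n + 3) (c k) = star (n + 3) (c l)"
        using eq inj_on_image_eq_iff[OF ginj star_sub[OF cc(1)] star_sub[OF cc(2)]] by simp
      then have "c k = c l" using inj_onD[OF star_inj[OF n]] cc by blast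
      then show "k = l" using inj_onD[OF bij_betw_imp_inj_on[OF c], of k l] k M(1) by auto
    qed
  next
    fix U and h :: "'a set \<Rightarrow> 'k"
    assume U: "U \<subseteq> facets P" "card U = Suc i"
      and h: "\<And>x y. x \<in> U \<Longrightarrow> y \<in> U \<Longrightarrow> {x, y} \<in> polytope_complex P \<Longrightarrow> h x = h y"
    have inj: "inj_on f U" using inj_on_subset[OF bij_betw_imp_inj_on[OF f] U(1)] .
    have Uf: "f ` U \<subseteq> polygon_diagonals (n + 3)" using U(1) bij_betw_imp_surj_on[OF f] by blast
    have cU: "card (f ` U) = Suc i" using card_image[OF inj] U(2) by simp
    have gfU: "g ` f ` U = U" using U(1) gf by (force simp: image_image)
    have "\<exists>k<M. U = g ` star (n + 3) (c k) \<and> (\<exists>c'. \<forall>x\<in>U - {g (c k)}. h x = c')"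
      if nc: "\<not> (\<exists>c. \<forall>x\<in>U. h x = c)"
    proof -
      have nc': "\<not> (\<exists>c. \<forall>d\<in>f ` U. h (g d) = c)"
      proof
        assume "\<exists>c. \<forall>d\<in>f ` U. h (g d) = c"
        then obtain c where "\<And>x. x \<in> U \<Longrightarrow> h (g (f x)) = c" by blast
        then have "\<forall>x\<in>U. h x = c" using gf U(1) by (metis subsetD)
        then show False using nc by blast
      qed
      have hd: "h (g d) = h (g e)" if de: "d \<in> f ` U" "e \<in> f ` U" "\<not> crossing d e" for d e
      proof -
        obtain x y where "x \<in> U" "d = f x" "y \<in> U" "e = f y" using de(1,2) by blast
        then show ?thesis using edge[of x y] h[of x y] de(3) gf U(1) by (simp add: subset_iff)
      qed
      have le: "max_crossers n + 1 \<le> card (f ` U)" using cU i by simp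
      note dd = disconnected_diagonals[OF n Uf le, of "\<lambda>d. h (g d)", OF hd nc']
      \<comment> \<open>A nonconstant \<open>h\<close> forces the extreme size, so for larger
        \<open>i\<close> every admissible \<open>h\<close> is constant.\<close>
      have iM: "i = max_crossers n" using dd(1) cU by simp
      obtain p c' where p: "p \<in> central_diagonals n" "f ` U = star (n + 3) p" "\<And>d. d \<in> f ` U - {p} \<Longrightarrow> h (g d) = c'"
        using dd(2) by blast
      obtain k where k: "k < card (central_diagonals n)" "c k = p"
        using bij_betw_imp_surj_on[OF c] p(1) by (metis imageE lessThan_iff)
      have kM: "k < M" using k iM by (simp add: M_def)
      have UW: "U = g ` star (n + 3) (c k)" using gfU p(2) k(2) by simp
      have hc: "h x = c'" if "x \<in> U - {g (c k)}" for x
        using p(3)[of "f x"] that gf[of x] U(1) k(2) by (cases "f x = p") auto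
      have "\<forall>x\<in>U - {g (c k)}. h x = c'" by (rule ballI) (rule hc)
      then show ?thesis using kM UW by (intro exI[of _ k] exI[of _ c'] conjI)
    qed
    then show "(\<exists>c. \<forall>x\<in>U. h x = c) \<or>
      (\<exists>k<M. U = g ` star (n + 3) (c k) \<and> (\<exists>c'. \<forall>x\<in>U - {g (c k)}. h x = c'))" by blast
  qed
  then show ?thesis by (simp add: bigraded_betti_def M_def)
qed


theorem theorem2p9:
  fixes P :: "'a::euclidean_space set" and n q :: nat
  assumes "n \<ge> 3"
    and "associahedron n P"
    and "q = (if even n then n * (n + 2) div 4 else (n + 1) ^ 2 div 4)"
  shows "bigraded_betti TYPE('k::field) P q (2 * (q + 1)) =
           (if even n then n + 3 else (n + 3) div 2) \<and>
         (\<forall>i \<ge> q + 1. bigraded_betti TYPE('k) P i (2 * (i + 1)) = 0)"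
proof -
  have q: "q = max_crossers n" using assms(3) by (simp add: max_crossers_def)
  show ?thesis
    using associahedron_linear_betti[OF assms(1,2), where 'k = 'k] card_central_diagonals[OF assms(1)]
    unfolding q by simp
qed

end
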